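(* Let $g=1+\sum_{|\alpha|\ge1}b_\alpha Z_\alpha$ be an admissible free holomorphic function and let ${\bf W}=(W_1,\ldots,W_n)$ be the weighted left creation operators associated with $g$, such that the series $\sum_{k=0}^\infty\sum_{|\alpha|=k}a_\alpha W_\alpha W_\alpha^*$ is convergent in the operator norm topology, where $g^{-1}=1+\sum_{|\alpha|\ge1}a_\alpha Z_\alpha$. Let $\pi$ be a unital $*$-representation of the $C^*$-algebra $C^*({\bf W})$ on a separable Hilbert space $\mathcal K$ and set $V_i:=\pi(W_i)$, $V:=(V_1,\ldots,V_n)$. Then the noncommutative Berezin kernel $K_{g,V}$ is a partial isometry. Setting $$\mathcal K^{(0)}:=\mathrm{range}\,K_{g,V}^*\quad\text{and}\quad\mathcal K^{(1)}:=\ker K_{g,V},$$ the orthogonal decomposition $\mathcal K=\mathcal K^{(0)}\oplus\mathcal K^{(1)}$ has the following properties. (i) $\mathcal K^{(0)}$ and $\mathcal K^{(1)}$ are reducing subspaces for each operator $V_i$. (ii) $V|_{\mathcal K^{(0)}}:=(V_1|_{\mathcal K^{(0)}},\ldots,V_n|_{\mathcal K^{(0)}})$ is a pure tuple in $\mathcal D_{g^{-1}}(\mathcal K^{(0)})$. (iii) $V|_{\mathcal K^{(1)}}:=(V_1|_{\mathcal K^{(1)}},\ldots,V_n|_{\mathcal K^{(1)}})$ is a Cuntz tuple in $\mathcal D_{g^{-1}}(\mathcal K^{(1)})$. Moreover, the Berezin kernel restricted to $\mathcal K^{(0)}$, $K_{g,V}|_{\mathcal K^{(0)}}$, is a unitary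 operator (onto $F^2(H_n)\otimes\mathcal D$) satisfying $$V_i|_{\mathcal K^{(0)}}=\big(K_{g,V}|_{\mathcal K^{(0)}}\big)^*(W_i\otimes I_{\mathcal D})\big(K_{g,V}|_{\mathcal K^{(0)}}\big),\qquad i\in\{1,\ldots,n\},$$ where $\mathcal D:=\mathrm{range}\,\Delta_{g^{-1}}(V,V^* )$ and $\Delta_{g^{-1}}(V,V^* )$ is an orthogonal projection. In addition, the orthogonal decomposition of $\mathcal K$ is uniquely determined by the properties (i), (ii), and (iii), and we have $$\mathcal K^{(0)}=\bigoplus_{\alpha\in\mathbb F_n^+}V_\alpha(\mathcal D),\quad\text{where}\quad\mathcal D=\mathcal K\ominus\Big(\bigoplus_{i=1}^n\overline{V_i\mathcal K}\Big),$$ and $$\mathcal K^{(1)}=\bigcap_{s=0}^\infty\Big(\bigoplus_{\alpha\in\mathbb F_n^+,|\alpha|=s}\overline{V_\alpha(\mathcal K)}\Big).$$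
   Context: $\mathbb F_n^+$ is the unital free semigroup on generators $g_1,\ldots,g_n$ with identity $g_0$, and $|\alpha|$ is the length of $\alpha$. For $\alpha=g_{i_1}\cdots g_{i_k}$, $X_\alpha:=X_{i_1}\cdots X_{i_k}$, $X_{g_0}:=I$. $F^2(H_n)$ is the full Fock space with orthonormal basis $\{e_\alpha\}_{\alpha\in\mathbb F_n^+}$, $e_\alpha=e_{i_1}\otimes\cdots\otimes e_{i_k}$, $e_{g_0}=1$. A formal power series $\sum_\alpha c_\alpha Z_\alpha$ in noncommuting indeterminates is a free holomorphic function in a neighborhood of the origin if there is $\rho>0$ such that $\sum_{k}\sum_{|\alpha|=k}c_\alpha X_\alpha$ converges in norm for every Hilbert space $\mathcal H$ and every $X\in B(\mathcal H)^n$ with $\|\sum_iX_iX_i^*\|^{1/2}\le\rho$; equivalently $\limsup_k(\sum_{|\alpha|=k}|c_\alpha|^2)^{1/2k}<\infty$. $g$ is admissible if: (a) $b_{g_0}=1$, all $b_\alpha>0$, and $\sup_\alpha b_\alpha/b_{g_i\alpha}<\infty$ for each $i$; (b) $g$ is free holomorphic in a neighborhood of the origin; (c) $\sup_{k}\big\|\sum_{p=0}^k\sum_{|\alpha|=p}a_\alpha W_\alpha W_\alpha^*\big\|<\infty$, where $g^{-1}=1+\sum_{|\alpha|\ge1}a_\alpha Z_\alpha$ is the inverse power series ($a_{g_0}=1$) and $W_ie_\alpha=\sqrt{b_\alpha/b_{g_i\alpha}}\,e_{g_i\alpha}$ are the weighted left creation operators on $F^2(H_n)$. $C^*({\bf W})$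 is the $C^*$-algebra generated by $W_1,\ldots,W_n$ and the identity. $\mathcal D_{g^{-1}}(\mathcal H)$ is the set of all $X\in B(\mathcal H)^n$ such that (1) $\Delta_{g^{-1}}(X,X^* ):=\sum_{p=0}^\infty\sum_{|\alpha|=p}a_\alpha X_\alpha X_\alpha^*$ converges in the weak operator topology and is $\ge0$; (2) $\sum_{\alpha}b_\alpha X_\alpha\Delta_{g^{-1}}(X,X^* )X_\alpha^*\le I$ (WOT convergence). $X\in\mathcal D_{g^{-1}}(\mathcal H)$ is pure if equality holds in (2), and is a Cuntz tuple if $\Delta_{g^{-1}}(X,X^* )=0$. The noncommutative Berezin kernel of $X\in\mathcal D_{g^{-1}}(\mathcal H)$ is $K_{g,X}:\mathcal H\to F^2(H_n)\otimes\overline{\Delta_{g^{-1}}(X,X^* )\mathcal H}$, $K_{g,X}h:=\sum_{\alpha}\sqrt{b_\alpha}\,e_\alpha\otimes\Delta_{g^{-1}}(X,X^* )^{1/2}X_\alpha^*h$. (For $V$ as in the statement, part of what is asserted is that $V\in\mathcal D_{g^{-1}}(\mathcal K)$, so that $K_{g,V}$ is defined.) *)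

theory Defs
  imports "HOL-Analysis.Analysis" "HOL-Library.Nonpos_Ints"
begin

section \<open>Complex Hilbert spaces\<close>

text \<open>
  The inner product \<open>cinner\<close> is linear in its first argument; its real part is the
  inner product of the underlying real Hilbert space.
\<close>

class chilbert_space = real_inner + complete_space +
  fixes scaleC :: "complex \<Rightarrow> 'a \<Rightarrow> 'a" (infixr "*\<^sub>C" 75)
    and cinner :: "'a \<Rightarrow> 'a \<Rightarrow> complex"
  assumes scaleC_add_right: "c *\<^sub>C (x + y) = c *\<^sub>C x + c *\<^sub>C y"
    and scaleC_add_left: "(c + d) *\<^sub>C x = c *\<^sub>C x + d *\<^sub>C x"
    and scaleC_scaleC: "c *\<^sub>C d *\<^sub>C x = (c * d) *\<^sub>C x"
    and scaleC_of_real: "complex_of_real r *\<^sub>C x = r *\<^sub>R x"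
    and cinner_commute: "cinner y x = cnj (cinner x y)"
    and cinner_add_left: "cinner (x + y) z = cinner x z + cinner y z"
    and cinner_scaleC_left: "cinner (c *\<^sub>C x) y = c * cinner x y"
    and Re_cinner: "Re (cinner x y) = inner x y"

lemma scaleC_one: "1 *\<^sub>C x = (x :: 'a::chilbert_space)"
  using scaleC_of_real[of 1 x] by simp

interpretation complex_vector: vector_space "scaleC :: complex \<Rightarrow> 'a \<Rightarrow> 'a::chilbert_space"
  by unfold_locales (simp_all add: scaleC_add_right scaleC_add_left scaleC_scaleC scaleC_one)

abbreviation csubspace :: "'a::chilbert_space set \<Rightarrow> bool"
  where "csubspace \<equiv> module.subspace scaleC"

abbreviation cspan :: "'a::chilbert_space set \<Rightarrow> 'a set"
  where "cspan \<equiv> module.span scaleC"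

lemma cinner_scaleC_right: "cinner x (c *\<^sub>C y) = cnj c * cinner x (y :: 'a::chilbert_space)"
  by (metis cinner_commute cinner_scaleC_left complex_cnj_mult)

lemma cinner_self: "cinner x x = complex_of_real ((norm (x :: 'a::chilbert_space))\<^sup>2)"
proof -
  have "Im (cinner x x) = 0"
    using cinner_commute[of x x] by (simp add: complex_eq_iff)
  then show ?thesis
    by (simp add: complex_eq_iff Re_cinner dot_square_norm)
qed

lemma norm_scaleC: "norm (c *\<^sub>C x) = cmod c * norm (x :: 'a::chilbert_space)"
proof -
  have "complex_of_real ((norm (c *\<^sub>C x))\<^sup>2) = c * cnj c * complex_of_real ((norm x)\<^sup>2)"
    by (simp only: cinner_self[symmetric] cinner_scaleC_left cinner_scaleC_right mult.assoc
        mult.left_commute)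
  also have "\<dots> = complex_of_real ((cmod c * norm x)\<^sup>2)"
    by (simp add: complex_norm_square[symmetric] power_mult_distrib)
  finally have "(norm (c *\<^sub>C x))\<^sup>2 = (cmod c * norm x)\<^sup>2"
    by (simp only: of_real_eq_iff)
  then show ?thesis
    by (rule power2_eq_imp_eq) simp_all
qed

instantiation complex :: chilbert_space
begin

definition scaleC_complex :: "complex \<Rightarrow> complex \<Rightarrow> complex"
  where "scaleC_complex c x = c * x"

definition cinner_complex :: "complex \<Rightarrow> complex \<Rightarrow> complex"
  where "cinner_complex x y = x * cnj y"

instance
  by standard
    (simp_all add: scaleC_complex_def cinner_complex_def inner_complex_def algebra_simps
      scaleR_conv_of_real)

end


section \<open>Square-summable families and the full Fock space\<close>

typedef (overloaded) ('i, 'a::chilbert_space) ell2 =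
  "{f :: 'i \<Rightarrow> 'a. (\<lambda>i. (norm (f i))\<^sup>2) summable_on UNIV}"
  by (rule exI[of _ "\<lambda>_. 0"]) simp

setup_lifting type_definition_ell2

lemma ell2_add_summable:
  fixes f g :: "'i \<Rightarrow> 'a::real_inner"
  assumes "(\<lambda>i. (norm (f i))\<^sup>2) summable_on UNIV" "(\<lambda>i. (norm (g i))\<^sup>2) summable_on UNIV"
  shows "(\<lambda>i. (norm (f i + g i))\<^sup>2) summable_on UNIV"
proof (rule summable_on_comparison_test)
  show "(\<lambda>i. 2 * (norm (f i))\<^sup>2 + 2 * (norm (g i))\<^sup>2) summable_on UNIV"
    by (intro summable_on_add summable_on_cmult_right assms)
  fix i
  have "(norm (f i + g i))\<^sup>2 + (norm (f i - g i))\<^sup>2 = 2 * (norm (f i))\<^sup>2 + 2 * (norm (g i))\<^sup>2"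
    by (simp add: power2_norm_eq_inner inner_add_left inner_add_right inner_diff_left inner_diff_right)
  then show "(norm (f i + g i))\<^sup>2 \<le> 2 * (norm (f i))\<^sup>2 + 2 * (norm (g i))\<^sup>2"
    using zero_le_power2[of "norm (f i - g i)"] by linarith
qed auto

lemma ell2_inner_summable:
  fixes f g :: "'i \<Rightarrow> 'a::real_inner"
  assumes "(\<lambda>i. (norm (f i))\<^sup>2) summable_on UNIV" "(\<lambda>i. (norm (g i))\<^sup>2) summable_on UNIV"
  shows "(\<lambda>i. inner (f i) (g i)) summable_on UNIV"
proof -
  have "(\<lambda>i. norm (inner (f i) (g i))) summable_on UNIV"
  proof (rule summable_on_comparison_test)
    show "(\<lambda>i. (norm (f i))\<^sup>2 + (norm (g i))\<^sup>2) summable_on UNIV"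
      by (intro summable_on_add assms)
    fix i
    have "norm (inner (f i) (g i)) \<le> norm (f i) * norm (g i)"
      by (simp add: Cauchy_Schwarz_ineq2)
    also have "\<dots> \<le> (norm (f i))\<^sup>2 + (norm (g i))\<^sup>2"
      using sum_squares_bound[of "norm (f i)" "norm (g i)"]
        mult_nonneg_nonneg[OF norm_ge_zero[of "f i"] norm_ge_zero[of "g i"]] by linarith
    finally show "norm (inner (f i) (g i)) \<le> (norm (f i))\<^sup>2 + (norm (g i))\<^sup>2" .
  qed auto
  then show ?thesis
    by (rule abs_summable_summable)
qed

lemma ell2_cinner_summable:
  fixes f g :: "'i \<Rightarrow> 'a::chilbert_space"
  assumes "(\<lambda>i. (norm (f i))\<^sup>2) summable_on UNIV" "(\<lambda>i. (norm (g i))\<^sup>2) summable_on UNIV"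
  shows "(\<lambda>i. cinner (f i) (g i)) summable_on UNIV"
proof -
  have im: "(\<lambda>i. inner (- \<i> *\<^sub>C f i) (g i)) summable_on UNIV"
    using assms by (intro ell2_inner_summable) (simp_all only: norm_scaleC norm_minus_cancel norm_ii mult_1)
  have "(\<lambda>i. complex_of_real (inner (f i) (g i)) +
      \<i> * complex_of_real (inner (- \<i> *\<^sub>C f i) (g i))) summable_on UNIV"
    by (intro summable_on_add summable_on_cmult_right summable_on_of_real im
        ell2_inner_summable[OF assms])
  moreover have "complex_of_real (inner x y) + \<i> * complex_of_real (inner (- \<i> *\<^sub>C x) y) = cinner x y"
    for x y :: 'a
  proof -
    have "inner (- \<i> *\<^sub>C x) y = Re (- \<i> * cinner x y)"
      by (simp only: Re_cinner[symmetric] cinner_scaleC_left)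
    then show ?thesis
      by (simp add: Re_cinner[symmetric] complex_eq_iff)
  qed
  ultimately show ?thesis
    by simp
qed

instantiation ell2 :: (type, chilbert_space) real_vector
begin

lift_definition zero_ell2 :: "('a, 'b) ell2" is "\<lambda>_. 0" by simp
lift_definition plus_ell2 :: "('a, 'b) ell2 \<Rightarrow> ('a, 'b) ell2 \<Rightarrow> ('a, 'b) ell2"
  is "\<lambda>f g i. f i + g i" by (rule ell2_add_summable)
lift_definition uminus_ell2 :: "('a, 'b) ell2 \<Rightarrow> ('a, 'b) ell2"
  is "\<lambda>f i. - f i" by simp
lift_definition minus_ell2 :: "('a, 'b) ell2 \<Rightarrow> ('a, 'b) ell2 \<Rightarrow> ('a, 'b) ell2"
  is "\<lambda>f g i. f i - g i"
  subgoal for f g using ell2_add_summable[of f "\<lambda>i. - g i"] by simp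
  done
lift_definition scaleR_ell2 :: "real \<Rightarrow> ('a, 'b) ell2 \<Rightarrow> ('a, 'b) ell2"
  is "\<lambda>r f i. r *\<^sub>R f i"
  by (simp add: power_mult_distrib summable_on_cmult_right)

instance
  by standard (transfer; simp add: algebra_simps)+

end

instantiation ell2 :: (type, chilbert_space) real_inner
begin

lift_definition inner_ell2 :: "('a, 'b) ell2 \<Rightarrow> ('a, 'b) ell2 \<Rightarrow> real"
  is "\<lambda>f g. \<Sum>\<^sub>\<infinity>i. inner (f i) (g i)" .

definition norm_ell2 :: "('a, 'b) ell2 \<Rightarrow> real"
  where "norm_ell2 f = sqrt (inner f f)"
definition sgn_ell2 :: "('a, 'b) ell2 \<Rightarrow> ('a, 'b) ell2"
  where "sgn_ell2 f = f /\<^sub>R norm f"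
definition dist_ell2 :: "('a, 'b) ell2 \<Rightarrow> ('a, 'b) ell2 \<Rightarrow> real"
  where "dist_ell2 f g = norm (f - g)"
definition uniformity_ell2 :: "(('a, 'b) ell2 \<times> ('a, 'b) ell2) filter"
  where "uniformity_ell2 = (INF e\<in>{0 <..}. principal {(f, g). dist f g < e})"
definition open_ell2 :: "('a, 'b) ell2 set \<Rightarrow> bool"
  where "open_ell2 U \<longleftrightarrow> (\<forall>x\<in>U. \<forall>\<^sub>F (x', y) in uniformity. x' = x \<longrightarrow> y \<in> U)"

instance
proof
  fix x y z :: "('a, 'b) ell2" and r :: real and U :: "('a, 'b) ell2 set"
  show "sgn x = x /\<^sub>R norm x" by (rule sgn_ell2_def)
  show "dist x y = norm (x - y)" by (rule dist_ell2_def)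
  show "(uniformity :: (('a, 'b) ell2 \<times> ('a, 'b) ell2) filter) =
      (INF e\<in>{0 <..}. principal {(x, y). dist x y < e})"
    by (rule uniformity_ell2_def)
  show "open U \<longleftrightarrow> (\<forall>x\<in>U. \<forall>\<^sub>F (x', y) in uniformity. x' = x \<longrightarrow> y \<in> U)"
    by (rule open_ell2_def)
  show "inner x y = inner y x"
    by transfer (simp add: inner_commute)
  show "inner (x + y) z = inner x z + inner y z"
    by transfer (simp add: inner_add_left infsum_add ell2_inner_summable)
  show "inner (r *\<^sub>R x) y = r * inner x y"
    by transfer (simp add: infsum_cmult_right')
  show "0 \<le> inner x x"
    by transfer (simp add: infsum_nonneg)
  show "inner x x = 0 \<longleftrightarrow> x = 0"
  proof transfer
    fix f :: "'a \<Rightarrow> 'b"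
    assume f: "(\<lambda>i. (norm (f i))\<^sup>2) summable_on UNIV"
    have "f i = 0" if z: "(\<Sum>\<^sub>\<infinity>i. inner (f i) (f i)) = 0" for i
    proof -
      have "inner (f i) (f i) = 0"
        by (rule nonneg_infsum_le_0D[where A = UNIV and f = "\<lambda>i. inner (f i) (f i)"])
          (rule eq_refl[OF z] ell2_inner_summable[OF f f] inner_ge_zero UNIV_I)+
      then show ?thesis
        by (simp only: inner_eq_zero_iff)
    qed
    moreover have "(\<Sum>\<^sub>\<infinity>i. inner (f i) (f i)) = 0" if "f = (\<lambda>_. 0)"
      unfolding that by (simp only: inner_zero_left infsum_0_simp)
    ultimately show "(\<Sum>\<^sub>\<infinity>i. inner (f i) (f i)) = 0 \<longleftrightarrow> f = (\<lambda>_. 0)"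
      by (metis ext)
  qed
  show "norm x = sqrt (inner x x)" by (rule norm_ell2_def)
qed

end

lemma ell2_summable: "(\<lambda>i. (norm (Rep_ell2 f i))\<^sup>2) summable_on UNIV"
  using Rep_ell2[of f] by simp

lemma norm_ell2_sq: "(norm f)\<^sup>2 = (\<Sum>\<^sub>\<infinity>i. (norm (Rep_ell2 f i))\<^sup>2)"
  by (simp add: power2_norm_eq_inner inner_ell2.rep_eq)

lemma ell2_finite_sum_le: "finite F \<Longrightarrow> (\<Sum>i\<in>F. (norm (Rep_ell2 f i))\<^sup>2) \<le> (norm f)\<^sup>2"
  unfolding norm_ell2_sq by (rule finite_sum_le_infsum[OF ell2_summable]) auto

lemma ell2_coord_le: "norm (Rep_ell2 f i) \<le> norm f"
  by (rule power2_le_imp_le) (use ell2_finite_sum_le[of "{i}" f] in simp_all)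

instance ell2 :: (type, chilbert_space) complete_space
proof
  fix X :: "nat \<Rightarrow> ('a, 'b) ell2"
  assume X: "Cauchy X"
  have "Cauchy (\<lambda>n. Rep_ell2 (X n) i)" for i
  proof (rule metric_CauchyI)
    fix e :: real assume "e > 0"
    then obtain M where M: "\<forall>m\<ge>M. \<forall>n\<ge>M. dist (X m) (X n) < e"
      using X unfolding Cauchy_def by blast
    have "dist (Rep_ell2 (X m) i) (Rep_ell2 (X n) i) \<le> dist (X m) (X n)" for m n
      using ell2_coord_le[of "X m - X n" i] by (simp add: dist_norm minus_ell2.rep_eq)
    with M show "\<exists>M. \<forall>m\<ge>M. \<forall>n\<ge>M. dist (Rep_ell2 (X m) i) (Rep_ell2 (X n) i) < e"
      by (meson le_less_trans)
  qed
  then have "\<exists>g. \<forall>i. (\<lambda>n. Rep_ell2 (X n) i) \<longlonglongrightarrow> g i"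
    unfolding Cauchy_convergent_iff convergent_def by metis
  then obtain g where g: "\<And>i. (\<lambda>n. Rep_ell2 (X n) i) \<longlonglongrightarrow> g i"
    by blast
  have tail: "\<exists>M. \<forall>m\<ge>M. \<forall>F. finite F \<longrightarrow> (\<Sum>i\<in>F. (norm (Rep_ell2 (X m) i - g i))\<^sup>2) \<le> e\<^sup>2"
    if "e > 0" for e :: real
  proof -
    obtain M where M: "\<And>m n. m \<ge> M \<Longrightarrow> n \<ge> M \<Longrightarrow> dist (X m) (X n) < e"
      using X \<open>e > 0\<close> unfolding Cauchy_def by blast
    have "(\<Sum>i\<in>F. (norm (Rep_ell2 (X m) i - g i))\<^sup>2) \<le> e\<^sup>2" if "m \<ge> M" "finite F" for m F
    proof (rule LIMSEQ_le_const2)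
      show "(\<lambda>n. \<Sum>i\<in>F. (norm (Rep_ell2 (X m) i - Rep_ell2 (X n) i))\<^sup>2)
          \<longlonglongrightarrow> (\<Sum>i\<in>F. (norm (Rep_ell2 (X m) i - g i))\<^sup>2)"
        by (intro tendsto_intros g)
      have "(\<Sum>i\<in>F. (norm (Rep_ell2 (X m) i - Rep_ell2 (X n) i))\<^sup>2) \<le> e\<^sup>2" if "n \<ge> M" for n
      proof -
        have "(\<Sum>i\<in>F. (norm (Rep_ell2 (X m) i - Rep_ell2 (X n) i))\<^sup>2) \<le> (norm (X m - X n))\<^sup>2"
          using ell2_finite_sum_le[OF \<open>finite F\<close>, of "X m - X n"] by (simp add: minus_ell2.rep_eq)
        also have "\<dots> \<le> e\<^sup>2"
          using M[OF \<open>m \<ge> M\<close> that] by (intro power_mono) (simp_all add: dist_norm)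
        finally show ?thesis .
      qed
      then show "\<exists>N. \<forall>n\<ge>N. (\<Sum>i\<in>F. (norm (Rep_ell2 (X m) i - Rep_ell2 (X n) i))\<^sup>2) \<le> e\<^sup>2"
        by blast
    qed
    then show ?thesis by blast
  qed
  have diff: "(\<lambda>i. (norm (Rep_ell2 (X m) i - g i))\<^sup>2) summable_on UNIV"
    if "\<forall>F. finite F \<longrightarrow> (\<Sum>i\<in>F. (norm (Rep_ell2 (X m) i - g i))\<^sup>2) \<le> e\<^sup>2" for m and e :: real
  proof (rule nonneg_bdd_above_summable_on)
    show "bdd_above (sum (\<lambda>i. (norm (Rep_ell2 (X m) i - g i))\<^sup>2) ` {F. F \<subseteq> UNIV \<and> finite F})"
      by (rule bdd_aboveI2[where M = "e\<^sup>2"]) (use that in blast)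
  qed (rule zero_le_power2)
  obtain M where M: "\<forall>m\<ge>M. \<forall>F. finite F \<longrightarrow> (\<Sum>i\<in>F. (norm (Rep_ell2 (X m) i - g i))\<^sup>2) \<le> 1\<^sup>2"
    using tail[of 1] by auto
  have "(\<lambda>i. (norm (Rep_ell2 (X M) i + - (Rep_ell2 (X M) i - g i)))\<^sup>2) summable_on UNIV"
  proof (rule ell2_add_summable)
    have "(\<lambda>i. (norm (Rep_ell2 (X M) i - g i))\<^sup>2) summable_on UNIV"
      using diff[of M 1] M by simp
    then show "(\<lambda>i. (norm (- (Rep_ell2 (X M) i - g i)))\<^sup>2) summable_on UNIV"
      by (simp only: norm_minus_cancel)
  qed (rule ell2_summable)
  then have g2: "(\<lambda>i. (norm (g i))\<^sup>2) summable_on UNIV"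
    by simp
  define G where "G = Abs_ell2 g"
  have G: "Rep_ell2 G = g"
    unfolding G_def using g2 by (simp add: Abs_ell2_inverse)
  have "X \<longlonglongrightarrow> G"
  proof (rule metric_LIMSEQ_I)
    fix e :: real assume "e > 0"
    then obtain M where M: "\<forall>m\<ge>M. \<forall>F. finite F \<longrightarrow> (\<Sum>i\<in>F. (norm (Rep_ell2 (X m) i - g i))\<^sup>2) \<le> (e/2)\<^sup>2"
      using tail[of "e/2"] by auto
    have "dist (X m) G < e" if "m \<ge> M" for m
    proof -
      have "(norm (X m - G))\<^sup>2 = (\<Sum>\<^sub>\<infinity>i. (norm (Rep_ell2 (X m) i - g i))\<^sup>2)"
        by (simp add: norm_ell2_sq minus_ell2.rep_eq G)
      also have "\<dots> \<le> (e/2)\<^sup>2"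
        by (rule infsum_le_finite_sums) (use M that diff in blast)+
      finally have "norm (X m - G) \<le> e/2"
        by (rule power2_le_imp_le) (use \<open>e > 0\<close> in simp)
      then show ?thesis
        using \<open>e > 0\<close> by (simp add: dist_norm)
    qed
    then show "\<exists>M. \<forall>m\<ge>M. dist (X m) G < e" by blast
  qed
  then show "convergent X"
    by (auto simp: convergent_def)
qed

instantiation ell2 :: (type, chilbert_space) chilbert_space
begin

lift_definition scaleC_ell2 :: "complex \<Rightarrow> ('a, 'b) ell2 \<Rightarrow> ('a, 'b) ell2"
  is "\<lambda>c f i. c *\<^sub>C f i"
  by (simp add: norm_scaleC power_mult_distrib summable_on_cmult_right)

lift_definition cinner_ell2 :: "('a, 'b) ell2 \<Rightarrow> ('a, 'b) ell2 \<Rightarrow> complex"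
  is "\<lambda>f g. \<Sum>\<^sub>\<infinity>i. cinner (f i) (g i)" .

instance
proof
  fix x y z :: "('a, 'b) ell2" and c d :: complex and r :: real
  show "c *\<^sub>C (x + y) = c *\<^sub>C x + c *\<^sub>C y"
    by transfer (simp add: scaleC_add_right)
  show "(c + d) *\<^sub>C x = c *\<^sub>C x + d *\<^sub>C x"
    by transfer (simp add: scaleC_add_left)
  show "c *\<^sub>C d *\<^sub>C x = (c * d) *\<^sub>C x"
    by transfer (simp add: scaleC_scaleC)
  show "complex_of_real r *\<^sub>C x = r *\<^sub>R x"
    by transfer (simp add: scaleC_of_real)
  show "cinner y x = cnj (cinner x y)"
    by transfer (simp add: infsum_cnj[symmetric] cinner_commute[symmetric])
  show "cinner (x + y) z = cinner x z + cinner y z"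
    by transfer (simp add: cinner_add_left infsum_add ell2_cinner_summable)
  show "cinner (c *\<^sub>C x) y = c * cinner x y"
    by transfer (simp add: cinner_scaleC_left infsum_cmult_right')
  show "Re (cinner x y) = inner x y"
    by transfer (simp add: infsum_Re[symmetric] ell2_cinner_summable Re_cinner)
qed

end

text \<open>
  Words are lists over a finite alphabet \<open>'n\<close> with \<open>n = CARD('n)\<close>: \<open>[]\<close> is \<open>g\<^sub>0\<close>,
  \<open>i # \<alpha>\<close> is \<open>g\<^sub>i \<alpha>\<close>. The full Fock space is identified with the square-summable
  complex families over words, \<open>e\<^sub>\<alpha>\<close> with \<open>ket \<alpha>\<close>.
\<close>

type_synonym 'n fock = "('n list, complex) ell2"

lift_definition ket :: "'i \<Rightarrow> ('i, complex) ell2" is "\<lambda>i j. if j = i then 1 else 0"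
proof -
  fix i :: 'i
  have "(\<lambda>j. (norm (if j = i then 1 else 0 :: complex))\<^sup>2) summable_on {i}"
    by simp
  then show "(\<lambda>j. (norm (if j = i then 1 else 0 :: complex))\<^sup>2) summable_on UNIV"
    by (rule summable_on_cong_neutral[THEN iffD1, rotated -1]) auto
qed

text \<open>
  The Hilbert tensor product of \<open>\<ell>\<^sup>2('i)\<close> and \<open>'a\<close> is realised as \<open>\<ell>\<^sup>2('i; 'a)\<close>.
  The next two lemmas state that this is the tensor product.
\<close>

lift_definition tensor :: "('i, complex) ell2 \<Rightarrow> 'a \<Rightarrow> ('i, 'a::chilbert_space) ell2"
    (infixr "\<otimes>\<^sub>h" 70)
  is "\<lambda>f d i. f i *\<^sub>C d"
  by (simp add: norm_scaleC power_mult_distrib summable_on_cmult_left)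

lemma cinner_tensor: "cinner (f \<otimes>\<^sub>h x) (g \<otimes>\<^sub>h y) = cinner f g * cinner x y"
  by transfer (simp add: cinner_scaleC_left cinner_scaleC_right cinner_complex_def
      mult.assoc[symmetric] infsum_cmult_left', simp add: mult.commute)

lemma Rep_ell2_sum: "Rep_ell2 (sum u F) i = (\<Sum>x\<in>F. Rep_ell2 (u x) i)"
  by (induction F rule: infinite_finite_induct) (simp_all add: zero_ell2.rep_eq plus_ell2.rep_eq)

lemma closure_cspan_tensor:
  "closure (cspan {f \<otimes>\<^sub>h x | f x. True}) = (UNIV :: ('i, 'a::chilbert_space) ell2 set)"
proof -
  have "\<exists>v\<in>cspan {f \<otimes>\<^sub>h x | f x. True}. dist v u < e" if "e > 0" for u :: "('i, 'a) ell2" and e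
  proof -
    let ?h = "\<lambda>i. (norm (Rep_ell2 u i))\<^sup>2"
    have "\<forall>\<^sub>F F in finite_subsets_at_top UNIV. dist (sum ?h F) (infsum ?h UNIV) < e\<^sup>2"
      by (rule tendstoD[OF infsum_tendsto[OF ell2_summable]]) (use \<open>e > 0\<close> in simp)
    then obtain F where F: "finite F" "dist (sum ?h F) (infsum ?h UNIV) < e\<^sup>2"
      unfolding eventually_finite_subsets_at_top by blast
    define v where "v = (\<Sum>i\<in>F. ket i \<otimes>\<^sub>h Rep_ell2 u i)"
    have v: "Rep_ell2 v j = (if j \<in> F then Rep_ell2 u j else 0)" for j
    proof -
      have "Rep_ell2 v j = (\<Sum>i\<in>F. if j = i then Rep_ell2 u i else 0)"
        unfolding v_def Rep_ell2_sum tensor.rep_eq ket.rep_eq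
        by (intro sum.cong) (auto simp: scaleC_one)
      then show ?thesis
        using F(1) by simp
    qed
    have "(norm (v - u))\<^sup>2 = (\<Sum>\<^sub>\<infinity>i. (if i \<in> F then 0 else ?h i))"
      unfolding norm_ell2_sq minus_ell2.rep_eq v
      by (rule infsum_cong) simp
    also have "\<dots> = infsum ?h (UNIV - F)"
      by (rule infsum_cong_neutral) auto
    also have "\<dots> = infsum ?h UNIV - sum ?h F"
      using infsum_Diff[OF ell2_summable[of u] summable_on_finite[OF F(1)]] F(1)
      by (simp only: infsum_finite subset_UNIV)
    also have "\<dots> \<le> dist (sum ?h F) (infsum ?h UNIV)"
      unfolding dist_real_def by linarith
    also have "\<dots> < e\<^sup>2"
      by (rule F(2))
    finally have "norm (v - u) < e"
      by (rule power2_less_imp_less) (use \<open>e > 0\<close> in simp)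
    then have "dist v u < e"
      by (simp only: dist_norm)
    moreover have "v \<in> cspan {f \<otimes>\<^sub>h x | f x. True}"
      unfolding v_def
      by (intro complex_vector.span_sum complex_vector.span_base) blast
    ultimately show ?thesis by blast
  qed
  then show ?thesis
    by (auto simp: closure_approachable)
qed


section \<open>Operators on closed subspaces\<close>

text \<open>
  Tuples restricted to a subspace are again considered on the subspace as a Hilbert space of its
  own. Operators are therefore functions that matter only on a carrier: a closed
  subspace \<open>S\<close> of the ambient type.
\<close>

definition closed_csubspace :: "'a::chilbert_space set \<Rightarrow> bool"
  where "closed_csubspace S \<longleftrightarrow> closed S \<and> csubspace S"

definition bounded_op :: "'a::chilbert_space set \<Rightarrow> 'b::chilbert_space set \<Rightarrow> ('a \<Rightarrow> 'b) \<Rightarrow> bool"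
  where "bounded_op S T A \<longleftrightarrow> A ` S \<subseteq> T \<and>
    (\<forall>x\<in>S. \<forall>y\<in>S. A (x + y) = A x + A y) \<and>
    (\<forall>c. \<forall>x\<in>S. A (c *\<^sub>C x) = c *\<^sub>C A x) \<and>
    (\<exists>B. \<forall>x\<in>S. norm (A x) \<le> B * norm x)"

definition adj_on :: "'a::chilbert_space set \<Rightarrow> ('a \<Rightarrow> 'b::chilbert_space) \<Rightarrow> 'b \<Rightarrow> 'a"
  where "adj_on S A y = (THE x. x \<in> S \<and> (\<forall>z\<in>S. cinner (A z) y = cinner z x))"

definition op_nonneg :: "'a::chilbert_space set \<Rightarrow> ('a \<Rightarrow> 'a) \<Rightarrow> bool"
  where "op_nonneg S A \<longleftrightarrow> (\<forall>x\<in>S. cinner (A x) x \<in> \<real>\<^sub>\<ge>\<^sub>0)"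

definition op_le :: "'a::chilbert_space set \<Rightarrow> ('a \<Rightarrow> 'a) \<Rightarrow> ('a \<Rightarrow> 'a) \<Rightarrow> bool"
  where "op_le S A B \<longleftrightarrow> op_nonneg S (\<lambda>x. B x - A x)"

definition sqrt_op :: "'a::chilbert_space set \<Rightarrow> ('a \<Rightarrow> 'a) \<Rightarrow> 'a \<Rightarrow> 'a"
  where "sqrt_op S A = (SOME R. bounded_op S S R \<and> op_nonneg S R \<and> (\<forall>x\<in>S. R (R x) = A x))"

definition wot_tendsto ::
    "'a::chilbert_space set \<Rightarrow> ('i \<Rightarrow> 'a \<Rightarrow> 'a) \<Rightarrow> ('a \<Rightarrow> 'a) \<Rightarrow> 'i filter \<Rightarrow> bool"
  where "wot_tendsto S A T F \<longleftrightarrow> bounded_op S S T \<and>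
    (\<forall>x\<in>S. \<forall>y\<in>S. ((\<lambda>i. cinner (A i x) y) \<longlongrightarrow> cinner (T x) y) F)"

definition wot_convergent :: "'a::chilbert_space set \<Rightarrow> ('i \<Rightarrow> 'a \<Rightarrow> 'a) \<Rightarrow> 'i filter \<Rightarrow> bool"
  where "wot_convergent S A F \<longleftrightarrow> (\<exists>T. wot_tendsto S A T F)"

definition wot_Lim :: "'a::chilbert_space set \<Rightarrow> ('i \<Rightarrow> 'a \<Rightarrow> 'a) \<Rightarrow> 'i filter \<Rightarrow> 'a \<Rightarrow> 'a"
  where "wot_Lim S A F = (SOME T. wot_tendsto S A T F)"

definition orthogonal_projection :: "('a::chilbert_space \<Rightarrow> 'a) \<Rightarrow> bool"
  where "orthogonal_projection P \<longleftrightarrow> bounded_op UNIV UNIV P \<and>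
    (\<forall>x. P (P x) = P x) \<and> (\<forall>x y. cinner (P x) y = cinner x (P y))"

definition partial_isometry ::
    "'a::chilbert_space set \<Rightarrow> 'b::chilbert_space set \<Rightarrow> ('a \<Rightarrow> 'b) \<Rightarrow> bool"
  where "partial_isometry S T A \<longleftrightarrow> bounded_op S T A \<and>
    (\<forall>x\<in>S. (\<forall>y\<in>S. A y = 0 \<longrightarrow> cinner x y = 0) \<longrightarrow> norm (A x) = norm x)"

definition unitary_op ::
    "'a::chilbert_space set \<Rightarrow> 'b::chilbert_space set \<Rightarrow> ('a \<Rightarrow> 'b) \<Rightarrow> bool"
  where "unitary_op S T A \<longleftrightarrow> bounded_op S T A \<and> A ` S = T \<and>
    (\<forall>x\<in>S. \<forall>y\<in>S. cinner (A x) (A y) = cinner x y)"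

definition reducing :: "'a::chilbert_space set \<Rightarrow> ('a \<Rightarrow> 'a) \<Rightarrow> bool"
  where "reducing M A \<longleftrightarrow> closed_csubspace M \<and> A ` M \<subseteq> M \<and> adj_on UNIV A ` M \<subseteq> M"

definition orthogonal_family :: "'i set \<Rightarrow> ('i \<Rightarrow> 'a::chilbert_space set) \<Rightarrow> bool"
  where "orthogonal_family I F \<longleftrightarrow> (\<forall>i\<in>I. closed_csubspace (F i)) \<and>
    (\<forall>i\<in>I. \<forall>j\<in>I. i \<noteq> j \<longrightarrow> (\<forall>x\<in>F i. \<forall>y\<in>F j. cinner x y = 0))"

text \<open>The orthogonal direct sum, to be used for orthogonal families only.\<close>

definition hilbert_sum :: "'i set \<Rightarrow> ('i \<Rightarrow> 'a::chilbert_space set) \<Rightarrow> 'a set"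
  where "hilbert_sum I F = closure (cspan (\<Union>i\<in>I. F i))"

definition orth_complement :: "'a::chilbert_space set \<Rightarrow> 'a set"
  where "orth_complement M = {x. \<forall>y\<in>M. cinner x y = 0}"

definition orthogonal_decomposition :: "'a::chilbert_space set \<Rightarrow> 'a set \<Rightarrow> bool"
  where "orthogonal_decomposition M N \<longleftrightarrow> closed_csubspace M \<and> closed_csubspace N \<and>
    (\<forall>x\<in>M. \<forall>y\<in>N. cinner x y = 0) \<and> (\<forall>z. \<exists>x\<in>M. \<exists>y\<in>N. z = x + y)"


section \<open>Operator algebras\<close>

text \<open>
  The type \<open>'a \<Rightarrow>\<^sub>L 'a\<close> contains all bounded real-linear operators; the complex-linear ones
  are singled out by \<open>clinear_op\<close>.
\<close>

definition clinear_op :: "('a::chilbert_space \<Rightarrow>\<^sub>L 'a) \<Rightarrow> bool"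
  where "clinear_op A \<longleftrightarrow> (\<forall>c x. blinfun_apply A (c *\<^sub>C x) = c *\<^sub>C blinfun_apply A x)"

definition scaleC_op :: "complex \<Rightarrow> ('a::chilbert_space \<Rightarrow>\<^sub>L 'a) \<Rightarrow> ('a \<Rightarrow>\<^sub>L 'a)"
  where "scaleC_op c A = Blinfun (\<lambda>x. c *\<^sub>C blinfun_apply A x)"

definition adj_op :: "('a::chilbert_space \<Rightarrow>\<^sub>L 'a) \<Rightarrow> ('a \<Rightarrow>\<^sub>L 'a)"
  where "adj_op A = Blinfun (adj_on UNIV (blinfun_apply A))"

definition unital_cstar_subalgebra :: "('a::chilbert_space \<Rightarrow>\<^sub>L 'a) set \<Rightarrow> bool"
  where "unital_cstar_subalgebra \<A> \<longleftrightarrow>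
    (\<forall>A\<in>\<A>. clinear_op A) \<and> id_blinfun \<in> \<A> \<and>
    (\<forall>A\<in>\<A>. \<forall>B\<in>\<A>. A + B \<in> \<A> \<and> A o\<^sub>L B \<in> \<A>) \<and>
    (\<forall>c. \<forall>A\<in>\<A>. scaleC_op c A \<in> \<A>) \<and>
    (\<forall>A\<in>\<A>. adj_op A \<in> \<A>) \<and> closed \<A>"

definition cstar_generated :: "('a::chilbert_space \<Rightarrow>\<^sub>L 'a) set \<Rightarrow> ('a \<Rightarrow>\<^sub>L 'a) set"
  where "cstar_generated G = \<Inter>{\<A>. unital_cstar_subalgebra \<A> \<and> G \<subseteq> \<A>}"

definition unital_star_representation ::
    "('a::chilbert_space \<Rightarrow>\<^sub>L 'a) set \<Rightarrow> (('a \<Rightarrow>\<^sub>L 'a) \<Rightarrow> ('k::chilbert_space \<Rightarrow>\<^sub>L 'k)) \<Rightarrow> bool"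
  where "unital_star_representation \<A> \<pi> \<longleftrightarrow>
    (\<forall>A\<in>\<A>. clinear_op (\<pi> A)) \<and> \<pi> id_blinfun = id_blinfun \<and>
    (\<forall>A\<in>\<A>. \<forall>B\<in>\<A>. \<pi> (A + B) = \<pi> A + \<pi> B \<and> \<pi> (A o\<^sub>L B) = \<pi> A o\<^sub>L \<pi> B) \<and>
    (\<forall>c. \<forall>A\<in>\<A>. \<pi> (scaleC_op c A) = scaleC_op c (\<pi> A)) \<and>
    (\<forall>A\<in>\<A>. \<pi> (adj_op A) = adj_op (\<pi> A))"


section \<open>Admissible free holomorphic functions\<close>

text \<open>
  A formal power series in noncommuting indeterminates is its family of coefficients. Norm
  convergence on some row ball over every Hilbert space, which would quantify over types, is
  expressed by the equivalent condition that the radius of convergence is positive.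
\<close>

definition free_holomorphic_near_0 :: "('n::finite list \<Rightarrow> complex) \<Rightarrow> bool"
  where "free_holomorphic_near_0 c \<longleftrightarrow>
    limsup (\<lambda>k. ereal (root (2 * k) (\<Sum>\<alpha> | length \<alpha> = k. (cmod (c \<alpha>))\<^sup>2))) < \<infinity>"

definition nc_mult :: "('n list \<Rightarrow> real) \<Rightarrow> ('n list \<Rightarrow> real) \<Rightarrow> 'n list \<Rightarrow> real"
  where "nc_mult a b \<gamma> = (\<Sum>(\<alpha>, \<beta>) | \<alpha> @ \<beta> = \<gamma>. a \<alpha> * b \<beta>)"

definition nc_one :: "'n list \<Rightarrow> real"
  where "nc_one \<gamma> = (if \<gamma> = [] then 1 else 0)"

definition nc_inverse :: "('n list \<Rightarrow> real) \<Rightarrow> 'n list \<Rightarrow> real"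
  where "nc_inverse b = (THE a. nc_mult a b = nc_one \<and> nc_mult b a = nc_one)"

primrec blinfun_word :: "('n \<Rightarrow> ('a::real_normed_vector \<Rightarrow>\<^sub>L 'a)) \<Rightarrow> 'n list \<Rightarrow> ('a \<Rightarrow>\<^sub>L 'a)"
  where "blinfun_word X [] = id_blinfun"
  | "blinfun_word X (i # \<alpha>) = X i o\<^sub>L blinfun_word X \<alpha>"

primrec op_word :: "('n \<Rightarrow> 'a \<Rightarrow> 'a) \<Rightarrow> 'n list \<Rightarrow> 'a \<Rightarrow> 'a"
  where "op_word X [] = id"
  | "op_word X (i # \<alpha>) = X i \<circ> op_word X \<alpha>"

definition weighted_creation :: "('n list \<Rightarrow> real) \<Rightarrow> 'n \<Rightarrow> ('n fock \<Rightarrow>\<^sub>L 'n fock)"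
  where "weighted_creation b i = (THE T. clinear_op T \<and>
    (\<forall>\<alpha>. blinfun_apply T (ket \<alpha>) = sqrt (b \<alpha> / b (i # \<alpha>)) *\<^sub>R ket (i # \<alpha>)))"

definition creation_defect_term ::
    "('n::finite list \<Rightarrow> real) \<Rightarrow> nat \<Rightarrow> ('n fock \<Rightarrow>\<^sub>L 'n fock)"
  where "creation_defect_term b p = (\<Sum>\<alpha> | length \<alpha> = p. nc_inverse b \<alpha> *\<^sub>R
    (blinfun_word (weighted_creation b) \<alpha> o\<^sub>L adj_op (blinfun_word (weighted_creation b) \<alpha>)))"

definition admissible :: "('n::finite list \<Rightarrow> real) \<Rightarrow> bool"
  where "admissible b \<longleftrightarrow>
    b [] = 1 \<and> (\<forall>\<alpha>. b \<alpha> > 0) \<and> (\<forall>i. bdd_above (range (\<lambda>\<alpha>. b \<alpha> / b (i # \<alpha>)))) \<and>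
    free_holomorphic_near_0 (\<lambda>\<alpha>. complex_of_real (b \<alpha>)) \<and>
    bdd_above (range (\<lambda>k. norm (\<Sum>p\<le>k. creation_defect_term b p)))"


section \<open>Noncommutative domains and Berezin kernels\<close>

definition defect_partial_sum :: "('n::finite list \<Rightarrow> real) \<Rightarrow> 'a::chilbert_space set \<Rightarrow>
    ('n \<Rightarrow> 'a \<Rightarrow> 'a) \<Rightarrow> nat \<Rightarrow> 'a \<Rightarrow> 'a"
  where "defect_partial_sum b S X k x = (\<Sum>p\<le>k. \<Sum>\<alpha> | length \<alpha> = p.
    nc_inverse b \<alpha> *\<^sub>R op_word X \<alpha> (adj_on S (op_word X \<alpha>) x))"

definition defect :: "('n::finite list \<Rightarrow> real) \<Rightarrow> 'a::chilbert_space set \<Rightarrow>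
    ('n \<Rightarrow> 'a \<Rightarrow> 'a) \<Rightarrow> 'a \<Rightarrow> 'a"
  where "defect b S X = wot_Lim S (defect_partial_sum b S X) sequentially"

definition purity_partial_sum :: "('n::finite list \<Rightarrow> real) \<Rightarrow> 'a::chilbert_space set \<Rightarrow>
    ('n \<Rightarrow> 'a \<Rightarrow> 'a) \<Rightarrow> 'n list set \<Rightarrow> 'a \<Rightarrow> 'a"
  where "purity_partial_sum b S X F x = (\<Sum>\<alpha>\<in>F.
    b \<alpha> *\<^sub>R op_word X \<alpha> (defect b S X (adj_on S (op_word X \<alpha>) x)))"

definition nc_domain :: "('n::finite list \<Rightarrow> real) \<Rightarrow> 'a::chilbert_space set \<Rightarrow>
    ('n \<Rightarrow> 'a \<Rightarrow> 'a) set"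
  where "nc_domain b S = {X. (\<forall>i. bounded_op S S (X i)) \<and>
    wot_convergent S (defect_partial_sum b S X) sequentially \<and>
    op_nonneg S (defect b S X) \<and>
    wot_convergent S (purity_partial_sum b S X) (finite_subsets_at_top UNIV) \<and>
    op_le S (wot_Lim S (purity_partial_sum b S X) (finite_subsets_at_top UNIV)) id}"

definition pure_tuple :: "('n::finite list \<Rightarrow> real) \<Rightarrow> 'a::chilbert_space set \<Rightarrow>
    ('n \<Rightarrow> 'a \<Rightarrow> 'a) \<Rightarrow> bool"
  where "pure_tuple b S X \<longleftrightarrow> X \<in> nc_domain b S \<and>
    (\<forall>x\<in>S. wot_Lim S (purity_partial_sum b S X) (finite_subsets_at_top UNIV) x = x)"

definition cuntz_tuple :: "('n::finite list \<Rightarrow> real) \<Rightarrow> 'a::chilbert_space set \<Rightarrow>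
    ('n \<Rightarrow> 'a \<Rightarrow> 'a) \<Rightarrow> bool"
  where "cuntz_tuple b S X \<longleftrightarrow> X \<in> nc_domain b S \<and> (\<forall>x\<in>S. defect b S X x = 0)"

text \<open>\<open>fock_tensor M\<close> is \<open>F\<^sup>2(H\<^sub>n) \<otimes> M\<close>, and \<open>tensor_id T M\<close> is \<open>T \<otimes> I\<^sub>M\<close> on it.\<close>

definition fock_tensor :: "'a::chilbert_space set \<Rightarrow> ('n list, 'a) ell2 set"
  where "fock_tensor M = closure (cspan {f \<otimes>\<^sub>h d | f d. d \<in> M})"

definition tensor_id :: "('n fock \<Rightarrow>\<^sub>L 'n fock) \<Rightarrow> 'a::chilbert_space set \<Rightarrow>
    ('n list, 'a) ell2 \<Rightarrow> ('n list, 'a) ell2"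
  where "tensor_id T M = (SOME R. bounded_op (fock_tensor M) (fock_tensor M) R \<and>
    (\<forall>f. \<forall>d\<in>M. R (f \<otimes>\<^sub>h d) = blinfun_apply T f \<otimes>\<^sub>h d))"

definition berezin_kernel :: "('n::finite list \<Rightarrow> real) \<Rightarrow> 'a::chilbert_space set \<Rightarrow>
    ('n \<Rightarrow> 'a \<Rightarrow> 'a) \<Rightarrow> 'a \<Rightarrow> ('n list, 'a) ell2"
  where "berezin_kernel b S X h = (\<Sum>\<^sub>\<infinity>\<alpha>. sqrt (b \<alpha>) *\<^sub>R
    (ket \<alpha> \<otimes>\<^sub>h sqrt_op S (defect b S X) (adj_on S (op_word X \<alpha>) h)))"

definition wold_decomposition :: "('n::finite list \<Rightarrow> real) \<Rightarrow>
    ('n \<Rightarrow> 'a \<Rightarrow> 'a) \<Rightarrow> 'a::chilbert_space set \<Rightarrow> 'a set \<Rightarrow> bool"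
  where "wold_decomposition b V M N \<longleftrightarrow> orthogonal_decomposition M N \<and>
    (\<forall>i. reducing M (V i) \<and> reducing N (V i)) \<and>
    pure_tuple b M (\<lambda>i. restrict (V i) M) \<and>
    cuntz_tuple b N (\<lambda>i. restrict (V i) N)"

end

theory Submission
  imports Defs
begin

text \<open>
  The series \<open>\<Sum> a\<^sub>\<alpha> W\<^sub>\<alpha> W\<^sub>\<alpha>\<^sup>*\<close> converges in norm to the projection onto the vacuum vector,
  so this projection lies in \<open>C\<^sup>*(W)\<close> and, as \<open>\<pi>\<close> is contractive, \<open>\<Delta>(V, V\<^sup>*)\<close> is its image \<open>P\<close>.
  The algebraic relations between the vacuum projection and the \<open>W\<^sub>\<alpha>\<close>, read off from the basis
  vectors, carry over to \<open>P\<close> and the \<open>V\<^sub>\<alpha>\<close>; they make the operators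
  \<open>b\<^sub>\<alpha> V\<^sub>\<alpha> P V\<^sub>\<alpha>\<^sup>*\<close> pairwise orthogonal projections whose sum \<open>K\<^sup>* K\<close> is the projection onto
  the pure part and commutes with every \<open>V\<^sub>i\<close>.
\<close>

section \<open>Hilbert space preliminaries\<close>

text \<open>Norm convergence is the decisive hypothesis: a representation need not respect weak
  limits, while norm limits survive because it is contractive. Contractivity is not part of the
  definition of a representation; it is derived from square roots inside the algebra. That the limit
  is the vacuum projection is the identity g^{-1} g = 1, read on each basis vector. What remains is
  a scalar relation after compression by the vacuum projection, and this is enough. Uniqueness rests
  on the fact that the defect and the pure projection are built by limits from polynomials in the
  V_i and their adjoints: they leave every reducing subspace invariant and restrict to the
  corresponding objects there.\<close>

lemma cinner_add_right: "cinner x (y + z) = cinner x y + cinner x (z :: 'a::chilbert_space)"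
  by (metis cinner_commute cinner_add_left complex_cnj_add)

lemma scaleR_scaleC: "r *\<^sub>R x = complex_of_real r *\<^sub>C (x :: 'a::chilbert_space)"
  by (simp add: scaleC_of_real)

text \<open>A unimodular factor on \<open>x\<close> makes the product real and nonnegative, which
  reduces the claim to the real Cauchy-Schwarz inequality.\<close>

lemma norm_cinner_le: "norm (cinner x y) \<le> norm x * norm (y :: 'a::chilbert_space)"
proof (cases "cinner x y = 0")
  case False
  define c where "c = cnj (sgn (cinner x y))"
  have c: "cmod c = 1"
    using False by (simp add: c_def norm_sgn)
  have "c * cinner x y = complex_of_real (cmod (cinner x y))"
    using False by (simp add: c_def sgn_eq complex_norm_square[symmetric] mult.commute power2_eq_square)
  then have "cmod (cinner x y) = inner (c *\<^sub>C x) y"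
    by (simp add: Re_cinner[symmetric] cinner_scaleC_left)
  also have "\<dots> \<le> norm (c *\<^sub>C x) * norm y"
    by (rule norm_cauchy_schwarz)
  finally show ?thesis
    by (simp add: norm_scaleC c)
qed simp

interpretation cinner: bounded_bilinear "cinner :: 'a::chilbert_space \<Rightarrow> 'a \<Rightarrow> complex"
proof
  show "\<exists>K. \<forall>a b :: 'a. norm (cinner a b) \<le> norm a * norm b * K"
    by (rule exI[of _ 1]) (simp add: norm_cinner_le)
qed (simp_all add: cinner_add_left cinner_add_right scaleR_scaleC cinner_scaleC_left
    cinner_scaleC_right scaleC_complex_def)

lemma cinner_self_eq_0 [simp]: "cinner x x = 0 \<longleftrightarrow> x = (0 :: 'a::chilbert_space)"
  by (simp add: cinner_self)

lemma cinner_eq_0_commute: "cinner x y = 0 \<longleftrightarrow> cinner y (x :: 'a::chilbert_space) = 0"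
  by (metis cinner_commute complex_cnj_zero)

lemma bounded_linear_scaleC: "bounded_linear (\<lambda>x :: 'a::chilbert_space. c *\<^sub>C x)"
  by (rule bounded_linear_intro[of _ "cmod c"])
    (simp_all add: scaleC_add_right scaleR_scaleC scaleC_scaleC norm_scaleC mult.commute)

lemma csubspace_closure:
  assumes "csubspace (S :: 'a::chilbert_space set)"
  shows "csubspace (closure S)"
proof (rule complex_vector.subspaceI)
  show "0 \<in> closure S"
    using complex_vector.subspace_0[OF assms] closure_subset by blast
next
  fix x y assume "x \<in> closure S" "y \<in> closure S"
  then obtain f g where "\<And>n. f n \<in> S" "f \<longlonglongrightarrow> x" "\<And>n. g n \<in> S" "g \<longlonglongrightarrow> y"
    unfolding closure_sequential by blast
  then show "x + y \<in> closure S"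
    using complex_vector.subspace_add[OF assms] unfolding closure_sequential
    by (intro exI[of _ "\<lambda>n. f n + g n"]) (blast intro: tendsto_add)
next
  fix c x assume "x \<in> closure S"
  then obtain f where "\<And>n. f n \<in> S" "f \<longlonglongrightarrow> x"
    unfolding closure_sequential by blast
  then show "c *\<^sub>C x \<in> closure S"
    using complex_vector.subspace_scale[OF assms] unfolding closure_sequential
    by (intro exI[of _ "\<lambda>n. c *\<^sub>C f n"])
      (blast intro: bounded_linear.tendsto[OF bounded_linear_scaleC])
qed

lemma closed_csubspace_closure: "csubspace S \<Longrightarrow> closed_csubspace (closure S)"
  by (simp add: closed_csubspace_def csubspace_closure)

lemma closure_cspan_least:
  assumes "A \<subseteq> S" "closed_csubspace S"
  shows "closure (cspan A) \<subseteq> S"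
  using assms unfolding closed_csubspace_def
  by (intro closure_minimal complex_vector.span_minimal) auto

lemma closed_csubspace_closure_cspan: "closed_csubspace (closure (cspan A))"
  by (simp add: closed_csubspace_closure)

lemma closed_csubspace_UNIV: "closed_csubspace UNIV"
  by (simp add: closed_csubspace_def)

lemma closed_csubspace_has_sum:
  assumes "closed_csubspace S" "(f has_sum x) A" "\<And>i. i \<in> A \<Longrightarrow> f i \<in> S"
  shows "x \<in> S"
proof (rule Lim_in_closed_set)
  show "(sum f \<longlongrightarrow> x) (finite_subsets_at_top A)"
    using assms(2) by (simp add: has_sum_def)
  show "\<forall>\<^sub>F F in finite_subsets_at_top A. sum f F \<in> S"
    using assms(1,3) unfolding closed_csubspace_def
    by (intro eventually_finite_subsets_at_top_weakI complex_vector.subspace_sum) auto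
qed (use assms(1) in \<open>auto simp: closed_csubspace_def\<close>)

section \<open>The Riesz representation theorem and adjoints\<close>

text \<open>The representing vector minimises \<open>\<parallel>x\<parallel>\<^sup>2 - 2 f x\<close>.\<close>

theorem riesz_real:
  fixes f :: "'a::{real_inner,complete_space} \<Rightarrow> real"
  assumes "bounded_linear f"
  shows "\<exists>y. \<forall>x. f x = inner x y"
proof -
  interpret f: bounded_linear f by (rule assms)
  define \<phi> where "\<phi> x = (norm x)\<^sup>2 - 2 * f x" for x
  obtain B where B: "\<And>x. \<bar>f x\<bar> \<le> norm x * B"
    using f.bounded by auto
  have low: "- B\<^sup>2 \<le> \<phi> x" for x
  proof -
    have "f x \<le> norm x * B" using B[of x] by simp
    moreover have "0 \<le> (norm x - B)\<^sup>2" by simp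
    ultimately show ?thesis
      by (simp add: \<phi>_def power2_diff algebra_simps)
  qed
  define m where "m = Inf (range \<phi>)"
  have bdd: "bdd_below (range \<phi>)"
    by (rule bdd_belowI2[OF low])
  have m: "m \<le> \<phi> x" for x
    unfolding m_def by (rule cInf_lower) (auto intro: bdd)
  have "\<exists>x. \<phi> x < m + e" if "e > 0" for e
    using that cInf_less_iff[OF _ bdd, of "m + e"] by (auto simp: m_def)
  then have "\<forall>n. \<exists>x. \<phi> x < m + 1 / real (Suc n)"
    by simp
  then obtain X where X: "\<And>n. \<phi> (X n) < m + 1 / real (Suc n)"
    by metis
  \<comment> \<open>The parallelogram law: the linear parts cancel, so two near-minimisers of
    \<open>\<phi>\<close> must be close to each other.\<close>
  have par: "(norm (x - y))\<^sup>2 = 2 * \<phi> x + 2 * \<phi> y - 4 * \<phi> ((1/2) *\<^sub>R (x + y))" for x y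
    unfolding \<phi>_def
    by (simp add: power2_norm_eq_inner inner_add inner_diff f.scaleR f.add inner_commute field_simps)
  have close: "(norm (X i - X j))\<^sup>2 < 2 / real (Suc i) + 2 / real (Suc j)" for i j
    using par[of "X i" "X j"] m[of "(1/2) *\<^sub>R (X i + X j)"] X[of i] X[of j] by simp
  have "Cauchy X"
  proof (rule metric_CauchyI)
    fix e :: real assume "e > 0"
    then obtain N where N: "4 / e\<^sup>2 < real N"
      using reals_Archimedean2 by blast
    have "dist (X i) (X j) < e" if "i \<ge> N" "j \<ge> N" for i j
    proof -
      have k: "2 / real (Suc k) \<le> e\<^sup>2 / 2" if "k \<ge> N" for k
      proof -
        have "4 < real N * e\<^sup>2"
          using N \<open>e > 0\<close> by (simp add: field_simps)
        also have "\<dots> \<le> real (Suc k) * e\<^sup>2"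
          using that by (intro mult_right_mono) auto
        finally show ?thesis by (simp add: field_simps)
      qed
      have "(norm (X i - X j))\<^sup>2 < e\<^sup>2"
        using close[of i j] k[OF that(1)] k[OF that(2)] by simp
      then show ?thesis
        using \<open>e > 0\<close> by (simp add: dist_norm power2_less_imp_less)
    qed
    then show "\<exists>M. \<forall>i\<ge>M. \<forall>j\<ge>M. dist (X i) (X j) < e" by blast
  qed
  then obtain y where y: "X \<longlonglongrightarrow> y"
    by (auto simp: Cauchy_convergent_iff convergent_def)
  have "\<phi> y \<le> m"
  proof (rule LIMSEQ_le)
    show "(\<lambda>n. \<phi> (X n)) \<longlonglongrightarrow> \<phi> y"
      unfolding \<phi>_def by (intro tendsto_intros y f.tendsto)
    show "(\<lambda>n. m + 1 / real (Suc n)) \<longlonglongrightarrow> m"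
      using tendsto_add[OF tendsto_const[of m] LIMSEQ_inverse_real_of_nat]
      by (simp add: inverse_eq_divide)
    show "\<exists>N. \<forall>n\<ge>N. \<phi> (X n) \<le> m + 1 / real (Suc n)"
      using X less_imp_le by blast
  qed
  have "f h = inner h y" for h
  proof (rule ccontr)
    define d where "d = inner h y - f h"
    assume "f h \<noteq> inner h y"
    then have d: "d \<noteq> 0" and h: "h \<noteq> 0"
      by (auto simp: d_def f.zero)
    \<comment> \<open>The minimiser of the quadratic polynomial t \<mapsto> \<phi>(y + t h), whose
      derivative at 0 is 2d.\<close>
    define t where "t = - d / (norm h)\<^sup>2"
    have "\<phi> (y + t *\<^sub>R h) = \<phi> y + 2 * t * d + t\<^sup>2 * (norm h)\<^sup>2"
      unfolding \<phi>_def d_def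
      by (simp add: power2_norm_eq_inner inner_add f.scaleR f.add inner_commute field_simps
          power2_eq_square[of t])
    also have "\<dots> = \<phi> y - d\<^sup>2 / (norm h)\<^sup>2"
      using h by (simp add: t_def field_simps power2_eq_square)
    also have "\<dots> < \<phi> y"
      using d h by simp
    finally show False
      using m[of "y + t *\<^sub>R h"] \<open>\<phi> y \<le> m\<close> by linarith
  qed
  then show ?thesis by blast
qed

lemma
  assumes "bounded_op S T A"
  shows bounded_op_in: "\<And>x. x \<in> S \<Longrightarrow> A x \<in> T"
    and bounded_op_add: "\<And>x y. x \<in> S \<Longrightarrow> y \<in> S \<Longrightarrow> A (x + y) = A x + A y"
    and bounded_op_scaleC: "\<And>c x. x \<in> S \<Longrightarrow> A (c *\<^sub>C x) = c *\<^sub>C A x"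
  using assms unfolding bounded_op_def by blast+

lemma bounded_op_UNIV_iff:
  "bounded_op UNIV UNIV A \<longleftrightarrow> bounded_linear A \<and> (\<forall>c x. A (c *\<^sub>C x) = c *\<^sub>C A x)"
proof
  assume A: "bounded_op UNIV UNIV A"
  then obtain B where "\<And>x. norm (A x) \<le> B * norm x"
    unfolding bounded_op_def by blast
  then have "bounded_linear A"
    by (intro bounded_linear_intro[where K = B])
      (simp_all add: bounded_op_add[OF A] bounded_op_scaleC[OF A] scaleR_scaleC mult.commute)
  then show "bounded_linear A \<and> (\<forall>c x. A (c *\<^sub>C x) = c *\<^sub>C A x)"
    by (simp add: bounded_op_scaleC[OF A])
next
  assume A: "bounded_linear A \<and> (\<forall>c x. A (c *\<^sub>C x) = c *\<^sub>C A x)"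
  then obtain B where "\<And>x. norm (A x) \<le> norm x * B"
    using bounded_linear.bounded by blast
  with A show "bounded_op UNIV UNIV A"
    unfolding bounded_op_def by (auto simp: linear_simps mult.commute)
qed

lemma bounded_op_mono:
  assumes "bounded_op S T A" "S' \<subseteq> S" "\<And>x. x \<in> S' \<Longrightarrow> A x \<in> T'"
  shows "bounded_op S' T' A"
  using assms unfolding bounded_op_def by (simp add: subset_eq image_iff Ball_def) blast

lemma bounded_op_cong:
  assumes "closed_csubspace S" "\<And>x. x \<in> S \<Longrightarrow> A x = B x"
  shows "bounded_op S T A \<longleftrightarrow> bounded_op S T B"
proof -
  have "x + y \<in> S" "c *\<^sub>C x \<in> S" if "x \<in> S" "y \<in> S" for c x y
    using assms(1) that
    by (auto simp: closed_csubspace_def complex_vector.subspace_add complex_vector.subspace_scale)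
  then show ?thesis
    using assms(2) unfolding bounded_op_def by (simp cong: ball_cong image_cong)
qed

lemma bounded_op_compose:
  assumes "bounded_op UNIV UNIV A" "bounded_op UNIV UNIV B"
  shows "bounded_op UNIV UNIV (\<lambda>x. A (B x))"
  using assms unfolding bounded_op_UNIV_iff by (auto intro: bounded_linear_compose)

text \<open>A complex-linear functional is determined by its real part, since Im f(x) = - Re f(i x);
  so the real representing vector already works.\<close>

lemma riesz:
  fixes f :: "'a::chilbert_space \<Rightarrow> complex"
  assumes "bounded_linear f" and f: "\<And>c x. f (c *\<^sub>C x) = c * f x"
  shows "\<exists>y. \<forall>x. f x = cinner x y"
proof -
  obtain y where y: "\<And>x. Re (f x) = inner x y"
    using riesz_real[OF bounded_linear_compose[OF bounded_linear_Re assms(1)]] by auto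
  have "f x = cinner x y" for x
  proof (rule complex_eqI)
    show re: "Re (f x) = Re (cinner x y)" for x
      by (simp add: y Re_cinner)
    show "Im (f x) = Im (cinner x y)"
      using re[of "\<i> *\<^sub>C x"] by (simp add: f cinner_scaleC_left)
  qed
  then show ?thesis by blast
qed

lemma cinner_eqI:
  assumes "\<And>z. cinner z x = cinner z (y :: 'a::chilbert_space)"
  shows "x = y"
  using assms[of "x - y"] cinner_self_eq_0[of "x - y"] by (simp add: cinner.diff_right)

text \<open>Testing against vectors of the carrier suffices, because the difference of two
  candidates lies in \<open>S\<close> itself. All adjoints, ambient or restricted, are computed this
  way.\<close>

lemma adj_on_eqI:
  assumes "closed_csubspace S" "x \<in> S" "\<And>z. z \<in> S \<Longrightarrow> cinner (A z) y = cinner z x"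
  shows "adj_on S A y = x"
  unfolding adj_on_def
proof (rule the_equality)
  fix x' assume x': "x' \<in> S \<and> (\<forall>z\<in>S. cinner (A z) y = cinner z x')"
  then have "x' - x \<in> S"
    using assms(1,2) by (simp add: closed_csubspace_def complex_vector.subspace_diff)
  then have "cinner (x' - x) x' = cinner (x' - x) x"
    using x' assms(3) by metis
  then show "x' = x"
    using cinner_self_eq_0[of "x' - x"] by (simp add: cinner.diff_right)
qed (use assms in auto)

lemma cinner_adj:
  fixes A :: "'a::chilbert_space \<Rightarrow> 'b::chilbert_space"
  assumes "bounded_op UNIV UNIV A"
  shows "cinner (A x) y = cinner x (adj_on UNIV A y)"
proof -
  have A: "bounded_linear A" "\<And>c x. A (c *\<^sub>C x) = c *\<^sub>C A x"
    using assms by (auto simp: bounded_op_UNIV_iff)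
  obtain z where z: "\<forall>x. cinner (A x) y = cinner x z"
    using riesz[of "\<lambda>x. cinner (A x) y"]
      bounded_linear_compose[OF cinner.bounded_linear_left A(1)] A(2)
    by (auto simp: cinner_scaleC_left)
  have "adj_on UNIV A y = z"
    by (rule adj_on_eqI) (simp_all add: closed_csubspace_UNIV z)
  with z show ?thesis by simp
qed

lemma adj_unique:
  assumes "\<And>x y. cinner (A x) y = cinner x (B y)"
  shows "adj_on UNIV A = B"
  by (rule ext, rule adj_on_eqI) (simp_all add: closed_csubspace_UNIV assms)

lemma
  fixes A :: "'a::chilbert_space \<Rightarrow> 'b::chilbert_space"
  assumes "bounded_op UNIV UNIV A"
  shows bounded_op_adj: "bounded_op UNIV UNIV (adj_on UNIV A)"
    and norm_adj_le: "0 \<le> B \<Longrightarrow> (\<And>x. norm (A x) \<le> B * norm x) \<Longrightarrow> norm (adj_on UNIV A y) \<le> B * norm y"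
proof -
  have bound: "norm (adj_on UNIV A y) \<le> B * norm y"
    if "0 \<le> B" and B: "\<And>x. norm (A x) \<le> B * norm x" for B y
  proof (cases "adj_on UNIV A y = 0")
    case True
    then show ?thesis using \<open>0 \<le> B\<close> by simp
  next
    case False
    let ?z = "adj_on UNIV A y"
    have "(norm ?z)\<^sup>2 = cmod (cinner ?z ?z)"
      by (simp add: cinner_self norm_power)
    also have "\<dots> = cmod (cinner (A ?z) y)"
      by (simp only: cinner_adj[OF assms])
    also have "\<dots> \<le> norm (A ?z) * norm y"
      by (rule norm_cinner_le)
    also have "\<dots> \<le> B * norm ?z * norm y"
      by (intro mult_right_mono B) simp
    finally show ?thesis
      using False by (simp add: power2_eq_square algebra_simps)
  qed
  obtain C where "\<And>x. norm (A x) \<le> C * norm x"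
    using assms unfolding bounded_op_def by blast
  then have "\<And>x. norm (A x) \<le> \<bar>C\<bar> * norm x"
    by (meson abs_ge_self mult_right_mono norm_ge_zero order_trans)
  then have "\<exists>B. \<forall>y. norm (adj_on UNIV A y) \<le> B * norm y"
    using bound[of "\<bar>C\<bar>"] by (metis abs_ge_zero)
  moreover have "adj_on UNIV A (x + y) = adj_on UNIV A x + adj_on UNIV A y" for x y
    by (rule cinner_eqI) (simp add: cinner_adj[OF assms, symmetric] cinner.add_right)
  moreover have "adj_on UNIV A (c *\<^sub>C x) = c *\<^sub>C adj_on UNIV A x" for c x
    by (rule cinner_eqI) (simp add: cinner_adj[OF assms, symmetric] cinner_scaleC_right)
  ultimately show "bounded_op UNIV UNIV (adj_on UNIV A)"
    unfolding bounded_op_def by simp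
  show "norm (adj_on UNIV A y) \<le> B * norm y" if "0 \<le> B" "\<And>x. norm (A x) \<le> B * norm x"
    by (rule bound[OF that])
qed

section \<open>Weak operator limits\<close>

lemma wot_tendsto_unique:
  assumes "closed_csubspace S" "wot_tendsto S A T F" "wot_tendsto S A T' F" "F \<noteq> bot" "x \<in> S"
  shows "T x = T' x"
proof -
  have "T x - T' x \<in> S"
    using assms(1) bounded_op_in[of S S T x] bounded_op_in[of S S T' x] assms(2,3,5)
    by (simp add: wot_tendsto_def closed_csubspace_def complex_vector.subspace_diff)
  then have "cinner (T x) (T x - T' x) = cinner (T' x) (T x - T' x)"
    using assms unfolding wot_tendsto_def by (blast intro: tendsto_unique)
  then show ?thesis
    using cinner_self_eq_0[of "T x - T' x"] by (simp add: cinner.diff_left)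
qed

text \<open>\<open>wot_Lim\<close> is a choice among functions that may differ off \<open>S\<close>,
  so its value is known only at points of \<open>S\<close>.\<close>

lemma wot_Lim_eq:
  assumes "closed_csubspace S" "wot_tendsto S A T F" "F \<noteq> bot" "x \<in> S"
  shows "wot_Lim S A F x = T x"
  unfolding wot_Lim_def
  by (rule wot_tendsto_unique[OF assms(1) _ assms(2-4)]) (rule someI[of "\<lambda>T. wot_tendsto S A T F", OF assms(2)])

section \<open>Square-summable families\<close>

lemma ell2_eqI: "(\<And>i. Rep_ell2 f i = Rep_ell2 g i) \<Longrightarrow> f = g"
  by (metis Rep_ell2_inject ext)

lemma bounded_linear_Rep_ell2: "bounded_linear (\<lambda>f. Rep_ell2 f i)"
  by (rule bounded_linear_intro[of _ 1])
    (simp_all add: plus_ell2.rep_eq scaleR_ell2.rep_eq ell2_coord_le)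

lemma Rep_ket_tensor: "Rep_ell2 (ket i \<otimes>\<^sub>h x) j = (if j = i then x else 0)"
  by (simp add: tensor.rep_eq ket.rep_eq scaleC_one)

lemma ket_tensor_has_sum: "((\<lambda>i. ket i \<otimes>\<^sub>h Rep_ell2 u i) has_sum u) UNIV"
  unfolding has_sum_def tendsto_iff
proof (intro allI impI)
  fix e :: real assume "e > 0"
  let ?h = "\<lambda>i. (norm (Rep_ell2 u i))\<^sup>2"
  have "\<forall>\<^sub>F F in finite_subsets_at_top UNIV. dist (sum ?h F) (infsum ?h UNIV) < e\<^sup>2"
    by (rule tendstoD[OF infsum_tendsto[OF ell2_summable]]) (use \<open>e > 0\<close> in simp)
  moreover have "\<forall>\<^sub>F F in finite_subsets_at_top UNIV. finite F \<and> F \<subseteq> (UNIV :: 'a set)"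
    by (rule eventually_finite_subsets_at_top_weakI) auto
  ultimately show "\<forall>\<^sub>F F in finite_subsets_at_top UNIV.
      dist (\<Sum>i\<in>F. ket i \<otimes>\<^sub>h Rep_ell2 u i) u < e"
  proof eventually_elim
    case (elim F)
    then have F: "finite F" "dist (sum ?h F) (infsum ?h UNIV) < e\<^sup>2" by auto
    define v where "v = (\<Sum>i\<in>F. ket i \<otimes>\<^sub>h Rep_ell2 u i)"
    have v: "Rep_ell2 v j = (if j \<in> F then Rep_ell2 u j else 0)" for j
      unfolding v_def Rep_ell2_sum Rep_ket_tensor using F(1) by simp
    have "(norm (v - u))\<^sup>2 = (\<Sum>\<^sub>\<infinity>i. (if i \<in> F then 0 else ?h i))"
      unfolding norm_ell2_sq minus_ell2.rep_eq v
      by (rule infsum_cong) simp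
    also have "\<dots> = infsum ?h (UNIV - F)"
      by (rule infsum_cong_neutral) auto
    also have "\<dots> = infsum ?h UNIV - sum ?h F"
      using infsum_Diff[OF ell2_summable[of u] summable_on_finite[OF F(1)]] F(1)
      by (simp only: infsum_finite subset_UNIV)
    also have "\<dots> \<le> dist (sum ?h F) (infsum ?h UNIV)"
      unfolding dist_real_def by linarith
    also have "\<dots> < e\<^sup>2"
      by (rule F(2))
    finally have "norm (v - u) < e"
      by (rule power2_less_imp_less) (use \<open>e > 0\<close> in simp)
    then show ?case
      by (simp only: dist_norm v_def)
  qed
qed

lemma cinner_ket_tensor_right: "cinner f (ket i \<otimes>\<^sub>h x) = cinner (Rep_ell2 f i) x"
proof -
  have "cinner f (ket i \<otimes>\<^sub>h x) = (\<Sum>\<^sub>\<infinity>j\<in>{i}. cinner (Rep_ell2 f i) x)"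
    unfolding cinner_ell2.rep_eq Rep_ket_tensor by (rule infsum_cong_neutral) (auto simp: cinner.zero_right)
  then show ?thesis by simp
qed

lemma ket_tensor_complex: "ket i \<otimes>\<^sub>h z = z *\<^sub>C ket i"
  by (rule ell2_eqI) (simp add: Rep_ket_tensor scaleC_ell2.rep_eq ket.rep_eq scaleC_complex_def)

lemma Rep_ell2_eq_cinner_ket: "Rep_ell2 f i = cinner f (ket i)"
  using cinner_ket_tensor_right[of f i 1] by (simp add: ket_tensor_complex scaleC_one cinner_complex_def)

text \<open>\<open>A\<close> is controlled on the carrier only; continuity is therefore used along
  the partial sums, which stay in \<open>S\<close> together with their limit.\<close>

lemma bounded_op_has_sum:
  assumes A: "bounded_op S T A" and S: "closed_csubspace S"
    and f: "(f has_sum x) I" "\<And>i. i \<in> I \<Longrightarrow> f i \<in> S"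
  shows "((\<lambda>i. A (f i)) has_sum A x) I"
proof -
  obtain B where B: "\<And>x. x \<in> S \<Longrightarrow> norm (A x) \<le> B * norm x"
    using A unfolding bounded_op_def by blast
  have x: "x \<in> S"
    by (rule closed_csubspace_has_sum[OF S f])
  have cs: "csubspace S"
    using S by (simp add: closed_csubspace_def)
  have A0: "A 0 = 0"
    using bounded_op_scaleC[OF A x, of 0] by simp
  have fin: "A (sum f F) = (\<Sum>i\<in>F. A (f i)) \<and> sum f F \<in> S" if "finite F" "F \<subseteq> I" for F
    using that
  proof (induction F rule: finite_induct)
    case (insert i F)
    then show ?case
      using f(2)[of i] bounded_op_add[OF A, of "f i" "sum f F"] complex_vector.subspace_add[OF cs]
      by simp
  qed (simp add: A0 complex_vector.subspace_0[OF cs])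
  have diff: "A (y - x) = A y - A x" if "y \<in> S" for y
    using bounded_op_add[OF A complex_vector.subspace_diff[OF cs that x] x] by simp
  have "((\<lambda>F. A (sum f F) - A x) \<longlongrightarrow> 0) (finite_subsets_at_top I)"
  proof (rule Lim_null_comparison)
    show "\<forall>\<^sub>F F in finite_subsets_at_top I. norm (A (sum f F) - A x) \<le> B * norm (sum f F - x)"
    proof (rule eventually_finite_subsets_at_top_weakI)
      fix F assume "finite F" "F \<subseteq> I"
      then show "norm (A (sum f F) - A x) \<le> B * norm (sum f F - x)"
        using fin[of F] diff[of "sum f F"] B[OF complex_vector.subspace_diff[OF cs _ x], of "sum f F"]
        by simp
    qed
    have "((\<lambda>F. B * norm (sum f F - x)) \<longlongrightarrow> B * norm (x - x)) (finite_subsets_at_top I)"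
      using f(1) unfolding has_sum_def by (intro tendsto_intros)
    then show "((\<lambda>F. B * norm (sum f F - x)) \<longlongrightarrow> 0) (finite_subsets_at_top I)"
      by simp
  qed
  then have "((\<lambda>F. A (sum f F)) \<longlongrightarrow> A x) (finite_subsets_at_top I)"
    by (rule Lim_null[THEN iffD2])
  then show ?thesis
    unfolding has_sum_def
    by (rule Lim_transform_eventually)
      (intro eventually_finite_subsets_at_top_weakI, simp add: fin)
qed

text \<open>Coordinates are continuous, which gives one inclusion; conversely an element is the sum
  of its elementary tensors \<open>ket \<alpha> \<otimes>\<^sub>h Rep_ell2 y \<alpha>\<close>.
  Membership thus becomes a coordinatewise condition.\<close>

lemma fock_tensor_eq:
  assumes "closed_csubspace M"
  shows "fock_tensor M = {y :: ('n list, 'a::chilbert_space) ell2. \<forall>\<alpha>. Rep_ell2 y \<alpha> \<in> M}"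
proof (rule antisym)
  have M: "closed M" "csubspace M"
    using assms by (auto simp: closed_csubspace_def)
  have "closed {y :: ('n list, 'a) ell2. \<forall>\<alpha>. Rep_ell2 y \<alpha> \<in> M}"
    by (intro closed_Collect_all closed_vimage[OF M(1), unfolded vimage_def]
        linear_continuous_on bounded_linear_Rep_ell2)
  moreover have "csubspace {y :: ('n list, 'a) ell2. \<forall>\<alpha>. Rep_ell2 y \<alpha> \<in> M}"
    by (rule complex_vector.subspaceI)
      (auto simp: zero_ell2.rep_eq plus_ell2.rep_eq scaleC_ell2.rep_eq
        complex_vector.subspace_0[OF M(2)] complex_vector.subspace_add[OF M(2)]
        complex_vector.subspace_scale[OF M(2)])
  ultimately show "fock_tensor M \<subseteq> {y :: ('n list, 'a) ell2. \<forall>\<alpha>. Rep_ell2 y \<alpha> \<in> M}"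
    unfolding fock_tensor_def
    by (intro closure_cspan_least)
      (auto simp: closed_csubspace_def tensor.rep_eq complex_vector.subspace_scale[OF M(2)])
next
  show "{y :: ('n list, 'a) ell2. \<forall>\<alpha>. Rep_ell2 y \<alpha> \<in> M} \<subseteq> fock_tensor M"
  proof
    fix y :: "('n list, 'a) ell2" assume "y \<in> {y. \<forall>\<alpha>. Rep_ell2 y \<alpha> \<in> M}"
    then have "ket \<alpha> \<otimes>\<^sub>h Rep_ell2 y \<alpha> \<in> fock_tensor M" for \<alpha>
      unfolding fock_tensor_def
      by (intro subsetD[OF closure_subset] complex_vector.span_base) blast
    then show "y \<in> fock_tensor M"
      by (intro closed_csubspace_has_sum[OF _ ket_tensor_has_sum[of y]])
        (simp_all add: fock_tensor_def closed_csubspace_closure_cspan)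
  qed
qed

lemma closed_csubspace_fock_tensor: "closed_csubspace (fock_tensor M)"
  by (simp add: fock_tensor_def closed_csubspace_closure_cspan)

section \<open>Weighted left shifts\<close>

text \<open>Vector-valued on purpose: with complex coefficients this is a weighted creation
  operator, with coefficients in a Hilbert space it is its tensor product with the identity. For
  bounded weights the family is square-summable, so that \<open>Abs_ell2\<close> is
  meaningful.\<close>

definition left_shift :: "('n list \<Rightarrow> real) \<Rightarrow> 'n \<Rightarrow> ('n list, 'a::chilbert_space) ell2 \<Rightarrow> ('n list, 'a) ell2"
  where "left_shift c i f = Abs_ell2 (\<lambda>\<gamma>. case \<gamma> of [] \<Rightarrow> 0
    | j # \<beta> \<Rightarrow> if j = i then c \<beta> *\<^sub>R Rep_ell2 f \<beta> else 0)"

context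
  fixes c :: "'n list \<Rightarrow> real" and B :: real
  assumes c: "\<And>\<beta>. \<bar>c \<beta>\<bar> \<le> B"
begin

text \<open>Only words that begin with \<open>i\<close> contribute, and reindexing along \<beta>
  \<mapsto> i\<beta> compares the sum with B^2 times that of \<open>f\<close>.\<close>

lemma left_shift_norm_bound:
  fixes f :: "('n list, 'a::chilbert_space) ell2" and i :: 'n
  defines "g \<equiv> \<lambda>\<gamma>. case \<gamma> of [] \<Rightarrow> 0 | j # \<beta> \<Rightarrow> if j = i then c \<beta> *\<^sub>R Rep_ell2 f \<beta> else 0"
  shows "(\<lambda>\<gamma>. (norm (g \<gamma>))\<^sup>2) summable_on UNIV"
    and "(\<Sum>\<^sub>\<infinity>\<gamma>. (norm (g \<gamma>))\<^sup>2) \<le> (B * norm f)\<^sup>2"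
proof -
  have le: "(norm (c \<beta> *\<^sub>R Rep_ell2 f \<beta>))\<^sup>2 \<le> B\<^sup>2 * (norm (Rep_ell2 f \<beta>))\<^sup>2" for \<beta>
    using power_mono[OF c[of \<beta>], of 2] by (simp add: power_mult_distrib mult_right_mono)
  have s: "(\<lambda>\<beta>. B\<^sup>2 * (norm (Rep_ell2 f \<beta>))\<^sup>2) summable_on UNIV"
    by (intro summable_on_cmult_right ell2_summable)
  have s': "(\<lambda>\<beta>. (norm (c \<beta> *\<^sub>R Rep_ell2 f \<beta>))\<^sup>2) summable_on UNIV"
    by (rule summable_on_comparison_test[OF s]) (use le in auto)
  have eq: "(\<lambda>\<gamma>. (norm (g \<gamma>))\<^sup>2) \<circ> (#) i = (\<lambda>\<beta>. (norm (c \<beta> *\<^sub>R Rep_ell2 f \<beta>))\<^sup>2)"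
    by (auto simp: g_def)
  have out: "(norm (g \<gamma>))\<^sup>2 = 0" if "\<gamma> \<notin> range ((#) i)" for \<gamma>
    using that by (auto simp: g_def split: list.splits)
  have "(\<lambda>\<gamma>. (norm (g \<gamma>))\<^sup>2) summable_on range ((#) i)"
    using summable_on_reindex[of "(#) i" UNIV "\<lambda>\<gamma>. (norm (g \<gamma>))\<^sup>2"] eq s' by simp
  then show "(\<lambda>\<gamma>. (norm (g \<gamma>))\<^sup>2) summable_on UNIV"
    by (rule summable_on_cong_neutral[THEN iffD1, rotated -1]) (use out in auto)
  have "(\<Sum>\<^sub>\<infinity>\<gamma>. (norm (g \<gamma>))\<^sup>2) = (\<Sum>\<^sub>\<infinity>\<gamma>\<in>range ((#) i). (norm (g \<gamma>))\<^sup>2)"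
    by (rule infsum_cong_neutral) (use out in auto)
  also have "\<dots> = (\<Sum>\<^sub>\<infinity>\<beta>. (norm (c \<beta> *\<^sub>R Rep_ell2 f \<beta>))\<^sup>2)"
    using infsum_reindex[of "(#) i" UNIV "\<lambda>\<gamma>. (norm (g \<gamma>))\<^sup>2"] eq by simp
  also have "\<dots> \<le> (\<Sum>\<^sub>\<infinity>\<beta>. B\<^sup>2 * (norm (Rep_ell2 f \<beta>))\<^sup>2)"
    by (rule infsum_mono[OF s' s le])
  also have "\<dots> = (B * norm f)\<^sup>2"
    by (simp add: infsum_cmult_right' norm_ell2_sq[symmetric] power_mult_distrib)
  finally show "(\<Sum>\<^sub>\<infinity>\<gamma>. (norm (g \<gamma>))\<^sup>2) \<le> (B * norm f)\<^sup>2" .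
qed

lemma Rep_left_shift:
  "Rep_ell2 (left_shift c i f) \<gamma> = (case \<gamma> of [] \<Rightarrow> 0
    | j # \<beta> \<Rightarrow> if j = i then c \<beta> *\<^sub>R Rep_ell2 f \<beta> else 0)"
  unfolding left_shift_def using left_shift_norm_bound(1)[of i f] by (subst Abs_ell2_inverse) auto

lemma bounded_op_left_shift: "bounded_op UNIV UNIV (left_shift c i)"
proof -
  have B: "0 \<le> B" using c[of undefined] by linarith
  have "norm (left_shift c i f) \<le> B * norm f" for f :: "('n list, 'a) ell2"
    by (rule power2_le_imp_le)
      (use left_shift_norm_bound(2)[of i f] B in \<open>simp_all add: norm_ell2_sq Rep_left_shift\<close>)
  moreover have "left_shift c i (f + g) = left_shift c i f + left_shift c i g"
    for f g :: "('n list, 'a) ell2"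
    by (rule ell2_eqI)
      (simp add: Rep_left_shift plus_ell2.rep_eq scaleR_right_distrib split: list.splits)
  moreover have "left_shift c i (z *\<^sub>C f) = z *\<^sub>C left_shift c i f"
    for z and f :: "('n list, 'a) ell2"
    by (rule ell2_eqI)
      (simp add: Rep_left_shift scaleC_ell2.rep_eq scaleR_scaleC scaleC_scaleC mult.commute split: list.splits)
  ultimately show ?thesis
    unfolding bounded_op_def by auto
qed

lemma left_shift_tensor: "left_shift c i (f \<otimes>\<^sub>h d) = left_shift c i f \<otimes>\<^sub>h d"
  by (rule ell2_eqI)
    (simp add: Rep_left_shift tensor.rep_eq scaleR_scaleC[of _ d] scaleR_scaleC scaleC_scaleC scaleC_complex_def
      split: list.splits)

lemma left_shift_ket: "left_shift c i (ket \<beta>) = c \<beta> *\<^sub>R ket (i # \<beta>)"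
  by (rule ell2_eqI) (auto simp add: Rep_left_shift ket.rep_eq scaleR_ell2.rep_eq split: list.splits)

end

section \<open>Concrete C*-algebras and their representations\<close>

text \<open>This makes the space of bounded operators complete, as the fixed point construction of
  square roots requires.\<close>

instance chilbert_space \<subseteq> banach ..

lemma clinear_op_iff: "clinear_op A \<longleftrightarrow> bounded_op UNIV UNIV (blinfun_apply A)"
  by (simp add: clinear_op_def bounded_op_UNIV_iff blinfun.bounded_linear_right)

lemma scaleC_op_apply [simp]: "blinfun_apply (scaleC_op c A) x = c *\<^sub>C blinfun_apply A x"
  unfolding scaleC_op_def
  by (simp add: bounded_linear_Blinfun_apply bounded_linear_compose[OF bounded_linear_scaleC]
      blinfun.bounded_linear_right)

lemma scaleR_eq_scaleC_op: "r *\<^sub>R A = scaleC_op (complex_of_real r) A"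
  by (rule blinfun_eqI) (simp add: blinfun.scaleR_left scaleC_of_real)

lemma clinear_op_scaleC: "clinear_op A \<Longrightarrow> blinfun_apply A (c *\<^sub>C x) = c *\<^sub>C blinfun_apply A x"
  by (simp add: clinear_op_def)

context
  fixes A :: "'a::chilbert_space \<Rightarrow>\<^sub>L 'a"
  assumes A: "clinear_op A"
begin

lemma adj_op_apply: "blinfun_apply (adj_op A) = adj_on UNIV (blinfun_apply A)"
  unfolding adj_op_def using bounded_op_adj[OF A[unfolded clinear_op_iff]]
  by (simp add: bounded_op_UNIV_iff bounded_linear_Blinfun_apply)

lemma cinner_adj_op: "cinner (blinfun_apply A x) y = cinner x (blinfun_apply (adj_op A) y)"
  unfolding adj_op_apply by (rule cinner_adj) (rule A[unfolded clinear_op_iff])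

lemma cinner_adj_op_left: "cinner (blinfun_apply (adj_op A) x) y = cinner x (blinfun_apply A y)"
  by (metis cinner_adj_op cinner_commute)

lemma clinear_adj_op: "clinear_op (adj_op A)"
  unfolding clinear_op_iff adj_op_apply by (rule bounded_op_adj) (rule A[unfolded clinear_op_iff])

lemma adj_op_eqI:
  assumes "\<And>x y. cinner (blinfun_apply A x) y = cinner x (blinfun_apply B y)"
  shows "adj_op A = B"
  by (rule blinfun_eqI, rule cinner_eqI) (simp add: cinner_adj_op[symmetric] assms)

lemma norm_adj_op_le: "norm (adj_op A) \<le> norm A"
  by (rule norm_blinfun_bound)
    (simp_all add: adj_op_apply norm_adj_le[OF A[unfolded clinear_op_iff]] norm_blinfun)

end

lemma adj_op_adj_op: "clinear_op A \<Longrightarrow> adj_op (adj_op A) = A"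
  by (rule adj_op_eqI) (simp_all add: clinear_adj_op cinner_adj_op_left)

lemma clinear_op_compose: "clinear_op A \<Longrightarrow> clinear_op B \<Longrightarrow> clinear_op (A o\<^sub>L B)"
  by (simp add: clinear_op_def)

lemma adj_op_compose:
  "clinear_op A \<Longrightarrow> clinear_op B \<Longrightarrow> adj_op (A o\<^sub>L B) = adj_op B o\<^sub>L adj_op A"
  by (rule adj_op_eqI) (simp_all add: clinear_op_compose cinner_adj_op)

text \<open>Ensures that the intersection in \<open>cstar_generated\<close> is over a nonempty
  family. It also serves as the ambient algebra in which limits of complex-linear operators stay
  complex-linear.\<close>

lemma unital_cstar_subalgebra_clinear: "unital_cstar_subalgebra {A. clinear_op A}"
proof -
  have "closed {A :: 'a \<Rightarrow>\<^sub>L 'a. clinear_op A}"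
    unfolding clinear_op_def
    by (intro closed_Collect_all closed_Collect_eq linear_continuous_on
        bounded_linear_compose[OF bounded_linear_scaleC] blinfun.bounded_linear_left)
  then show ?thesis
    unfolding unital_cstar_subalgebra_def
    by (auto simp: clinear_adj_op clinear_op_compose)
      (auto simp: clinear_op_def blinfun.add_left scaleC_add_right scaleC_scaleC mult.commute)
qed

lemma unital_cstar_subalgebra_cstar_generated:
  assumes "\<And>A. A \<in> G \<Longrightarrow> clinear_op A"
  shows "unital_cstar_subalgebra (cstar_generated G)"
proof -
  have "cstar_generated G \<subseteq> {A. clinear_op A}"
    using assms unital_cstar_subalgebra_clinear unfolding cstar_generated_def by blast
  moreover have "closed (cstar_generated G)"
    unfolding cstar_generated_def by (rule closed_Inter) (auto simp: unital_cstar_subalgebra_def)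
  ultimately show ?thesis
    unfolding unital_cstar_subalgebra_def[of "cstar_generated G"]
    by (auto simp: cstar_generated_def unital_cstar_subalgebra_def)
qed

lemma cstar_generated_base: "A \<in> G \<Longrightarrow> A \<in> cstar_generated G"
  by (auto simp: cstar_generated_def)

lemma
  assumes "unital_cstar_subalgebra \<A>"
  shows cstar_clinear: "\<And>A. A \<in> \<A> \<Longrightarrow> clinear_op A"
    and cstar_id: "id_blinfun \<in> \<A>"
    and cstar_add: "\<And>A B. A \<in> \<A> \<Longrightarrow> B \<in> \<A> \<Longrightarrow> A + B \<in> \<A>"
    and cstar_compose: "\<And>A B. A \<in> \<A> \<Longrightarrow> B \<in> \<A> \<Longrightarrow> A o\<^sub>L B \<in> \<A>"
    and cstar_scaleC: "\<And>c A. A \<in> \<A> \<Longrightarrow> scaleC_op c A \<in> \<A>"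
    and cstar_adj: "\<And>A. A \<in> \<A> \<Longrightarrow> adj_op A \<in> \<A>"
    and cstar_closed: "closed \<A>"
  using assms unfolding unital_cstar_subalgebra_def by blast+

lemma cstar_scaleR: "unital_cstar_subalgebra \<A> \<Longrightarrow> A \<in> \<A> \<Longrightarrow> r *\<^sub>R A \<in> \<A>"
  by (simp add: scaleR_eq_scaleC_op cstar_scaleC)

lemma cstar_sum:
  assumes "unital_cstar_subalgebra \<A>" "\<And>i. i \<in> I \<Longrightarrow> f i \<in> \<A>"
  shows "sum f I \<in> \<A>"
proof -
  have "(0 :: 'a \<Rightarrow>\<^sub>L 'a) \<in> \<A>"
    using cstar_scaleR[OF assms(1) cstar_id[OF assms(1)], of 0] by simp
  with assms(2) show ?thesis
    by (induction I rule: infinite_finite_induct) (auto intro: cstar_add[OF assms(1)])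
qed

text \<open>
  The square root of \<open>1 - T\<close> is \<open>1 - X\<close> for the fixed point \<open>X\<close> of the contraction
  \<open>X \<mapsto> (T + X\<^sup>2)/2\<close> of the ball of radius \<open>\<parallel>T\<parallel>\<close>.
\<close>

lemma cstar_sqrt:
  assumes \<A>: "unital_cstar_subalgebra \<A>" and T: "T \<in> \<A>" "adj_op T = T" "norm T < 1"
  shows "\<exists>B\<in>\<A>. adj_op B = B \<and> B o\<^sub>L B = id_blinfun - T"
proof -
  \<comment> \<open>Self-adjointness in a form that is visibly a closed condition; on the algebra it
    agrees with \<open>adj_op X = X\<close>.\<close>
  define sa where "sa X \<longleftrightarrow> (\<forall>x y. cinner (blinfun_apply X x) y = cinner x (blinfun_apply X y))"
    for X :: "'a \<Rightarrow>\<^sub>L 'a"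
  define S where "S = \<A> \<inter> {X. sa X} \<inter> cball 0 (norm T)"
  define f where "f X = (1/2) *\<^sub>R (T + (X o\<^sub>L X))" for X
  have sa: "adj_op X = X \<longleftrightarrow> sa X" if "X \<in> \<A>" for X
    using adj_op_eqI[OF cstar_clinear[OF \<A> that], of X] cinner_adj_op[OF cstar_clinear[OF \<A> that]]
    unfolding sa_def by metis
  have "closed {X :: 'a \<Rightarrow>\<^sub>L 'a. sa X}"
    unfolding sa_def
    by (intro closed_Collect_all closed_Collect_eq linear_continuous_on blinfun.bounded_linear_left
        bounded_linear_compose[OF cinner.bounded_linear_left]
        bounded_linear_compose[OF cinner.bounded_linear_right])
  then have "complete S"
    unfolding S_def complete_eq_closed by (intro closed_Int cstar_closed[OF \<A>] closed_cball)
  moreover have "T \<in> S"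
    using T sa by (simp add: S_def)
  moreover have "f ` S \<subseteq> S"
  proof
    fix Y assume "Y \<in> f ` S"
    then obtain X where X: "X \<in> \<A>" "sa X" "norm X \<le> norm T" and Y: "Y = f X"
      by (auto simp: S_def)
    have "Y \<in> \<A>"
      unfolding Y f_def using X T by (intro cstar_scaleR[OF \<A>] cstar_add[OF \<A>] cstar_compose[OF \<A>])
    moreover have "sa Y"
      using X(2) T sa[OF T(1)]
      by (simp add: sa_def Y f_def blinfun.scaleR_left blinfun.add_left cinner.scaleR_left
          cinner.scaleR_right cinner.add_left cinner.add_right)
    moreover have "norm Y \<le> norm T"
    proof -
      have "norm (X o\<^sub>L X) \<le> norm X * norm X"
        by (rule norm_blinfun_compose)
      also have "\<dots> \<le> norm T * norm T"
        by (intro mult_mono X) auto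
      also have "\<dots> \<le> norm T * 1"
        using T(3) by (intro mult_left_mono) auto
      finally have "norm (T + (X o\<^sub>L X)) \<le> norm T + norm T"
        by (intro norm_triangle_le) simp
      then show ?thesis
        by (simp add: Y f_def)
    qed
    ultimately show "Y \<in> S"
      by (simp add: S_def)
  qed
  moreover have "\<forall>X\<in>S. \<forall>Y\<in>S. dist (f X) (f Y) \<le> norm T * dist X Y"
  proof (intro ballI)
    fix X Y assume "X \<in> S" "Y \<in> S"
    then have n: "norm X \<le> norm T" "norm Y \<le> norm T"
      by (auto simp: S_def)
    \<comment> \<open>From X^2 - Y^2 = X (X - Y) + (X - Y) Y the Lipschitz constant on the ball is
      \<open>norm T\<close>, which is below 1.\<close>
    have "f X - f Y = (1/2) *\<^sub>R ((X o\<^sub>L (X - Y)) + ((X - Y) o\<^sub>L Y))"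
      by (rule blinfun_eqI)
        (simp add: f_def blinfun.scaleR_left blinfun.add_left blinfun.diff_left blinfun.diff_right
          scaleR_diff_right scaleR_add_right)
    moreover have "norm (X o\<^sub>L (X - Y)) \<le> norm T * norm (X - Y)"
      by (rule order_trans[OF norm_blinfun_compose]) (intro mult_right_mono n norm_ge_zero)
    moreover have "norm ((X - Y) o\<^sub>L Y) \<le> norm (X - Y) * norm T"
      by (rule order_trans[OF norm_blinfun_compose]) (intro mult_left_mono n norm_ge_zero)
    ultimately show "dist (f X) (f Y) \<le> norm T * dist X Y"
      using norm_triangle_ineq[of "X o\<^sub>L (X - Y)" "(X - Y) o\<^sub>L Y"]
      by (simp add: dist_norm mult.commute)
  qed
  ultimately have "\<exists>!X\<in>S. f X = X"
    using T(3) by (intro Banach_fix[of S "norm T"]) auto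
  then obtain X where X: "X \<in> \<A>" "sa X" "f X = X"
    by (auto simp: S_def)
  \<comment> \<open>The fixed point equation 2X = T + X^2 is what makes (1 - X)^2 equal to 1 -
    T.\<close>
  have X2: "blinfun_apply X x + blinfun_apply X x = blinfun_apply T x + blinfun_apply X (blinfun_apply X x)" for x
  proof -
    have "2 *\<^sub>R blinfun_apply X x = 2 *\<^sub>R blinfun_apply (f X) x"
      by (simp only: X(3))
    also have "\<dots> = blinfun_apply T x + blinfun_apply X (blinfun_apply X x)"
      by (simp add: f_def blinfun.scaleR_left blinfun.add_left)
    finally show ?thesis by (simp add: scaleR_2)
  qed
  define B where "B = id_blinfun + (- 1) *\<^sub>R X"
  have "B \<in> \<A>"
    unfolding B_def by (intro cstar_add[OF \<A>] cstar_id[OF \<A>] cstar_scaleR[OF \<A>] X)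
  moreover have "sa B"
    using X(2) by (simp add: B_def sa_def blinfun.diff_left cinner.diff_left cinner.diff_right)
  moreover have "B o\<^sub>L B = id_blinfun - T"
    by (rule blinfun_eqI)
      (use X2 in \<open>simp add: B_def blinfun.diff_left blinfun.diff_right algebra_simps\<close>)
  ultimately show ?thesis
    using sa by blast
qed

lemma
  assumes "unital_star_representation \<A> \<pi>"
  shows rep_clinear: "\<And>A. A \<in> \<A> \<Longrightarrow> clinear_op (\<pi> A)"
    and rep_id: "\<pi> id_blinfun = id_blinfun"
    and rep_add: "\<And>A B. A \<in> \<A> \<Longrightarrow> B \<in> \<A> \<Longrightarrow> \<pi> (A + B) = \<pi> A + \<pi> B"
    and rep_compose: "\<And>A B. A \<in> \<A> \<Longrightarrow> B \<in> \<A> \<Longrightarrow> \<pi> (A o\<^sub>L B) = \<pi> A o\<^sub>L \<pi> B"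
    and rep_scaleC: "\<And>c A. A \<in> \<A> \<Longrightarrow> \<pi> (scaleC_op c A) = scaleC_op c (\<pi> A)"
    and rep_adj: "\<And>A. A \<in> \<A> \<Longrightarrow> \<pi> (adj_op A) = adj_op (\<pi> A)"
  using assms unfolding unital_star_representation_def by blast+

lemma rep_scaleR:
  "unital_star_representation \<A> \<pi> \<Longrightarrow> A \<in> \<A> \<Longrightarrow> \<pi> (r *\<^sub>R A) = r *\<^sub>R \<pi> A"
  by (simp add: scaleR_eq_scaleC_op rep_scaleC)

text \<open>If \<open>norm A < 1\<close>, then 1 - A^* A = B^2 with \<open>B\<close> self-adjoint in
  the algebra. Applying \<open>\<pi>\<close> gives \<parallel>x\<parallel>^2 - \<parallel>\<pi>(A)
  x\<parallel>^2 = \<parallel>\<pi>(B) x\<parallel>^2, which is nonnegative.\<close>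

theorem rep_contractive:
  assumes \<A>: "unital_cstar_subalgebra \<A>" and \<pi>: "unital_star_representation \<A> \<pi>" and A: "A \<in> \<A>"
  shows "norm (\<pi> A) \<le> norm A"
proof -
  have le1: "norm (blinfun_apply (\<pi> A) x) \<le> norm x" if A: "A \<in> \<A>" "norm A < 1" for A x
  proof -
    note cA = cstar_clinear[OF \<A> A(1)]
    note c\<pi>A = rep_clinear[OF \<pi> A(1)]
    define T where "T = adj_op A o\<^sub>L A"
    have T: "T \<in> \<A>"
      unfolding T_def by (intro cstar_compose[OF \<A>] cstar_adj[OF \<A>] A)
    have "adj_op T = T"
      unfolding T_def by (simp add: adj_op_compose cA clinear_adj_op adj_op_adj_op)
    moreover have "norm T < 1"
    proof -
      have "norm T \<le> norm (adj_op A) * norm A"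
        unfolding T_def by (rule norm_blinfun_compose)
      also have "\<dots> \<le> 1 * norm A"
        using norm_adj_op_le[OF cA] A(2) by (intro mult_right_mono) auto
      finally show ?thesis using A(2) by simp
    qed
    ultimately obtain B where B: "B \<in> \<A>" "adj_op B = B" "B o\<^sub>L B = id_blinfun - T"
      using cstar_sqrt[OF \<A> T] by blast
    have "\<pi> B o\<^sub>L \<pi> B = \<pi> (id_blinfun + (- 1) *\<^sub>R T)"
      using B(3) rep_compose[OF \<pi> B(1) B(1)] by simp
    also have "\<dots> = id_blinfun + (- 1) *\<^sub>R \<pi> T"
      by (simp only: rep_add[OF \<pi> cstar_id[OF \<A>] cstar_scaleR[OF \<A> T]] rep_id[OF \<pi>]
          rep_scaleR[OF \<pi> T])
    also have "\<pi> T = adj_op (\<pi> A) o\<^sub>L \<pi> A"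
      by (simp only: T_def rep_compose[OF \<pi> cstar_adj[OF \<A> A(1)] A(1)] rep_adj[OF \<pi> A(1)])
    finally have BB: "blinfun_apply (\<pi> B) (blinfun_apply (\<pi> B) x) =
        x - blinfun_apply (adj_op (\<pi> A)) (blinfun_apply (\<pi> A) x)"
      by (metis (no_types, lifting) blinfun_apply_blinfun_compose blinfun.add_left
          blinfun.scaleR_left id_blinfun.rep_eq id_apply scaleR_minus1_left uminus_add_conv_diff add.commute)
    have "complex_of_real ((norm (blinfun_apply (\<pi> B) x))\<^sup>2) =
        cinner x (blinfun_apply (\<pi> B) (blinfun_apply (\<pi> B) x))"
      unfolding cinner_self[symmetric] cinner_adj_op[OF rep_clinear[OF \<pi> B(1)]]
      using rep_adj[OF \<pi> B(1)] B(2) by simp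
    also have "\<dots> = complex_of_real ((norm x)\<^sup>2 - (norm (blinfun_apply (\<pi> A) x))\<^sup>2)"
      unfolding BB by (simp add: cinner.diff_right cinner_adj_op[OF c\<pi>A, symmetric] cinner_self)
    finally have "(norm (blinfun_apply (\<pi> B) x))\<^sup>2 = (norm x)\<^sup>2 - (norm (blinfun_apply (\<pi> A) x))\<^sup>2"
      by (simp only: of_real_eq_iff)
    then have "(norm (blinfun_apply (\<pi> A) x))\<^sup>2 \<le> (norm x)\<^sup>2"
      using zero_le_power2[of "norm (blinfun_apply (\<pi> B) x)"] by linarith
    then show ?thesis
      by (rule power2_le_imp_le) simp
  qed
  \<comment> \<open>For every c above \<open>norm A\<close> the operator A/c is a strict
    contraction, so the first part applies to it; then c is lowered to
    \<open>norm A\<close>.\<close>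
  show ?thesis
  proof (rule dense_ge)
    fix c assume c: "norm A < c"
    then have c0: "c > 0" using norm_ge_zero[of A] by linarith
    have "norm (blinfun_apply (\<pi> A) x) \<le> c * norm x" for x
      using le1[OF cstar_scaleR[OF \<A> A, of "1 / c"], of x] c c0
      by (simp add: rep_scaleR[OF \<pi> A] blinfun.scaleR_left field_simps)
    then show "norm (\<pi> A) \<le> c"
      using c0 by (intro norm_blinfun_bound) auto
  qed
qed

lemma rep_diff:
  assumes \<A>: "unital_cstar_subalgebra \<A>" and \<pi>: "unital_star_representation \<A> \<pi>"
    and A: "A \<in> \<A>" "B \<in> \<A>"
  shows "A - B \<in> \<A>" "\<pi> (A - B) = \<pi> A - \<pi> B"
proof -
  have e: "A - B = A + (- 1) *\<^sub>R B" by simp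
  show "A - B \<in> \<A>" unfolding e by (intro cstar_add[OF \<A>] cstar_scaleR[OF \<A>] A)
  show "\<pi> (A - B) = \<pi> A - \<pi> B"
    unfolding e rep_add[OF \<pi> A(1) cstar_scaleR[OF \<A> A(2)]] rep_scaleR[OF \<pi> A(2)] by simp
qed

lemma rep_sum:
  assumes \<A>: "unital_cstar_subalgebra \<A>" and \<pi>: "unital_star_representation \<A> \<pi>"
    and f: "\<And>i. i \<in> I \<Longrightarrow> f i \<in> \<A>"
  shows "\<pi> (sum f I) = (\<Sum>i\<in>I. \<pi> (f i))"
proof -
  have z: "\<pi> 0 = 0"
    using rep_scaleR[OF \<pi> cstar_id[OF \<A>], of 0] by simp
  show ?thesis using f
    by (induction I rule: infinite_finite_induct)
      (simp_all add: z rep_add[OF \<pi>] cstar_sum[OF \<A>])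
qed

text \<open>Contractivity turns norm convergence in the algebra into norm convergence of the images.
  This carries the defect series from the W_i to the V_i.\<close>

lemma rep_tendsto:
  assumes \<A>: "unital_cstar_subalgebra \<A>" and \<pi>: "unital_star_representation \<A> \<pi>"
    and f: "\<And>i. f i \<in> \<A>" "(f \<longlongrightarrow> A) F" "F \<noteq> bot"
  shows "A \<in> \<A>" "((\<lambda>i. \<pi> (f i)) \<longlongrightarrow> \<pi> A) F"
proof -
  show A: "A \<in> \<A>"
    by (rule Lim_in_closed_set[OF cstar_closed[OF \<A>] _ f(3,2)]) (simp add: f(1))
  have "((\<lambda>i. norm (f i - A)) \<longlongrightarrow> 0) F"
    using f(2) by (simp add: tendsto_norm_zero_iff LIM_zero)
  then have "((\<lambda>i. \<pi> (f i) - \<pi> A) \<longlongrightarrow> 0) F"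
    by (rule Lim_null_comparison[rotated])
      (simp add: rep_diff(2)[OF \<A> \<pi> f(1) A, symmetric] rep_contractive[OF \<A> \<pi> rep_diff(1)[OF \<A> \<pi> f(1) A]])
  then show "((\<lambda>i. \<pi> (f i)) \<longlongrightarrow> \<pi> A) F"
    by (rule Lim_null[THEN iffD2])
qed

section \<open>Inverses of noncommutative power series\<close>

text \<open>A factorisation of \<open>\<gamma>\<close> is determined by its cut position, so the sum
  over pairs of words becomes a sum over \<open>k\<close>.\<close>

lemma nc_mult_eq: "nc_mult a b \<gamma> = (\<Sum>k\<le>length \<gamma>. a (take k \<gamma>) * b (drop k \<gamma>))"
proof -
  have "{(\<alpha>, \<beta>). \<alpha> @ \<beta> = \<gamma>} = (\<lambda>k. (take k \<gamma>, drop k \<gamma>)) ` {..length \<gamma>}"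
  proof -
    have "(\<alpha>, \<beta>) \<in> (\<lambda>k. (take k (\<alpha> @ \<beta>), drop k (\<alpha> @ \<beta>))) ` {..length (\<alpha> @ \<beta>)}" for \<alpha> \<beta> :: "'a list"
      by (rule image_eqI[of _ _ "length \<alpha>"]) auto
    then show ?thesis by auto
  qed
  moreover have "inj_on (\<lambda>k. (take k \<gamma>, drop k \<gamma>)) {..length \<gamma>}"
  proof (rule inj_onI)
    fix k l assume "k \<in> {..length \<gamma>}" "l \<in> {..length \<gamma>}"
      "(take k \<gamma>, drop k \<gamma>) = (take l \<gamma>, drop l \<gamma>)"
    then show "k = l"
      by (metis Pair_inject atMost_iff length_take min.absorb2)
  qed
  ultimately show ?thesis
    unfolding nc_mult_def by (simp add: sum.reindex)
qed

lemma nc_mult_assoc: "nc_mult (nc_mult a b) c = nc_mult a (nc_mult b c)"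
proof
  fix \<gamma>
  \<comment> \<open>The contribution of cutting \<open>\<gamma>\<close> into pieces of lengths i and
    j and a remainder. Both bracketings sum it over the triangle i + j \<le> length
    \<gamma>.\<close>
  define g where "g i j = a (take i \<gamma>) * b (take j (drop i \<gamma>)) * c (drop (i + j) \<gamma>)" for i j
  have "nc_mult (nc_mult a b) c \<gamma> = (\<Sum>k\<le>length \<gamma>. \<Sum>i\<le>k. g i (k - i))"
    unfolding nc_mult_eq g_def
    by (intro sum.cong refl)
      (auto simp: sum_distrib_right min.absorb1 min.absorb2 drop_take intro!: sum.cong)
  also have "\<dots> = (\<Sum>(i, j)\<in>{(i, j). i + j \<le> length \<gamma>}. g i j)"
    by (rule sum.triangle_reindex_eq[symmetric])
  also have "{(i, j). i + j \<le> length \<gamma>} = (SIGMA i:{..length \<gamma>}. {..length \<gamma> - i})"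
    by auto
  also have "(\<Sum>(i, j)\<in>(SIGMA i:{..length \<gamma>}. {..length \<gamma> - i}). g i j) = nc_mult a (nc_mult b c) \<gamma>"
    unfolding nc_mult_eq g_def
    by (simp add: sum.Sigma[symmetric] sum_distrib_left mult.assoc add.commute)
  finally show "nc_mult (nc_mult a b) c \<gamma> = nc_mult a (nc_mult b c) \<gamma>" .
qed

lemma nc_mult_one_left: "nc_mult nc_one a = a"
proof
  fix \<gamma>
  have "nc_mult nc_one a \<gamma> = (\<Sum>k\<le>length \<gamma>. if k = 0 then a \<gamma> else 0)"
    unfolding nc_mult_eq by (rule sum.cong) (auto simp: nc_one_def)
  then show "nc_mult nc_one a \<gamma> = a \<gamma>"
    by simp
qed

lemma nc_mult_one_right: "nc_mult a nc_one = a"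
proof
  fix \<gamma>
  have "nc_mult a nc_one \<gamma> = (\<Sum>k\<le>length \<gamma>. if k = length \<gamma> then a \<gamma> else 0)"
    unfolding nc_mult_eq by (rule sum.cong) (auto simp: nc_one_def)
  then show "nc_mult a nc_one \<gamma> = a \<gamma>"
    by simp
qed

text \<open>The equation b a = 1 solved for the coefficient at \<open>\<gamma>\<close>: the empty
  prefix contributes a(\<gamma>) with factor \<open>b [] = 1\<close>, and the other prefixes involve
  \<open>a\<close> on proper suffixes only.\<close>

function nc_right_inverse :: "('n list \<Rightarrow> real) \<Rightarrow> 'n list \<Rightarrow> real"
  where "nc_right_inverse b \<gamma> = (if \<gamma> = [] then 1
    else - (\<Sum>k\<in>{1..length \<gamma>}. b (take k \<gamma>) * nc_right_inverse b (drop k \<gamma>)))"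
  by pat_completeness auto
termination
  by (relation "Wellfounded.measure (\<lambda>(b, \<gamma>). length \<gamma>)") auto

declare nc_right_inverse.simps [simp del]

lemma nc_mult_right_inverse:
  fixes b :: "'n list \<Rightarrow> real"
  assumes "b [] = 1"
  shows "nc_mult b (nc_right_inverse b) = nc_one"
proof
  fix \<gamma> :: "'n list"
  have "{..length \<gamma>} = insert 0 {1..length \<gamma>}"
    by auto
  then have "nc_mult b (nc_right_inverse b) \<gamma> =
      nc_right_inverse b \<gamma> + (\<Sum>k\<in>{1..length \<gamma>}. b (take k \<gamma>) * nc_right_inverse b (drop k \<gamma>))"
    unfolding nc_mult_eq by (simp add: assms)
  then show "nc_mult b (nc_right_inverse b) \<gamma> = nc_one \<gamma>"
    by (subst (asm) (1) nc_right_inverse.simps) (auto simp: nc_one_def)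
qed

text \<open>The right inverse \<open>a\<close> of \<open>b\<close> has a right inverse of its own,
  which associativity forces to be \<open>b\<close>. Hence \<open>a\<close> is two-sided and unique,
  as the definite description requires.\<close>

lemma nc_inverse:
  assumes "b [] = 1"
  shows "nc_mult (nc_inverse b) b = nc_one" "nc_mult b (nc_inverse b) = nc_one"
proof -
  define a where "a = nc_right_inverse b"
  have ba: "nc_mult b a = nc_one"
    using nc_mult_right_inverse[of b] assms by (simp add: a_def)
  have ac: "nc_mult a (nc_right_inverse a) = nc_one"
    by (rule nc_mult_right_inverse) (simp add: a_def nc_right_inverse.simps)
  have "nc_right_inverse a = b"
    by (metis ba ac nc_mult_assoc nc_mult_one_left nc_mult_one_right)
  with ac have ab: "nc_mult a b = nc_one"
    by simp
  have "nc_mult (nc_inverse b) b = nc_one \<and> nc_mult b (nc_inverse b) = nc_one"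
    unfolding nc_inverse_def
  proof (rule theI[of _ a])
    fix a' assume "nc_mult a' b = nc_one \<and> nc_mult b a' = nc_one"
    then show "a' = a"
      by (metis ba nc_mult_assoc nc_mult_one_left nc_mult_one_right)
  qed (simp add: ab ba)
  then show "nc_mult (nc_inverse b) b = nc_one" "nc_mult b (nc_inverse b) = nc_one"
    by auto
qed

lemma nc_inverse_Nil: "b [] = 1 \<Longrightarrow> nc_inverse b [] = 1"
  using nc_inverse(1)[of b] by (auto dest!: fun_cong[of _ _ "[]"] simp: nc_mult_eq nc_one_def)

section \<open>Weighted left creation operators\<close>

lemma finite_words: "finite {\<alpha> :: 'n::finite list. length \<alpha> = p}"
  using finite_lists_length_eq[of "UNIV :: 'n set" p] by simp

lemma cinner_ket: "cinner (ket \<alpha>) (ket \<beta>) = (if \<alpha> = \<beta> then 1 else 0)"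
  unfolding Rep_ell2_eq_cinner_ket[symmetric] by (simp add: ket.rep_eq)

lemma ket_scaleC_has_sum: "((\<lambda>i. Rep_ell2 f i *\<^sub>C ket i) has_sum f) UNIV"
  using ket_tensor_has_sum[of f] by (simp add: ket_tensor_complex)

lemma clinear_op_0: "clinear_op 0"
  by (simp add: clinear_op_def)

lemma clinear_op_scaleR: "clinear_op A \<Longrightarrow> clinear_op (r *\<^sub>R A)"
  by (simp add: scaleR_eq_scaleC_op clinear_op_def scaleC_scaleC mult.commute)

text \<open>Every vector is the sum of its coordinates times basis vectors, and bounded
  complex-linear operators respect such sums. All relations on the Fock space below are checked on
  basis vectors through this rule.\<close>

lemma clinear_op_ket_eqI:
  assumes "clinear_op A" "clinear_op B"
    and "\<And>\<alpha>. blinfun_apply A (ket \<alpha>) = blinfun_apply B (ket \<alpha>)"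
  shows "A = B"
proof (rule blinfun_eqI)
  fix f :: "('a, complex) ell2"
  have "((\<lambda>i. blinfun_apply A (Rep_ell2 f i *\<^sub>C ket i)) has_sum blinfun_apply A f) UNIV"
    "((\<lambda>i. blinfun_apply B (Rep_ell2 f i *\<^sub>C ket i)) has_sum blinfun_apply B f) UNIV"
    using assms(1,2) unfolding clinear_op_iff
    by (auto intro!: bounded_op_has_sum[OF _ closed_csubspace_UNIV ket_scaleC_has_sum])
  then show "blinfun_apply A f = blinfun_apply B f"
    using assms by (auto simp: clinear_op_scaleC intro: has_sum_unique)
qed

context
  fixes b :: "'n::finite list \<Rightarrow> real"
  assumes adm: "admissible b"
begin

lemma admissible_Nil: "b [] = 1" and admissible_pos: "0 < b \<alpha>"
  using adm by (auto simp: admissible_def)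

lemma creation_weight_bounded: "\<exists>B. \<forall>\<beta>. \<bar>sqrt (b \<beta> / b (i # \<beta>))\<bar> \<le> B"
proof -
  obtain M where "\<And>\<beta>. b \<beta> / b (i # \<beta>) \<le> M"
    using adm unfolding admissible_def bdd_above_def by blast
  then show ?thesis
    using admissible_pos by (intro exI[of _ "sqrt M"]) (auto simp: less_imp_le)
qed

text \<open>The shift is the witness for the definite description; uniqueness holds because the
  values on basis vectors determine the operator.\<close>

lemma
  shows clinear_weighted_creation: "clinear_op (weighted_creation b i)"
    and weighted_creation_eq:
      "blinfun_apply (weighted_creation b i) = left_shift (\<lambda>\<beta>. sqrt (b \<beta> / b (i # \<beta>))) i"
proof -
  obtain B where B: "\<And>\<beta>. \<bar>sqrt (b \<beta> / b (i # \<beta>))\<bar> \<le> B"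
    using creation_weight_bounded by blast
  define T :: "'n fock \<Rightarrow>\<^sub>L 'n fock" where "T = Blinfun (left_shift (\<lambda>\<beta>. sqrt (b \<beta> / b (i # \<beta>))) i)"
  have op: "bounded_op UNIV UNIV
      (left_shift (\<lambda>\<beta>. sqrt (b \<beta> / b (i # \<beta>))) i :: 'n fock \<Rightarrow> 'n fock)"
    by (rule bounded_op_left_shift[OF B])
  then have T: "blinfun_apply T = left_shift (\<lambda>\<beta>. sqrt (b \<beta> / b (i # \<beta>))) i"
    by (simp add: T_def bounded_op_UNIV_iff bounded_linear_Blinfun_apply)
  have "weighted_creation b i = T"
    unfolding weighted_creation_def
  proof (rule the_equality)
    show *: "clinear_op T \<and>
        (\<forall>\<alpha>. blinfun_apply T (ket \<alpha>) = sqrt (b \<alpha> / b (i # \<alpha>)) *\<^sub>R ket (i # \<alpha>))"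
      using op by (auto simp: T clinear_op_iff left_shift_ket[OF B])
    fix T' assume "clinear_op T' \<and>
        (\<forall>\<alpha>. blinfun_apply T' (ket \<alpha>) = sqrt (b \<alpha> / b (i # \<alpha>)) *\<^sub>R ket (i # \<alpha>))"
    with * show "T' = T"
      by (intro clinear_op_ket_eqI) auto
  qed
  then show "clinear_op (weighted_creation b i)"
    "blinfun_apply (weighted_creation b i) = left_shift (\<lambda>\<beta>. sqrt (b \<beta> / b (i # \<beta>))) i"
    using op T by (simp_all add: clinear_op_iff)
qed

lemma weighted_creation_ket:
  "blinfun_apply (weighted_creation b i) (ket \<beta>) = sqrt (b \<beta> / b (i # \<beta>)) *\<^sub>R ket (i # \<beta>)"
proof -
  obtain B where "\<And>\<beta>. \<bar>sqrt (b \<beta> / b (i # \<beta>))\<bar> \<le> B"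
    using creation_weight_bounded by blast
  then show ?thesis
    unfolding weighted_creation_eq by (rule left_shift_ket)
qed

abbreviation creation_word :: "'n list \<Rightarrow> 'n fock \<Rightarrow>\<^sub>L 'n fock"
  where "creation_word \<equiv> blinfun_word (weighted_creation b)"

lemma clinear_creation_word: "clinear_op (creation_word \<alpha>)"
  by (induction \<alpha>)
    (auto simp: clinear_op_compose clinear_weighted_creation, simp add: clinear_op_def)

lemma creation_word_ket:
  "blinfun_apply (creation_word \<alpha>) (ket \<beta>) = sqrt (b \<beta> / b (\<alpha> @ \<beta>)) *\<^sub>R ket (\<alpha> @ \<beta>)"
proof (induction \<alpha>)
  case Nil
  then show ?case using admissible_pos[of \<beta>] by simp
next
  case (Cons i \<alpha>)
  then show ?case
    using admissible_pos[of "\<alpha> @ \<beta>"]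
    by (simp add: blinfun.scaleR_right weighted_creation_ket real_sqrt_mult[symmetric])
qed

text \<open>The coordinates are read off as inner products with \<open>creation_word_ket\<close>.
  The test on \<open>take\<close> says that \<open>\<alpha>\<close> is a prefix of
  \<open>\<gamma>\<close>.\<close>

lemma adj_creation_word_ket:
  "blinfun_apply (adj_op (creation_word \<alpha>)) (ket \<gamma>) = (if take (length \<alpha>) \<gamma> = \<alpha>
    then sqrt (b (drop (length \<alpha>) \<gamma>) / b \<gamma>) *\<^sub>R ket (drop (length \<alpha>) \<gamma>) else 0)"
proof (rule ell2_eqI)
  fix \<beta>
  have "Rep_ell2 (blinfun_apply (adj_op (creation_word \<alpha>)) (ket \<gamma>)) \<beta> =
      sqrt (b \<beta> / b (\<alpha> @ \<beta>)) * (if \<gamma> = \<alpha> @ \<beta> then 1 else 0)"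
    unfolding Rep_ell2_eq_cinner_ket cinner_adj_op_left[OF clinear_creation_word] creation_word_ket
    by (simp add: scaleR_scaleC cinner_scaleC_right cinner_ket)
  moreover have "\<gamma> = \<alpha> @ \<beta> \<longleftrightarrow> take (length \<alpha>) \<gamma> = \<alpha> \<and> \<beta> = drop (length \<alpha>) \<gamma>"
    by (metis append_eq_conv_conj)
  ultimately show "Rep_ell2 (blinfun_apply (adj_op (creation_word \<alpha>)) (ket \<gamma>)) \<beta> =
      Rep_ell2 (if take (length \<alpha>) \<gamma> = \<alpha>
        then sqrt (b (drop (length \<alpha>) \<gamma>) / b \<gamma>) *\<^sub>R ket (drop (length \<alpha>) \<gamma>) else 0) \<beta>"
    by (auto simp: scaleR_ell2.rep_eq ket.rep_eq zero_ell2.rep_eq scaleR_conv_of_real)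
qed

lemma creation_word_adj_ket:
  "blinfun_apply (creation_word \<alpha>) (blinfun_apply (adj_op (creation_word \<alpha>)) (ket \<gamma>)) =
    (if take (length \<alpha>) \<gamma> = \<alpha> then (b (drop (length \<alpha>) \<gamma>) / b \<gamma>) *\<^sub>R ket \<gamma> else 0)"
proof (cases "take (length \<alpha>) \<gamma> = \<alpha>")
  case True
  then have "\<alpha> @ drop (length \<alpha>) \<gamma> = \<gamma>"
    by (metis append_take_drop_id)
  with True show ?thesis
    using admissible_pos less_imp_le[OF admissible_pos]
    by (simp add: adj_creation_word_ket blinfun.scaleR_right creation_word_ket)
qed (simp add: adj_creation_word_ket)

text \<open>Each term is diagonal: among the words of length \<open>p\<close> only the prefix of
  \<open>\<gamma>\<close> acts on \<open>ket \<gamma>\<close>, and there is none once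
  \<open>p\<close> exceeds the length of \<open>\<gamma>\<close>.\<close>

lemma creation_defect_term_ket:
  "blinfun_apply (creation_defect_term b p) (ket \<gamma>) =
    (if p \<le> length \<gamma> then (nc_inverse b (take p \<gamma>) * b (drop p \<gamma>) / b \<gamma>) *\<^sub>R ket \<gamma> else 0)"
proof -
  have "blinfun_apply (creation_defect_term b p) (ket \<gamma>) =
      (\<Sum>\<alpha> | length \<alpha> = p. if \<alpha> = take p \<gamma> then
        (nc_inverse b (take p \<gamma>) * b (drop p \<gamma>) / b \<gamma>) *\<^sub>R ket \<gamma> else 0)"
    unfolding creation_defect_term_def
    unfolding blinfun.sum_left blinfun.scaleR_left blinfun_apply_blinfun_compose creation_word_adj_ket
  proof (rule sum.cong[OF refl])
    fix \<alpha> :: "'n list" assume "\<alpha> \<in> {\<alpha>. length \<alpha> = p}"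
    then have p: "length \<alpha> = p" by simp
    show "nc_inverse b \<alpha> *\<^sub>R (if take (length \<alpha>) \<gamma> = \<alpha>
        then (b (drop (length \<alpha>) \<gamma>) / b \<gamma>) *\<^sub>R ket \<gamma> else 0) = (if \<alpha> = take p \<gamma> then
        (nc_inverse b (take p \<gamma>) * b (drop p \<gamma>) / b \<gamma>) *\<^sub>R ket \<gamma> else 0)"
      unfolding p by (cases "take p \<gamma> = \<alpha>") simp_all
  qed
  also have "\<dots> = (if p \<le> length \<gamma> then (nc_inverse b (take p \<gamma>) * b (drop p \<gamma>) / b \<gamma>) *\<^sub>R ket \<gamma> else 0)"
    by (auto simp: sum.delta finite_words)
  finally show ?thesis .
qed

section \<open>The vacuum projection and its relations with the creation operators\<close>

context
  assumes summ: "summable (creation_defect_term b)"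
begin

abbreviation creation_defect :: "'n fock \<Rightarrow>\<^sub>L 'n fock"
  where "creation_defect \<equiv> \<Sum>p. creation_defect_term b p"

lemma creation_defect_LIMSEQ: "(\<lambda>k. \<Sum>p\<le>k. creation_defect_term b p) \<longlonglongrightarrow> creation_defect"
  by (rule summable_LIMSEQ'[OF summ])

lemma clinear_creation_defect: "clinear_op creation_defect"
proof -
  note alg = unital_cstar_subalgebra_clinear
  have "creation_defect_term b p \<in> {A. clinear_op A}" for p
    unfolding creation_defect_term_def
    by (intro cstar_sum[OF alg] cstar_scaleR[OF alg])
      (simp add: clinear_op_compose clinear_adj_op clinear_creation_word)
  then have "(\<Sum>p\<le>k. creation_defect_term b p) \<in> {A. clinear_op A}" for k
    by (intro cstar_sum[OF alg])
  then have "creation_defect \<in> {A. clinear_op A}"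
    by (intro closed_sequentially[OF cstar_closed[OF alg] _ creation_defect_LIMSEQ]) auto
  then show ?thesis by simp
qed

text \<open>The terms beyond the length of \<open>\<gamma>\<close> vanish, and the others add up to
  the coefficient of g^{-1} g = 1 at \<open>\<gamma>\<close>, divided by \<open>b \<gamma>\<close>.
  So the limit is the projection onto the vacuum vector.\<close>

lemma creation_defect_ket:
  "blinfun_apply creation_defect (ket \<gamma>) = (if \<gamma> = [] then ket [] else 0)"
proof (rule LIMSEQ_unique)
  show "(\<lambda>k. blinfun_apply (\<Sum>p\<le>k. creation_defect_term b p) (ket \<gamma>))
      \<longlonglongrightarrow> blinfun_apply creation_defect (ket \<gamma>)"
    by (intro bounded_linear.tendsto[OF blinfun.bounded_linear_left] creation_defect_LIMSEQ)
  have "blinfun_apply (\<Sum>p\<le>k. creation_defect_term b p) (ket \<gamma>) = (if \<gamma> = [] then ket [] else 0)"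
    if "length \<gamma> \<le> k" for k
  proof -
    have "blinfun_apply (\<Sum>p\<le>k. creation_defect_term b p) (ket \<gamma>) =
        (\<Sum>p\<le>length \<gamma>. (nc_inverse b (take p \<gamma>) * b (drop p \<gamma>) / b \<gamma>) *\<^sub>R ket \<gamma>)"
      unfolding blinfun.sum_left creation_defect_term_ket
      by (rule sum.mono_neutral_cong_right) (use that in auto)
    also have "\<dots> = (nc_mult (nc_inverse b) b \<gamma> / b \<gamma>) *\<^sub>R ket \<gamma>"
      by (simp only: nc_mult_eq scaleR_sum_left sum_divide_distrib)
    finally show ?thesis
      by (simp add: nc_inverse(1)[of b] nc_one_def admissible_Nil)
  qed
  then show "(\<lambda>k. blinfun_apply (\<Sum>p\<le>k. creation_defect_term b p) (ket \<gamma>))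
      \<longlonglongrightarrow> (if \<gamma> = [] then ket [] else 0)"
    by (intro tendsto_eventually eventually_sequentiallyI[of "length \<gamma>"])
qed

lemma creation_defect_idem: "creation_defect o\<^sub>L creation_defect = creation_defect"
  by (rule clinear_op_ket_eqI)
    (simp_all add: clinear_op_compose clinear_creation_defect creation_defect_ket)

lemma adj_creation_defect: "adj_op creation_defect = creation_defect"
proof (rule clinear_op_ket_eqI)
  fix \<gamma>
  show "blinfun_apply (adj_op creation_defect) (ket \<gamma>) = blinfun_apply creation_defect (ket \<gamma>)"
    by (rule ell2_eqI)
      (auto simp: Rep_ell2_eq_cinner_ket cinner_adj_op_left clinear_creation_defect
        creation_defect_ket cinner_ket cinner.zero_left cinner.zero_right)
qed (simp_all add: clinear_adj_op clinear_creation_defect)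

lemma creation_defect_weighted_creation: "creation_defect o\<^sub>L weighted_creation b i = 0"
  by (rule clinear_op_ket_eqI)
    (simp_all add: clinear_op_compose clinear_creation_defect clinear_weighted_creation
      creation_defect_ket weighted_creation_ket blinfun.scaleR_right clinear_op_0)

text \<open>The weighted substitute for W_i^* W_i = I: removing the letter \<open>i\<close> costs a
  scalar once the result is compressed to the vacuum. Both sides vanish on all basis vectors except
  \<open>ket \<beta>\<close>, where the weights agree.\<close>

lemma creation_defect_adj_word:
  "creation_defect o\<^sub>L (adj_op (creation_word (i # \<beta>)) o\<^sub>L weighted_creation b i) =
    (b \<beta> / b (i # \<beta>)) *\<^sub>R (creation_defect o\<^sub>L adj_op (creation_word \<beta>))"
proof (rule clinear_op_ket_eqI)
  fix \<gamma>
  have "drop (length \<beta>) \<gamma> = [] \<and> take (length \<beta>) \<gamma> = \<beta> \<longleftrightarrow> \<gamma> = \<beta>"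
    by auto
  moreover have "sqrt (b \<beta> / b (i # \<beta>)) * sqrt (1 / b (i # \<beta>)) = (b \<beta> / b (i # \<beta>)) * sqrt (1 / b \<beta>)"
    using admissible_pos[of \<beta>] admissible_pos[of "i # \<beta>"]
    by (simp add: real_sqrt_divide field_simps)
  ultimately show "blinfun_apply (creation_defect o\<^sub>L (adj_op (creation_word (i # \<beta>)) o\<^sub>L weighted_creation b i)) (ket \<gamma>) =
      blinfun_apply ((b \<beta> / b (i # \<beta>)) *\<^sub>R (creation_defect o\<^sub>L adj_op (creation_word \<beta>))) (ket \<gamma>)"
    unfolding blinfun_apply_blinfun_compose weighted_creation_ket blinfun.scaleR_right
      blinfun.scaleR_left adj_creation_word_ket
    by (cases "\<gamma> = \<beta>")
      (auto simp: blinfun.scaleR_right creation_defect_ket admissible_Nil)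
next
  show "clinear_op (creation_defect o\<^sub>L (adj_op (creation_word (i # \<beta>)) o\<^sub>L weighted_creation b i))"
    by (intro clinear_op_compose clinear_adj_op clinear_creation_defect clinear_creation_word
        clinear_weighted_creation)
  show "clinear_op ((b \<beta> / b (i # \<beta>)) *\<^sub>R (creation_defect o\<^sub>L adj_op (creation_word \<beta>)))"
    by (intro clinear_op_scaleR clinear_op_compose clinear_adj_op clinear_creation_defect
        clinear_creation_word)
qed

lemma adj_creation_word_word:
  assumes "length \<alpha> = length \<beta>" "\<alpha> \<noteq> \<beta>"
  shows "adj_op (creation_word \<alpha>) o\<^sub>L creation_word \<beta> = 0"
  by (rule clinear_op_ket_eqI)
    (use assms in \<open>auto simp: clinear_op_compose clinear_adj_op clinear_creation_word creation_word_ket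
      adj_creation_word_ket blinfun.scaleR_right clinear_op_0\<close>)

end

end

text \<open>
  The relations between the operators \<open>V\<^sub>i = \<pi>(W\<^sub>i)\<close> and \<open>P = \<pi>(\<Delta>(W, W\<^sup>*))\<close> which
  suffice for the Wold decomposition.
\<close>

locale wold_model =
  fixes b :: "'n::finite list \<Rightarrow> real" and V :: "'n \<Rightarrow> 'k::chilbert_space \<Rightarrow> 'k" and P :: "'k \<Rightarrow> 'k"
  assumes b_Nil: "b [] = 1" and b_pos: "0 < b \<alpha>"
    and bounded_V: "bounded_op UNIV UNIV (V i)" and bounded_P: "bounded_op UNIV UNIV P"
    and P_idem: "P (P x) = P x" and cinner_P: "cinner (P x) y = cinner x (P y)"
    and defect_LIMSEQ: "(\<lambda>k. defect_partial_sum b UNIV V k x) \<longlonglongrightarrow> P x"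
    and P_V: "P (V i x) = 0"
    and P_adj_Cons: "P (adj_on UNIV (op_word V (i # \<beta>)) (V i x)) =
      (b \<beta> / b (i # \<beta>)) *\<^sub>R P (adj_on UNIV (op_word V \<beta>) x)"
    and adj_word_word: "length \<alpha> = length \<beta> \<Longrightarrow> \<alpha> \<noteq> \<beta> \<Longrightarrow>
      adj_on UNIV (op_word V \<alpha>) (op_word V \<beta> x) = 0"

text \<open>Each algebraic relation is an identity between elements of the generated algebra, so
  \<open>\<pi>\<close> transports it; membership of every factor has to be recorded because
  \<open>\<pi>\<close> is multiplicative only there. The convergence clause comes from
  \<open>rep_tendsto\<close>.\<close>

lemma wold_model_representation:
  fixes b :: "'n::finite list \<Rightarrow> real"
    and \<pi> :: "('n fock \<Rightarrow>\<^sub>L 'n fock) \<Rightarrow> ('k::chilbert_space \<Rightarrow>\<^sub>L 'k)"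
  assumes adm: "admissible b" and summ: "summable (creation_defect_term b)"
    and \<pi>: "unital_star_representation (cstar_generated (range (weighted_creation b))) \<pi>"
  shows "wold_model b (\<lambda>i. blinfun_apply (\<pi> (weighted_creation b i)))
    (blinfun_apply (\<pi> (\<Sum>p. creation_defect_term b p)))"
proof -
  let ?W = "weighted_creation b" and ?Wa = "blinfun_word (weighted_creation b)"
  let ?D = "\<Sum>p. creation_defect_term b p"
  let ?V = "\<lambda>i. blinfun_apply (\<pi> (?W i))"
  define \<A> where "\<A> = cstar_generated (range ?W)"
  note \<pi> = \<pi>[folded \<A>_def]
  have \<A>: "unital_cstar_subalgebra \<A>"
    unfolding \<A>_def
    by (rule unital_cstar_subalgebra_cstar_generated) (auto simp: clinear_weighted_creation[OF adm])
  have W: "?W i \<in> \<A>" for i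
    by (simp add: \<A>_def cstar_generated_base)
  have Wa: "?Wa \<alpha> \<in> \<A>" for \<alpha>
    by (induction \<alpha>) (auto intro: cstar_id[OF \<A>] cstar_compose[OF \<A>] W)
  have Wa': "adj_op (?Wa \<alpha>) \<in> \<A>" for \<alpha>
    by (rule cstar_adj[OF \<A> Wa])
  have word: "op_word ?V \<alpha> = blinfun_apply (\<pi> (?Wa \<alpha>))" for \<alpha>
    by (induction \<alpha>) (auto simp: rep_id[OF \<pi>] rep_compose[OF \<pi> W Wa] fun_eq_iff)
  have adj_word: "adj_on UNIV (op_word ?V \<alpha>) = blinfun_apply (\<pi> (adj_op (?Wa \<alpha>)))" for \<alpha>
    by (simp add: word rep_adj[OF \<pi> Wa] adj_op_apply rep_clinear[OF \<pi> Wa])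
  have WW: "?Wa \<alpha> o\<^sub>L adj_op (?Wa \<alpha>) \<in> \<A>" for \<alpha>
    by (rule cstar_compose[OF \<A> Wa Wa'])
  have T: "creation_defect_term b p \<in> \<A>" for p
    unfolding creation_defect_term_def by (intro cstar_sum[OF \<A>] cstar_scaleR[OF \<A>] WW)
  have S: "(\<Sum>p\<le>k. creation_defect_term b p) \<in> \<A>" for k
    by (intro cstar_sum[OF \<A>] T)
  note lim = rep_tendsto[OF \<A> \<pi> S creation_defect_LIMSEQ[OF adm summ] sequentially_bot]
  note D = lim(1)
  have z: "\<pi> 0 = 0"
    using rep_scaleR[OF \<pi> cstar_id[OF \<A>], of 0] by simp
  have ps: "defect_partial_sum b UNIV ?V k x = blinfun_apply (\<pi> (\<Sum>p\<le>k. creation_defect_term b p)) x" for k x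
  proof -
    have defect_term: "\<pi> (creation_defect_term b p) =
        (\<Sum>\<alpha> | length \<alpha> = p. nc_inverse b \<alpha> *\<^sub>R (\<pi> (?Wa \<alpha>) o\<^sub>L \<pi> (adj_op (?Wa \<alpha>))))" for p
      unfolding creation_defect_term_def
      by (simp add: rep_sum[OF \<A> \<pi>] cstar_scaleR[OF \<A> WW] rep_scaleR[OF \<pi> WW] rep_compose[OF \<pi> Wa Wa'])
    have "\<pi> (\<Sum>p\<le>k. creation_defect_term b p) = (\<Sum>p\<le>k. \<pi> (creation_defect_term b p))"
      by (rule rep_sum[OF \<A> \<pi>]) (rule T)
    then show ?thesis
      unfolding defect_partial_sum_def adj_word unfolding word
      by (simp add: defect_term blinfun.sum_left blinfun.scaleR_left)
  qed
  show ?thesis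
  proof
    show "b [] = 1" "\<And>\<alpha>. 0 < b \<alpha>"
      using adm by (auto simp: admissible_def)
    show "bounded_op UNIV UNIV (?V i)" for i
      using rep_clinear[OF \<pi> W] by (simp add: clinear_op_iff)
    show "bounded_op UNIV UNIV (blinfun_apply (\<pi> ?D))"
      using rep_clinear[OF \<pi> D] by (simp add: clinear_op_iff)
    show "blinfun_apply (\<pi> ?D) (blinfun_apply (\<pi> ?D) x) = blinfun_apply (\<pi> ?D) x" for x
      using rep_compose[OF \<pi> D D] creation_defect_idem[OF adm summ]
      by (metis blinfun_apply_blinfun_compose)
    show "cinner (blinfun_apply (\<pi> ?D) x) y = cinner x (blinfun_apply (\<pi> ?D) y)" for x y
      using cinner_adj_op[OF rep_clinear[OF \<pi> D]] rep_adj[OF \<pi> D] adj_creation_defect[OF adm summ]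
      by simp
    show "(\<lambda>k. defect_partial_sum b UNIV ?V k x) \<longlonglongrightarrow> blinfun_apply (\<pi> ?D) x" for x
      unfolding ps by (intro bounded_linear.tendsto[OF blinfun.bounded_linear_left] lim(2))
    show "blinfun_apply (\<pi> ?D) (?V i x) = 0" for i x
      using rep_compose[OF \<pi> D W] creation_defect_weighted_creation[OF adm summ] z
      by (metis blinfun_apply_blinfun_compose blinfun.zero_left)
    show "blinfun_apply (\<pi> ?D) (adj_on UNIV (op_word ?V (i # \<beta>)) (?V i x)) =
        (b \<beta> / b (i # \<beta>)) *\<^sub>R blinfun_apply (\<pi> ?D) (adj_on UNIV (op_word ?V \<beta>) x)" for i \<beta> x
    proof -
      have "\<pi> ?D o\<^sub>L (\<pi> (adj_op (?Wa (i # \<beta>))) o\<^sub>L \<pi> (?W i)) =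
          (b \<beta> / b (i # \<beta>)) *\<^sub>R (\<pi> ?D o\<^sub>L \<pi> (adj_op (?Wa \<beta>)))"
        unfolding rep_compose[OF \<pi> Wa' W, symmetric] rep_compose[OF \<pi> D Wa', symmetric]
          rep_compose[OF \<pi> D cstar_compose[OF \<A> Wa' W], symmetric]
          rep_scaleR[OF \<pi> cstar_compose[OF \<A> D Wa'], symmetric]
        by (rule arg_cong[OF creation_defect_adj_word[OF adm summ]])
      from arg_cong[OF this, of "\<lambda>A. blinfun_apply A x"] show ?thesis
        unfolding adj_word by (simp only: blinfun_apply_blinfun_compose blinfun.scaleR_left)
    qed
    show "adj_on UNIV (op_word ?V \<alpha>) (op_word ?V \<beta> x) = 0"
      if "length \<alpha> = length \<beta>" "\<alpha> \<noteq> \<beta>" for \<alpha> \<beta> x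
      unfolding word adj_word[unfolded word]
      using rep_compose[OF \<pi> Wa' Wa, of \<alpha> \<beta>] adj_creation_word_word[OF adm summ that] z
      by (metis blinfun_apply_blinfun_compose blinfun.zero_left)
  qed
qed

section \<open>Projections and closed subspaces\<close>

lemma closed_csubspace_vimage:
  assumes "bounded_op UNIV UNIV A" "closed_csubspace S"
  shows "closed_csubspace {x. A x \<in> S}"
proof -
  have A: "bounded_linear A" "\<And>c x. A (c *\<^sub>C x) = c *\<^sub>C A x"
    using assms(1) by (auto simp: bounded_op_UNIV_iff)
  have S: "closed S" "csubspace S"
    using assms(2) by (auto simp: closed_csubspace_def)
  have "closed {x. A x \<in> S}"
    by (intro closed_vimage[OF S(1), unfolded vimage_def] linear_continuous_on A)
  moreover have "csubspace {x. A x \<in> S}"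
    by (rule complex_vector.subspaceI)
      (auto simp: linear_simps[OF A(1)] A(2) complex_vector.subspace_0[OF S(2)]
        complex_vector.subspace_add[OF S(2)] complex_vector.subspace_scale[OF S(2)])
  ultimately show ?thesis
    by (simp add: closed_csubspace_def)
qed

lemma closed_csubspace_zero: "closed_csubspace {0}"
  by (simp add: closed_csubspace_def)

lemma closed_csubspace_orthogonal: "closed_csubspace {x. cinner x y = 0}"
proof -
  have "closed {x. cinner x y = 0}"
    by (intro closed_Collect_eq linear_continuous_on cinner.bounded_linear_left continuous_on_const)
  then show ?thesis
    unfolding closed_csubspace_def
    by (auto intro!: complex_vector.subspaceI
        simp: cinner.zero_left cinner.add_left cinner_scaleC_left)
qed

text \<open>Orthogonality to one fixed vector is a closed linear condition, so it passes from the
  generators to the closed span, one side at a time.\<close>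

lemma closure_cspan_orthogonal:
  assumes "\<And>x y. x \<in> A \<Longrightarrow> y \<in> B \<Longrightarrow> cinner x y = 0"
    and "x \<in> closure (cspan A)" "y \<in> closure (cspan B)"
  shows "cinner x y = 0"
proof -
  have *: "cinner x y = 0" if "y \<in> B" "x \<in> closure (cspan A)" for x y
    using closure_cspan_least[OF _ closed_csubspace_orthogonal[of y], of A] assms(1) that by blast
  have "B \<subseteq> {y. cinner y x = 0}"
    using *[OF _ assms(2)] by (auto simp: cinner_eq_0_commute[of _ x])
  then have "cinner y x = 0"
    using closure_cspan_least[OF _ closed_csubspace_orthogonal[of x], of B] assms(3) by blast
  then show ?thesis
    by (simp add: cinner_eq_0_commute)
qed

lemma orth_complement_closure_cspan:
  "orth_complement (closure (cspan A)) = {x. \<forall>y\<in>A. cinner x y = 0}"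
proof (intro set_eqI iffI)
  fix x assume "x \<in> orth_complement (closure (cspan A))"
  then show "x \<in> {x. \<forall>y\<in>A. cinner x y = 0}"
    using closure_subset complex_vector.span_superset[of A] by (fastforce simp: orth_complement_def)
next
  fix x assume x: "x \<in> {x. \<forall>y\<in>A. cinner x y = 0}"
  have "x \<in> closure (cspan {x})"
    using closure_subset complex_vector.span_superset[of "{x}"] by blast
  then show "x \<in> orth_complement (closure (cspan A))"
    unfolding orth_complement_def using x closure_cspan_orthogonal[of "{x}" A x] by blast
qed

lemma csubspace_range:
  assumes A: "bounded_op UNIV UNIV A"
  shows "csubspace (range A)"
proof (rule complex_vector.subspaceI)
  show "0 \<in> range A"
    using A by (intro range_eqI[of _ _ 0]) (simp add: bounded_op_UNIV_iff linear_simps)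
  show "x + y \<in> range A" if "x \<in> range A" "y \<in> range A" for x y
    using that bounded_op_add[OF A, symmetric] by auto
  show "c *\<^sub>C x \<in> range A" if "x \<in> range A" for c x
    using that bounded_op_scaleC[OF A, symmetric] by auto
qed

lemma range_idempotent: "(\<And>x. E (E x) = E x) \<Longrightarrow> range E = {x. E x = x}"
  by (auto intro: range_eqI[OF sym])

lemma closed_csubspace_range_idempotent:
  assumes E: "bounded_op UNIV UNIV E" and idem: "\<And>x. E (E x) = E x"
  shows "closed_csubspace (range E)"
proof -
  have "bounded_linear E"
    using E by (simp add: bounded_op_UNIV_iff)
  then have "closed {x. E x = x}"
    by (intro closed_Collect_eq linear_continuous_on continuous_on_id)
  then show ?thesis
    by (simp add: closed_csubspace_def csubspace_range[OF E] range_idempotent[OF idem, symmetric])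
qed

lemma csubspace_scaleR: "csubspace S \<Longrightarrow> x \<in> S \<Longrightarrow> r *\<^sub>R x \<in> S"
  by (simp add: scaleR_scaleC complex_vector.subspace_scale)

lemma cinner_self_nonneg: "cinner x x \<in> \<real>\<^sub>\<ge>\<^sub>0"
  by (simp add: cinner_self)

text \<open>\<open>sqrt_op\<close> picks some nonnegative root, so uniqueness is required. For a
  projection it follows without spectral theory, by showing that a root \<open>R\<close> vanishes on
  the kernel of \<open>P\<close> and is the identity on its range.\<close>

lemma sqrt_op_projection:
  assumes "orthogonal_projection P"
  shows "sqrt_op UNIV P = P"
  unfolding sqrt_op_def
proof (rule some_equality)
  have P: "bounded_op UNIV UNIV P" "\<And>x. P (P x) = P x" "\<And>x y. cinner (P x) y = cinner x (P y)"
    using assms by (auto simp: orthogonal_projection_def)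
  have "cinner (P x) x = cinner (P x) (P x)" for x
    by (metis P(2,3))
  then show "bounded_op UNIV UNIV P \<and> op_nonneg UNIV P \<and> (\<forall>x\<in>UNIV. P (P x) = P x)"
    using P(1,2) by (simp add: op_nonneg_def cinner_self_nonneg)
  fix R assume R: "bounded_op UNIV UNIV R \<and> op_nonneg UNIV R \<and> (\<forall>x\<in>UNIV. R (R x) = P x)"
  then have lin: "bounded_linear R" and RR: "\<And>x. R (R x) = P x"
    by (auto simp: bounded_op_UNIV_iff)
  have pos: "0 \<le> Re (cinner (R x) x)" for x
    using R by (auto simp: op_nonneg_def complex_nonneg_Reals_iff)
  have plin: "bounded_linear P"
    using P(1) by (simp add: bounded_op_UNIV_iff)
  have ker: "R y = 0" if "P y = 0" for y
  proof (rule ccontr)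
    assume "R y \<noteq> 0"
    define z where "z = R y"
    \<comment> \<open>Since \<open>R z = 0\<close>, moving \<open>y\<close> along \<open>z\<close>
      does not change its image under \<open>R\<close>. This \<open>t\<close> makes the quadratic
      form of \<open>R\<close> equal to -1, against positivity.\<close>
    define t where "t = - (1 + Re (cinner z y)) / (norm z)\<^sup>2"
    have "R z = 0"
      using RR[of y] that by (simp add: z_def)
    then have "R (y + t *\<^sub>R z) = z"
      by (simp add: linear_simps[OF lin] z_def)
    then have "0 \<le> Re (cinner z (y + t *\<^sub>R z))"
      using pos[of "y + t *\<^sub>R z"] by simp
    also have "\<dots> = Re (cinner z y) + t * (norm z)\<^sup>2"
      by (simp add: cinner.add_right cinner.scaleR_right cinner_self)
    also have "\<dots> = - 1"
      using \<open>R y \<noteq> 0\<close> by (simp add: t_def z_def)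
    finally show False by simp
  qed
  have ran: "R x = x" if "P x = x" for x
  proof -
    \<comment> \<open>R squares to the identity on the range of \<open>P\<close>, so this
      \<open>y\<close> satisfies R y = - y, which positivity allows only for y = 0.\<close>
    define y where "y = R x - x"
    have "R y = - y"
      using RR[of x] that by (simp add: y_def linear_simps[OF lin])
    then have "0 \<le> - (norm y)\<^sup>2"
      using pos[of y] by (simp add: cinner.minus_left cinner_self)
    then show ?thesis
      by (simp add: y_def)
  qed
  show "R = P"
  proof
    fix x
    have "R x = R (P x) + R (x - P x)"
      by (simp add: linear_simps[OF lin])
    also have "R (P x) = P x"
      by (rule ran) (rule P(2))
    also have "R (x - P x) = 0"
      by (rule ker) (simp add: linear_simps[OF plin] P(2))
    finally show "R x = P x" by simp
  qed
qed

section \<open>The tensor product with the identity\<close>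

text \<open>\<open>tensor_id\<close> is a choice, but two bounded operators that agree on elementary
  tensors agree on all of \<open>fock_tensor M\<close>, whose elements are sums of such
  tensors.\<close>

lemma tensor_id_eq_left_shift:
  assumes c: "\<And>\<beta>. \<bar>c \<beta>\<bar> \<le> B" and T: "blinfun_apply T = left_shift c i"
    and M: "closed_csubspace M" and y: "y \<in> fock_tensor M"
  shows "tensor_id T M y = left_shift c i y"
proof -
  let ?good = "\<lambda>R. bounded_op (fock_tensor M) (fock_tensor M) R \<and>
    (\<forall>f. \<forall>d\<in>M. R (f \<otimes>\<^sub>h d) = blinfun_apply T f \<otimes>\<^sub>h d)"
  have sub: "csubspace M" using M by (simp add: closed_csubspace_def)
  have "left_shift c i z \<in> fock_tensor M" if "z \<in> fock_tensor M" for z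
    using that unfolding fock_tensor_eq[OF M]
    by (auto simp: Rep_left_shift[OF c] complex_vector.subspace_0[OF sub] csubspace_scaleR[OF sub]
        split: list.splits)
  then have good: "?good (left_shift c i)"
    using bounded_op_mono[OF bounded_op_left_shift[where c = c and i = i, OF c] subset_UNIV]
    by (auto simp: T left_shift_tensor[OF c])
  have "tensor_id T M = (SOME R. ?good R)"
    by (simp add: tensor_id_def)
  then have R: "?good (tensor_id T M)"
    using someI[of ?good, OF good] by simp
  have coord: "ket \<alpha> \<otimes>\<^sub>h Rep_ell2 y \<alpha> \<in> fock_tensor M" "Rep_ell2 y \<alpha> \<in> M" for \<alpha>
    using y unfolding fock_tensor_eq[OF M]
    by (auto simp: Rep_ket_tensor complex_vector.subspace_0[OF sub])
  have "((\<lambda>\<alpha>. tensor_id T M (ket \<alpha> \<otimes>\<^sub>h Rep_ell2 y \<alpha>)) has_sum tensor_id T M y) UNIV"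
    by (rule bounded_op_has_sum[OF conjunct1[OF R] closed_csubspace_fock_tensor ket_tensor_has_sum coord(1)])
  moreover have "((\<lambda>\<alpha>. left_shift c i (ket \<alpha> \<otimes>\<^sub>h Rep_ell2 y \<alpha>)) has_sum left_shift c i y) UNIV"
    by (rule bounded_op_has_sum[OF conjunct1[OF good] closed_csubspace_fock_tensor ket_tensor_has_sum coord(1)])
  moreover have "tensor_id T M (ket \<alpha> \<otimes>\<^sub>h Rep_ell2 y \<alpha>) = left_shift c i (ket \<alpha> \<otimes>\<^sub>h Rep_ell2 y \<alpha>)" for \<alpha>
    using R good coord(2)[of \<alpha>] by simp
  ultimately show ?thesis
    by (simp add: has_sum_unique)
qed

section \<open>The Wold decomposition\<close>

context wold_model
begin

section \<open>Words in the V_i, their adjoints and the defect projection\<close>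

abbreviation word_adj :: "'n list \<Rightarrow> 'k \<Rightarrow> 'k"
  where "word_adj \<alpha> \<equiv> adj_on UNIV (op_word V \<alpha>)"

lemma bounded_word: "bounded_op UNIV UNIV (op_word V \<alpha>)"
proof (induction \<alpha>)
  case Nil
  then show ?case
    by (auto simp: bounded_op_UNIV_iff id_def)
next
  case (Cons i \<alpha>)
  then show ?case
    using bounded_op_compose[OF bounded_V Cons] by (simp add: o_def)
qed

lemmas bounded_word_adj = bounded_op_adj[OF bounded_word]
lemmas cinner_word = cinner_adj[OF bounded_word]

lemmas P_linear = linear_simps[OF conjunct1[OF bounded_P[unfolded bounded_op_UNIV_iff]]]
lemmas V_linear = linear_simps[OF conjunct1[OF bounded_V[unfolded bounded_op_UNIV_iff]]]
lemmas word_linear = linear_simps[OF conjunct1[OF bounded_word[unfolded bounded_op_UNIV_iff]]]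
lemmas word_adj_linear = linear_simps[OF conjunct1[OF bounded_word_adj[unfolded bounded_op_UNIV_iff]]]

lemma adj_on_id [simp]: "adj_on UNIV id = (id :: 'k \<Rightarrow> 'k)" "adj_on UNIV (\<lambda>x :: 'k. x) = id"
  by (rule adj_unique; simp)+

lemma word_adj_Nil: "word_adj [] = id"
  by simp

lemma word_append: "op_word V (\<alpha> @ \<beta>) x = op_word V \<alpha> (op_word V \<beta> x)"
  by (induction \<alpha>) auto

lemma word_adj_append: "word_adj (\<alpha> @ \<beta>) x = word_adj \<beta> (word_adj \<alpha> x)"
proof -
  have "word_adj (\<alpha> @ \<beta>) = (\<lambda>x. word_adj \<beta> (word_adj \<alpha> x))"
    by (rule adj_unique) (simp add: word_append cinner_word)
  then show ?thesis by simp
qed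

lemma word_adj_Cons: "word_adj (i # \<alpha>) x = word_adj \<alpha> (word_adj [i] x)"
  using word_adj_append[of "[i]"] by simp

lemma P_word_Cons: "P (op_word V (i # \<alpha>) x) = 0"
  by (simp add: P_V)

text \<open>The adjoint form of P V_\<alpha> P = 0, which holds because P V_i = 0.\<close>

lemma P_word_adj_P: "\<alpha> \<noteq> [] \<Longrightarrow> P (word_adj \<alpha> (P x)) = 0"
  by (rule cinner_eqI)
    (cases \<alpha>; simp del: op_word.simps add: cinner_P[symmetric] cinner_word[symmetric] P_word_Cons
      cinner.zero_left cinner.zero_right)

text \<open>Letters are cancelled one at a time by \<open>P_adj_Cons\<close>, and the quotients of
  weights telescope.\<close>

lemma P_adj_word_append:
  "P (word_adj (\<beta> @ \<gamma>) (op_word V \<beta> x)) = (b \<gamma> / b (\<beta> @ \<gamma>)) *\<^sub>R P (word_adj \<gamma> x)"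
proof (induction \<beta>)
  case Nil
  then show ?case using b_pos[of \<gamma>] by simp
next
  case (Cons i \<beta>)
  have "op_word V (i # \<beta>) x = V i (op_word V \<beta> x)"
    by simp
  then show ?case
    unfolding append_Cons using b_pos[of "\<beta> @ \<gamma>"]
    by (simp only: P_adj_Cons Cons.IH) simp
qed

text \<open>Common first letters cancel by \<open>P_adj_Cons\<close>. Then either two different
  letters meet, and V_j^* V_i = 0, or \<open>\<alpha>\<close> is exhausted first, and P V_i = 0
  applies.\<close>

lemma P_adj_word_not_prefix:
  "\<nexists>\<gamma>. \<alpha> = \<beta> @ \<gamma> \<Longrightarrow> P (word_adj \<alpha> (op_word V \<beta> x)) = 0"
proof (induction \<beta> arbitrary: \<alpha>)
  case (Cons i \<beta>)
  show ?case
  proof (cases \<alpha>)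
    case Nil
    then show ?thesis by (simp add: P_V)
  next
    case (Cons j \<alpha>')
    show ?thesis
    proof (cases "i = j")
      case True
      with Cons have "\<nexists>\<gamma>. \<alpha>' = \<beta> @ \<gamma>"
        using Cons.prems by auto
      then have "P (word_adj \<alpha>' (op_word V \<beta> x)) = 0"
        by (rule Cons.IH)
      moreover have "op_word V (j # \<beta>) x = V j (op_word V \<beta> x)"
        by simp
      ultimately show ?thesis
        unfolding Cons True by (simp only: P_adj_Cons) simp
    next
      case False
      then have "word_adj [j] (op_word V [i] (op_word V \<beta> x)) = 0"
        by (intro adj_word_word) auto
      then have "word_adj \<alpha> (op_word V (i # \<beta>) x) = 0"
        using word_adj_Cons[of j \<alpha>' "op_word V (i # \<beta>) x"] Cons by (simp add: word_adj_linear)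
      then show ?thesis
        by (simp add: P_linear)
    qed
  qed
qed simp

section \<open>The cells: images of the rank-one projections of the Fock space\<close>

text \<open>The image under \<open>\<pi>\<close> of the projection onto the span of \<open>e\<^sub>\<alpha>\<close>.\<close>

definition cell :: "'n list \<Rightarrow> 'k \<Rightarrow> 'k"
  where "cell \<alpha> x = b \<alpha> *\<^sub>R op_word V \<alpha> (P (word_adj \<alpha> x))"

text \<open>If \<open>\<alpha>\<close> does not extend \<open>\<beta>\<close>, the prefix lemma
  gives 0. If \<alpha> = \<beta>\<gamma> with \<gamma> nonempty, P V_\<gamma>^* P = 0 does. If
  \<alpha> = \<beta>, the factor \<open>b \<beta>\<close> in \<open>cell\<close> cancels the 1 / b
  \<beta> left by the weights.\<close>

lemma P_adj_cell: "P (word_adj \<alpha> (cell \<beta> x)) = (if \<alpha> = \<beta> then P (word_adj \<alpha> x) else 0)"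
proof -
  have e: "P (word_adj \<alpha> (cell \<beta> x)) = b \<beta> *\<^sub>R P (word_adj \<alpha> (op_word V \<beta> (P (word_adj \<beta> x))))"
    by (simp add: cell_def word_adj_linear P_linear)
  show ?thesis
  proof (cases "\<exists>\<gamma>. \<alpha> = \<beta> @ \<gamma>")
    case True
    then obtain \<gamma> where \<gamma>: "\<alpha> = \<beta> @ \<gamma>" by blast
    show ?thesis
    proof (cases "\<gamma> = []")
      case True
      then have "\<alpha> = \<beta>" using \<gamma> by simp
      then show ?thesis
        unfolding e using P_adj_word_append[of \<beta> "[]" "P (word_adj \<beta> x)"] b_pos[of \<beta>]
        by (simp add: P_idem b_Nil)
    next
      case False
      then show ?thesis
        unfolding e unfolding \<gamma> P_adj_word_append P_word_adj_P[OF False] by simp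
    qed
  next
    case False
    then have "\<alpha> \<noteq> \<beta>" by auto
    then show ?thesis
      unfolding e P_adj_word_not_prefix[OF False] by simp
  qed
qed

lemma bounded_cell: "bounded_op UNIV UNIV (cell \<alpha>)"
proof -
  have "bounded_op UNIV UNIV (\<lambda>x. op_word V \<alpha> (P (word_adj \<alpha> x)))"
    by (rule bounded_op_compose[OF bounded_word bounded_op_compose[OF bounded_P bounded_word_adj]])
  then show ?thesis
    unfolding cell_def[abs_def] bounded_op_UNIV_iff
    using bounded_linear_compose[OF bounded_linear_scaleR_right[of "b \<alpha>"]]
    by auto (simp add: scaleR_scaleC scaleC_scaleC mult.commute)
qed

lemma cinner_cell: "cinner (cell \<alpha> x) y = b \<alpha> * cinner (P (word_adj \<alpha> x)) (P (word_adj \<alpha> y))"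
proof -
  have "cinner (cell \<alpha> x) y = b \<alpha> * cinner (P (word_adj \<alpha> x)) (word_adj \<alpha> y)"
    by (simp add: cell_def cinner.scaleR_left cinner_word scaleR_conv_of_real)
  also have "cinner (P (word_adj \<alpha> x)) (word_adj \<alpha> y) = cinner (P (word_adj \<alpha> x)) (P (word_adj \<alpha> y))"
    by (metis P_idem cinner_P)
  finally show ?thesis .
qed

lemma cinner_cell_right: "cinner x (cell \<alpha> y) = cinner (cell \<alpha> x) y"
  by (subst cinner_commute, unfold cinner_cell) (simp add: cinner_commute[of "P _" "P _", symmetric])

lemma cell_cell: "cell \<alpha> (cell \<beta> x) = (if \<alpha> = \<beta> then cell \<alpha> x else 0)"
  unfolding cell_def[of \<alpha>] P_adj_cell by (simp add: word_linear)

text \<open>Bessel's inequality for the pairwise orthogonal projections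
  \<open>cell \<alpha>\<close>: the sum \<open>s\<close> of the cells of \<open>h\<close> satisfies
  \<open>inner s s = inner s h\<close>, and \<parallel>h - s\<parallel>^2 is nonnegative. It makes
  the coordinates of the Berezin kernel square-summable.\<close>

lemma cell_bessel:
  assumes "finite F"
  shows "(\<Sum>\<alpha>\<in>F. (norm (sqrt (b \<alpha>) *\<^sub>R P (word_adj \<alpha> h)))\<^sup>2) \<le> (norm h)\<^sup>2"
proof -
  define s where "s = (\<Sum>\<alpha>\<in>F. cell \<alpha> h)"
  have n: "(norm (sqrt (b \<alpha>) *\<^sub>R P (word_adj \<alpha> h)))\<^sup>2 = inner (cell \<alpha> h) h" for \<alpha>
    using b_pos[of \<alpha>]
    by (simp add: Re_cinner[symmetric] cinner_cell cinner_self power_mult_distrib)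
  have sh: "inner s h = (\<Sum>\<alpha>\<in>F. inner (cell \<alpha> h) h)"
    by (simp add: s_def inner_sum_left)
  have "inner (cell \<alpha> h) (cell \<beta> h) = (if \<alpha> = \<beta> then inner (cell \<alpha> h) h else 0)" for \<alpha> \<beta>
    unfolding Re_cinner[symmetric] cinner_cell_right cell_cell
    by (auto simp: cell_cell cinner.zero_left)
  then have "inner s s = inner s h"
    unfolding sh by (simp add: s_def inner_sum_left inner_sum_right sum.delta assms)
  then have "(norm (h - s))\<^sup>2 = (norm h)\<^sup>2 - inner s h"
    by (simp add: power2_norm_eq_inner inner_diff inner_commute)
  then show ?thesis
    unfolding n sh[symmetric] using zero_le_power2[of "norm (h - s)"] by linarith
qed

section \<open>The Berezin kernel in coordinates\<close>

definition kernel :: "'k \<Rightarrow> ('n list, 'k) ell2"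
  where "kernel h = Abs_ell2 (\<lambda>\<alpha>. sqrt (b \<alpha>) *\<^sub>R P (word_adj \<alpha> h))"

lemma Rep_kernel: "Rep_ell2 (kernel h) \<alpha> = sqrt (b \<alpha>) *\<^sub>R P (word_adj \<alpha> h)"
proof -
  have "(\<lambda>\<alpha>. (norm (sqrt (b \<alpha>) *\<^sub>R P (word_adj \<alpha> h)))\<^sup>2) summable_on UNIV"
  proof (rule nonneg_bdd_above_summable_on)
    show "bdd_above (sum (\<lambda>\<alpha>. (norm (sqrt (b \<alpha>) *\<^sub>R P (word_adj \<alpha> h)))\<^sup>2) ` {F. F \<subseteq> UNIV \<and> finite F})"
      by (rule bdd_aboveI2[where M = "(norm h)\<^sup>2"]) (use cell_bessel in blast)
  qed (rule zero_le_power2)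
  then show ?thesis
    unfolding kernel_def by (subst Abs_ell2_inverse) auto
qed

lemma bounded_kernel: "bounded_op UNIV UNIV kernel"
proof -
  have "norm (kernel h) \<le> norm h" for h
  proof (rule power2_le_imp_le)
    show "(norm (kernel h))\<^sup>2 \<le> (norm h)\<^sup>2"
      unfolding norm_ell2_sq
      by (rule infsum_le_finite_sums[OF ell2_summable]) (use cell_bessel[of _ h] in \<open>simp add: Rep_kernel\<close>)
  qed simp
  moreover have "kernel (x + y) = kernel x + kernel y" for x y
    by (rule ell2_eqI)
      (simp add: Rep_kernel plus_ell2.rep_eq word_adj_linear P_linear scaleR_right_distrib)
  moreover have "kernel (c *\<^sub>C x) = c *\<^sub>C kernel x" for c x
    by (rule ell2_eqI)
      (simp add: Rep_kernel scaleC_ell2.rep_eq bounded_op_scaleC[OF bounded_word_adj]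
        bounded_op_scaleC[OF bounded_P] scaleR_scaleC scaleC_scaleC mult.commute)
  ultimately show ?thesis
    unfolding bounded_op_def by (auto intro!: exI[of _ 1])
qed

lemma cinner_Rep_kernel: "cinner (Rep_ell2 (kernel x) \<alpha>) (Rep_ell2 (kernel y) \<alpha>) = cinner (cell \<alpha> x) y"
  using b_pos[of \<alpha>]
  by (simp add: Rep_kernel cinner_cell cinner.scaleR_left cinner.scaleR_right scaleR_conv_of_real
      mult.assoc[symmetric] of_real_mult[symmetric] del: of_real_mult)

section \<open>The projection K^* K onto the pure part\<close>

definition pure_proj :: "'k \<Rightarrow> 'k"
  where "pure_proj x = adj_on UNIV kernel (kernel x)"

lemma bounded_pure_proj: "bounded_op UNIV UNIV pure_proj"
proof -
  have "bounded_op UNIV UNIV (\<lambda>x. adj_on UNIV kernel (kernel x))"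
    using bounded_kernel bounded_op_adj[OF bounded_kernel] unfolding bounded_op_UNIV_iff
    by (auto intro: bounded_linear_compose)
  then show ?thesis
    by (simp add: pure_proj_def[abs_def])
qed

lemmas pure_proj_linear = linear_simps[OF conjunct1[OF bounded_pure_proj[unfolded bounded_op_UNIV_iff]]]

lemma cinner_pure_proj: "cinner (pure_proj x) y = cinner (kernel x) (kernel y)"
  unfolding pure_proj_def
  by (metis cinner_adj[OF bounded_kernel] cinner_commute)

lemma cinner_pure_proj_right: "cinner x (pure_proj y) = cinner (pure_proj x) y"
  by (metis cinner_pure_proj cinner_commute)

text \<open>The adjoint of \<open>kernel\<close> is applied to the expansion of
  \<open>kernel x\<close> into elementary tensors; each of them is sent to a cell.\<close>

lemma cell_has_sum: "((\<lambda>\<alpha>. cell \<alpha> x) has_sum pure_proj x) UNIV"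
proof -
  have "adj_on UNIV kernel (ket \<alpha> \<otimes>\<^sub>h Rep_ell2 (kernel x) \<alpha>) = cell \<alpha> x" for \<alpha>
    by (rule cinner_eqI)
      (simp add: cinner_adj[OF bounded_kernel, symmetric] cinner_ket_tensor_right cinner_Rep_kernel
        cinner_cell_right)
  then show ?thesis
    using bounded_op_has_sum[OF bounded_op_adj[OF bounded_kernel] closed_csubspace_UNIV
        ket_tensor_has_sum[of "kernel x"]]
    by (simp add: pure_proj_def)
qed

text \<open>Of the cells that sum to \<open>pure_proj x\<close> only the one at
  \<open>\<alpha>\<close> survives. The result is the identity K K^* K = K that characterises
  partial isometries.\<close>

lemma P_adj_pure_proj: "P (word_adj \<alpha> (pure_proj x)) = P (word_adj \<alpha> x)"
proof -
  have "((\<lambda>\<beta>. P (word_adj \<alpha> (cell \<beta> x))) has_sum P (word_adj \<alpha> (pure_proj x))) UNIV"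
    by (rule bounded_op_has_sum[OF bounded_op_compose[OF bounded_P bounded_word_adj]
          closed_csubspace_UNIV cell_has_sum]) simp
  moreover have "((\<lambda>\<beta>. P (word_adj \<alpha> (cell \<beta> x))) has_sum P (word_adj \<alpha> x)) UNIV"
    unfolding P_adj_cell by (rule has_sum_finite_neutralI[of "{\<alpha>}"]) auto
  ultimately show ?thesis
    by (rule has_sum_unique)
qed

lemma kernel_pure_proj: "kernel (pure_proj x) = kernel x"
  by (rule ell2_eqI) (simp add: Rep_kernel P_adj_pure_proj)

lemma pure_proj_idem: "pure_proj (pure_proj x) = pure_proj x"
  unfolding pure_proj_def[of "pure_proj x"] kernel_pure_proj by (simp add: pure_proj_def)

lemma cell_pure_proj: "cell \<alpha> (pure_proj x) = cell \<alpha> x"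
  by (simp add: cell_def P_adj_pure_proj)

lemma pure_proj_adj_kernel: "pure_proj (adj_on UNIV kernel y) = adj_on UNIV kernel y"
  by (rule cinner_eqI)
    (simp add: cinner_pure_proj_right cinner_adj[OF bounded_kernel, symmetric] kernel_pure_proj)

lemma kernel_eq_0_iff: "kernel x = 0 \<longleftrightarrow> pure_proj x = 0"
proof
  assume "pure_proj x = 0"
  then have "cinner (kernel x) (kernel x) = 0"
    by (simp add: cinner_pure_proj[symmetric] cinner.zero_left)
  then show "kernel x = 0" by simp
next
  assume "kernel x = 0"
  then show "pure_proj x = 0"
    using bounded_op_adj[OF bounded_kernel]
    by (simp add: pure_proj_def bounded_op_UNIV_iff linear_simps)
qed

lemma kernel_eq_0_iff_cells: "kernel x = 0 \<longleftrightarrow> (\<forall>\<alpha>. P (word_adj \<alpha> x) = 0)"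
proof
  assume "kernel x = 0"
  then show "\<forall>\<alpha>. P (word_adj \<alpha> x) = 0"
    using Rep_kernel[of x] less_imp_neq[OF b_pos] by (metis zero_ell2.rep_eq scaleR_eq_0_iff real_sqrt_eq_zero_cancel_iff)
next
  assume "\<forall>\<alpha>. P (word_adj \<alpha> x) = 0"
  then show "kernel x = 0"
    by (intro ell2_eqI) (simp add: Rep_kernel zero_ell2.rep_eq)
qed

lemma kernel_eq_0_P: "kernel x = 0 \<Longrightarrow> P x = 0"
  using kernel_eq_0_iff_cells[of x] by (metis word_adj_Nil id_apply)

text \<open>For words that begin with \<open>i\<close> this is \<open>P_adj_Cons\<close>; the other
  coordinates vanish by the prefix lemma. The shift on the right is W_i tensored with the identity,
  so this is the intertwining relation of the Berezin kernel.\<close>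

lemma kernel_V:
  assumes c: "\<And>\<beta>. \<bar>sqrt (b \<beta> / b (i # \<beta>))\<bar> \<le> B"
  shows "kernel (V i h) = left_shift (\<lambda>\<beta>. sqrt (b \<beta> / b (i # \<beta>))) i (kernel h)"
proof (rule ell2_eqI)
  fix \<gamma>
  show "Rep_ell2 (kernel (V i h)) \<gamma> =
      Rep_ell2 (left_shift (\<lambda>\<beta>. sqrt (b \<beta> / b (i # \<beta>))) i (kernel h)) \<gamma>"
  proof (cases "\<exists>\<beta>. \<gamma> = i # \<beta>")
    case True
    then obtain \<beta> where \<beta>: "\<gamma> = i # \<beta>" by blast
    have "sqrt (b (i # \<beta>)) * (b \<beta> / b (i # \<beta>)) = sqrt (b \<beta> / b (i # \<beta>)) * sqrt (b \<beta>)"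
      using b_pos[of \<beta>] b_pos[of "i # \<beta>"]
      by (simp add: real_sqrt_divide field_simps)
    then show ?thesis
      by (simp add: \<beta> Rep_kernel Rep_left_shift[OF c] P_adj_Cons[unfolded op_word.simps])
  next
    case False
    then have "\<nexists>\<beta>. \<gamma> = [i] @ \<beta>" by simp
    from P_adj_word_not_prefix[OF this, of h] False show ?thesis
      by (auto simp: Rep_kernel Rep_left_shift[OF c] split: list.splits)
  qed
qed

text \<open>\<open>V i\<close> carries the cell at \<beta> to the cell at i\<beta>, and the cells at
  words that do not begin with \<open>i\<close> vanish on the range of \<open>V i\<close>.
  Reindexing the sum of cells gives the commutation.\<close>

lemma pure_proj_V: "pure_proj (V i x) = V i (pure_proj x)"
proof -
  have "((\<lambda>\<alpha>. cell \<alpha> (V i x)) has_sum pure_proj (V i x)) (range ((#) i))"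
  proof (rule has_sum_cong_neutral[THEN iffD1, OF _ _ _ cell_has_sum])
    fix \<alpha> assume "\<alpha> \<in> UNIV - range ((#) i)"
    then have "\<nexists>\<gamma>. \<alpha> = [i] @ \<gamma>" by auto
    from P_adj_word_not_prefix[OF this, of x] show "cell \<alpha> (V i x) = 0"
      by (simp add: cell_def word_linear)
  qed auto
  moreover have "cell (i # \<beta>) (V i x) = V i (cell \<beta> x)" for \<beta>
    using P_adj_Cons[of i \<beta> x] b_pos[of "i # \<beta>"] by (simp add: cell_def V_linear word_linear)
  ultimately have "((\<lambda>\<beta>. V i (cell \<beta> x)) has_sum pure_proj (V i x)) UNIV"
    by (subst (asm) has_sum_reindex) (auto simp: o_def)
  moreover have "((\<lambda>\<beta>. V i (cell \<beta> x)) has_sum V i (pure_proj x)) UNIV"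
    by (rule bounded_op_has_sum[OF bounded_V closed_csubspace_UNIV cell_has_sum]) simp
  ultimately show ?thesis
    by (rule has_sum_unique)
qed

lemma pure_proj_adj_V: "pure_proj (adj_on UNIV (V i) x) = adj_on UNIV (V i) (pure_proj x)"
  by (rule cinner_eqI)
    (simp add: cinner_pure_proj_right cinner_adj[OF bounded_V, symmetric] pure_proj_V)

section \<open>Reducing subspaces and the restricted tuples\<close>

lemma reducing_pure: "reducing (range pure_proj) (V i)"
  unfolding reducing_def
  using closed_csubspace_range_idempotent[OF bounded_pure_proj pure_proj_idem]
  by (auto simp: pure_proj_V[symmetric] pure_proj_adj_V[symmetric])

lemma reducing_ker: "reducing {x. pure_proj x = 0} (V i)"
proof -
  have "adj_on UNIV (V i) 0 = 0"
    using word_adj_linear(1)[of "[i]"] word_adj_linear[of "[i]"] by simp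
  then show ?thesis
    unfolding reducing_def
    using closed_csubspace_vimage[OF bounded_pure_proj closed_csubspace_zero]
    by (auto simp: pure_proj_V pure_proj_adj_V V_linear)
qed

lemma reducing_UNIV: "reducing UNIV (V i)"
  by (simp add: reducing_def closed_csubspace_UNIV)

context
  fixes M :: "'k set"
  assumes red: "reducing M (V i)"
begin

lemma closed_csubspace_reducing: "closed_csubspace M"
  using red by (simp add: reducing_def)

lemma V_reducing: "x \<in> M \<Longrightarrow> V i x \<in> M"
  using red[of i] by (auto simp: reducing_def)

lemma word_reducing: "x \<in> M \<Longrightarrow> op_word V \<alpha> x \<in> M"
  by (induction \<alpha>) (auto simp: V_reducing)

lemma word_adj_reducing: "x \<in> M \<Longrightarrow> word_adj \<alpha> x \<in> M"
proof (induction \<alpha> arbitrary: x)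
  case (Cons i \<alpha>)
  have "word_adj [i] x \<in> M"
    using red[of i] Cons.prems by (auto simp: reducing_def)
  then show ?case
    unfolding word_adj_Cons[of i \<alpha>] by (rule Cons.IH)
qed simp

lemma restrict_word: "x \<in> M \<Longrightarrow> op_word (\<lambda>i. restrict (V i) M) \<alpha> x = op_word V \<alpha> x"
  by (induction \<alpha>) (auto simp: word_reducing)

text \<open>Since \<open>M\<close> is invariant under the adjoints, the ambient adjoint already
  yields a vector of \<open>M\<close>, and adjoints on a carrier are unique.\<close>

lemma restrict_word_adj: "x \<in> M \<Longrightarrow> adj_on M (op_word (\<lambda>i. restrict (V i) M) \<alpha>) x = word_adj \<alpha> x"
  by (rule adj_on_eqI)
    (simp_all add: closed_csubspace_reducing word_adj_reducing restrict_word cinner_word)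

lemma scaleR_reducing: "x \<in> M \<Longrightarrow> r *\<^sub>R x \<in> M"
  using closed_csubspace_reducing by (simp add: closed_csubspace_def csubspace_scaleR)

lemma sum_reducing: "(\<And>i. i \<in> I \<Longrightarrow> f i \<in> M) \<Longrightarrow> sum f I \<in> M"
  using closed_csubspace_reducing by (simp add: closed_csubspace_def complex_vector.subspace_sum)

lemma restrict_defect_partial_sum:
  "x \<in> M \<Longrightarrow> defect_partial_sum b M (\<lambda>i. restrict (V i) M) k x = defect_partial_sum b UNIV V k x"
  unfolding defect_partial_sum_def
  by (simp add: restrict_word_adj restrict_word word_adj_reducing)

text \<open>\<open>P x\<close> is a limit of polynomials in the V_i and their adjoints applied to
  \<open>x\<close>, and \<open>M\<close> is closed. That this holds for every reducing subspace, and
  not only for the two summands, is what uniqueness uses.\<close>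

lemma P_reducing: "x \<in> M \<Longrightarrow> P x \<in> M"
proof -
  assume x: "x \<in> M"
  have "defect_partial_sum b UNIV V k x \<in> M" for k
    unfolding defect_partial_sum_def
    by (intro sum_reducing scaleR_reducing word_reducing word_adj_reducing x)
  then show ?thesis
    using closed_csubspace_reducing
    by (intro closed_sequentially[OF _ _ defect_LIMSEQ]) (auto simp: closed_csubspace_def)
qed

lemma cell_reducing: "x \<in> M \<Longrightarrow> cell \<alpha> x \<in> M"
  by (simp add: cell_def scaleR_reducing word_reducing word_adj_reducing P_reducing)

lemma pure_proj_reducing: "x \<in> M \<Longrightarrow> pure_proj x \<in> M"
  by (rule closed_csubspace_has_sum[OF closed_csubspace_reducing cell_has_sum]) (rule cell_reducing)

lemma wot_tendsto_defect:
  "wot_tendsto M (defect_partial_sum b M (\<lambda>i. restrict (V i) M)) P sequentially"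
  unfolding wot_tendsto_def
  using bounded_op_mono[OF bounded_P, of M M] P_reducing
  by (auto simp: restrict_defect_partial_sum
      intro!: bounded_linear.tendsto[OF cinner.bounded_linear_left] defect_LIMSEQ)

lemma defect_reducing: "x \<in> M \<Longrightarrow> defect b M (\<lambda>i. restrict (V i) M) x = P x"
  unfolding defect_def
  by (rule wot_Lim_eq[OF closed_csubspace_reducing wot_tendsto_defect]) simp_all

lemma restrict_purity_partial_sum:
  "x \<in> M \<Longrightarrow> purity_partial_sum b M (\<lambda>i. restrict (V i) M) F x = (\<Sum>\<alpha>\<in>F. cell \<alpha> x)"
  unfolding purity_partial_sum_def cell_def
  by (simp add: restrict_word_adj restrict_word word_adj_reducing defect_reducing P_reducing)

lemma wot_tendsto_purity:
  "wot_tendsto M (purity_partial_sum b M (\<lambda>i. restrict (V i) M)) pure_proj (finite_subsets_at_top UNIV)"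
  unfolding wot_tendsto_def
  using bounded_op_mono[OF bounded_pure_proj, of M M] pure_proj_reducing
  by (auto simp: restrict_purity_partial_sum
      intro!: bounded_linear.tendsto[OF cinner.bounded_linear_left] cell_has_sum[unfolded has_sum_def])

lemma purity_reducing:
  "x \<in> M \<Longrightarrow> wot_Lim M (purity_partial_sum b M (\<lambda>i. restrict (V i) M))
    (finite_subsets_at_top UNIV) x = pure_proj x"
  by (rule wot_Lim_eq[OF closed_csubspace_reducing wot_tendsto_purity]) simp_all

text \<open>Both order conditions hold because \<open>P\<close> and the complement of
  \<open>pure_proj\<close> are projections. The case \<open>M = UNIV\<close> covers \<open>V\<close>
  itself.\<close>

lemma nc_domain_reducing: "(\<lambda>i. restrict (V i) M) \<in> nc_domain b M"
proof -
  have "bounded_op M M (restrict (V i) M)" for i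
    using bounded_op_mono[OF bounded_V subset_UNIV V_reducing]
    by (simp add: bounded_op_cong[OF closed_csubspace_reducing, of "restrict (V i) M" "V i"])
  moreover have "op_nonneg M (defect b M (\<lambda>i. restrict (V i) M))"
  proof -
    have "cinner (P x) x = cinner (P x) (P x)" for x
      by (metis P_idem cinner_P)
    then show ?thesis
      by (simp add: op_nonneg_def defect_reducing cinner_self_nonneg)
  qed
  moreover have "op_le M (wot_Lim M (purity_partial_sum b M (\<lambda>i. restrict (V i) M))
      (finite_subsets_at_top UNIV)) id"
  proof -
    have "cinner (x - pure_proj x) x = cinner (x - pure_proj x) (x - pure_proj x)" for x
      by (simp add: cinner.diff_left cinner.diff_right cinner_pure_proj_right pure_proj_idem pure_proj_linear cinner.zero_left)
    then show ?thesis
      by (simp add: op_le_def op_nonneg_def purity_reducing cinner_self_nonneg)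
  qed
  ultimately show ?thesis
    using wot_tendsto_defect wot_tendsto_purity
    by (auto simp: nc_domain_def wot_convergent_def)
qed

lemma pure_tuple_iff: "pure_tuple b M (\<lambda>i. restrict (V i) M) \<longleftrightarrow> (\<forall>x\<in>M. pure_proj x = x)"
  by (simp add: pure_tuple_def nc_domain_reducing purity_reducing)

lemma cuntz_tuple_iff: "cuntz_tuple b M (\<lambda>i. restrict (V i) M) \<longleftrightarrow> (\<forall>x\<in>M. P x = 0)"
  by (simp add: cuntz_tuple_def nc_domain_reducing defect_reducing)

text \<open>\<open>M\<close> contains every V_\<alpha>^* x, so all coordinates P V_\<alpha>^* x of
  the kernel vanish.\<close>

lemma pure_proj_eq_0_reducing:
  assumes "\<And>x. x \<in> M \<Longrightarrow> P x = 0" "x \<in> M"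
  shows "pure_proj x = 0"
  using assms unfolding kernel_eq_0_iff[symmetric] kernel_eq_0_iff_cells
  by (simp add: word_adj_reducing)

end

section \<open>The Berezin kernel as a partial isometry and as a unitary\<close>

lemma restrict_UNIV_V: "(\<lambda>i. restrict (V i) UNIV) = V"
  by (simp add: fun_eq_iff)

lemma defect_eq: "defect b UNIV V = P"
  using defect_reducing[OF reducing_UNIV] by (simp add: restrict_UNIV_V fun_eq_iff)

lemma nc_domain_V: "V \<in> nc_domain b UNIV"
  using nc_domain_reducing[OF reducing_UNIV] by (simp add: restrict_UNIV_V)

lemma orthogonal_projection_P: "orthogonal_projection P"
  by (simp add: orthogonal_projection_def bounded_P P_idem cinner_P)

text \<open>The defect is a projection, hence its own nonnegative square root; the infinite sum is
  then the expansion of \<open>kernel h\<close>.\<close>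

lemma berezin_kernel_eq: "berezin_kernel b UNIV V = kernel"
proof
  fix h
  have "sqrt (b \<alpha>) *\<^sub>R (ket \<alpha> \<otimes>\<^sub>h P (word_adj \<alpha> h)) = ket \<alpha> \<otimes>\<^sub>h Rep_ell2 (kernel h) \<alpha>" for \<alpha>
    by (rule ell2_eqI) (simp add: scaleR_ell2.rep_eq Rep_ket_tensor Rep_kernel)
  then show "berezin_kernel b UNIV V h = kernel h"
    unfolding berezin_kernel_def defect_eq sqrt_op_projection[OF orthogonal_projection_P]
    by (simp add: infsumI[OF ket_tensor_has_sum])
qed

lemma closed_csubspace_range_P: "closed_csubspace (range P)"
  by (rule closed_csubspace_range_idempotent[OF bounded_P P_idem])

lemma closure_range_P: "closure (range P) = range P"
  using closed_csubspace_range_P by (simp add: closed_csubspace_def)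

lemma kernel_in_fock_tensor: "kernel h \<in> fock_tensor (range P)"
proof -
  have "csubspace (range P)"
    using closed_csubspace_range_P by (simp add: closed_csubspace_def)
  then show ?thesis
    by (simp add: fock_tensor_eq[OF closed_csubspace_range_P] Rep_kernel csubspace_scaleR)
qed

lemma pure_proj_range_iff: "x \<in> range pure_proj \<longleftrightarrow> pure_proj x = x"
  by (simp add: range_idempotent[OF pure_proj_idem])

lemma adj_kernel_image: "adj_on UNIV kernel ` fock_tensor (range P) = range pure_proj"
proof
  show "adj_on UNIV kernel ` fock_tensor (range P) \<subseteq> range pure_proj"
    by (auto simp: pure_proj_range_iff pure_proj_adj_kernel)
  show "range pure_proj \<subseteq> adj_on UNIV kernel ` fock_tensor (range P)"
    using kernel_in_fock_tensor by (auto simp: pure_proj_def)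
qed

lemma partial_isometry_kernel: "partial_isometry UNIV (fock_tensor (range P)) kernel"
  unfolding partial_isometry_def
proof (intro conjI ballI impI)
  show "bounded_op UNIV (fock_tensor (range P)) kernel"
    by (rule bounded_op_mono[OF bounded_kernel]) (simp_all add: kernel_in_fock_tensor)
  fix x assume x: "\<forall>y\<in>UNIV. kernel y = 0 \<longrightarrow> cinner x y = 0"
  \<comment> \<open>This difference is a vector on which the hypothesis about \<open>x\<close> can
    be used. The resulting orthogonality says that \<parallel>x\<parallel>^2 equals the inner
    product of x with \<open>pure_proj x\<close>, which is \<parallel>K x\<parallel>^2.\<close>
  have "kernel (x - pure_proj x) = 0"
    by (simp add: kernel_eq_0_iff pure_proj_linear pure_proj_idem)
  then have "cinner x (x - pure_proj x) = 0"
    using x by blast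
  then have "cinner (kernel x) (kernel x) = cinner x x"
    by (simp add: cinner.diff_right cinner_pure_proj_right cinner_pure_proj)
  then show "norm (kernel x) = norm x"
    unfolding cinner_self of_real_eq_iff by (simp add: power2_eq_iff_nonneg)
qed

text \<open>Explicit preimages of elementary tensors, from which surjectivity follows. For \<alpha>
  = \<beta>\<gamma> the coordinate contains P V_\<gamma>^* d = P V_\<gamma>^* P d, which vanishes
  unless \<gamma> is empty.\<close>

lemma kernel_word: "P d = d \<Longrightarrow> kernel (sqrt (b \<beta>) *\<^sub>R op_word V \<beta> d) = ket \<beta> \<otimes>\<^sub>h d"
proof (rule ell2_eqI)
  fix \<alpha> assume d: "P d = d"
  have "P (word_adj \<alpha> (op_word V \<beta> d)) = (if \<alpha> = \<beta> then (1 / b \<beta>) *\<^sub>R d else 0)"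
  proof (cases "\<exists>\<gamma>. \<alpha> = \<beta> @ \<gamma>")
    case True
    then obtain \<gamma> where \<gamma>: "\<alpha> = \<beta> @ \<gamma>" by blast
    have "P (word_adj \<gamma> d) = (if \<gamma> = [] then d else 0)"
      using P_word_adj_P[of \<gamma> d] d by auto
    then show ?thesis
      unfolding \<gamma> P_adj_word_append by (simp add: b_Nil)
  next
    case False
    then show ?thesis
      unfolding P_adj_word_not_prefix[OF False] by auto
  qed
  then show "Rep_ell2 (kernel (sqrt (b \<beta>) *\<^sub>R op_word V \<beta> d)) \<alpha> = Rep_ell2 (ket \<beta> \<otimes>\<^sub>h d) \<alpha>"
    using b_pos[of \<beta>] by (simp add: Rep_kernel Rep_ket_tensor word_adj_linear P_linear)
qed

text \<open>K K^* fixes the range of K, hence by \<open>kernel_word\<close> every elementary tensor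
  in the expansion of \<open>y\<close>; boundedness extends this to the sum.\<close>

lemma kernel_adj_kernel:
  assumes "y \<in> fock_tensor (range P)"
  shows "kernel (adj_on UNIV kernel y) = y"
proof -
  have y: "P (Rep_ell2 y \<alpha>) = Rep_ell2 y \<alpha>" for \<alpha>
  proof -
    have "Rep_ell2 y \<alpha> \<in> range P"
      using assms by (simp add: fock_tensor_eq[OF closed_csubspace_range_P])
    then show ?thesis
      by (auto simp: P_idem)
  qed
  have ket: "kernel (adj_on UNIV kernel (ket \<alpha> \<otimes>\<^sub>h Rep_ell2 y \<alpha>)) = ket \<alpha> \<otimes>\<^sub>h Rep_ell2 y \<alpha>" for \<alpha>
    unfolding kernel_word[OF y, symmetric] pure_proj_def[symmetric] by (rule kernel_pure_proj)
  have "bounded_op UNIV UNIV (\<lambda>z. kernel (adj_on UNIV kernel z))"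
    using bounded_kernel bounded_op_adj[OF bounded_kernel] unfolding bounded_op_UNIV_iff
    by (auto intro: bounded_linear_compose)
  from bounded_op_has_sum[OF this closed_csubspace_UNIV ket_tensor_has_sum[of y]]
  have "((\<lambda>\<alpha>. ket \<alpha> \<otimes>\<^sub>h Rep_ell2 y \<alpha>) has_sum kernel (adj_on UNIV kernel y)) UNIV"
    by (simp add: ket)
  then show ?thesis
    using ket_tensor_has_sum by (rule has_sum_unique)
qed

lemma unitary_kernel:
  "unitary_op (range pure_proj) (fock_tensor (range P)) (restrict kernel (range pure_proj))"
  unfolding unitary_op_def
proof (intro conjI ballI)
  have c: "closed_csubspace (range pure_proj)"
    by (rule closed_csubspace_range_idempotent[OF bounded_pure_proj pure_proj_idem])
  show "bounded_op (range pure_proj) (fock_tensor (range P)) (restrict kernel (range pure_proj))"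
    using bounded_op_mono[OF bounded_kernel, of "range pure_proj" "fock_tensor (range P)"]
    by (subst bounded_op_cong[OF c, of _ kernel]) (simp_all add: kernel_in_fock_tensor)
  show "restrict kernel (range pure_proj) ` range pure_proj = fock_tensor (range P)"
  proof
    show "restrict kernel (range pure_proj) ` range pure_proj \<subseteq> fock_tensor (range P)"
      by (auto simp: kernel_in_fock_tensor)
    show "fock_tensor (range P) \<subseteq> restrict kernel (range pure_proj) ` range pure_proj"
    proof
      fix y :: "('n list, 'k) ell2" assume y: "y \<in> fock_tensor (range P)"
      have a: "adj_on UNIV kernel y \<in> range pure_proj"
        by (simp add: pure_proj_range_iff pure_proj_adj_kernel)
      then show "y \<in> restrict kernel (range pure_proj) ` range pure_proj"
        using kernel_adj_kernel[OF y] imageI[OF a, of "restrict kernel (range pure_proj)"] by simp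
    qed
  qed
  fix x y assume "x \<in> range pure_proj" "y \<in> range pure_proj"
  then show "cinner (restrict kernel (range pure_proj) x) (restrict kernel (range pure_proj) y) = cinner x y"
    by (simp add: cinner_pure_proj[symmetric] pure_proj_range_iff[of x])
qed

text \<open>The adjoint is that of the restricted kernel, so it suffices to test against vectors of
  the pure part, where K preserves inner products; \<open>kernel_V\<close> then replaces the shifted
  kernel of \<open>h\<close> by the kernel of \<open>V i h\<close>.\<close>

lemma intertwining:
  assumes c: "\<And>\<beta>. \<bar>sqrt (b \<beta> / b (i # \<beta>))\<bar> \<le> B"
    and T: "blinfun_apply T = left_shift (\<lambda>\<beta>. sqrt (b \<beta> / b (i # \<beta>))) i"
    and h: "h \<in> range pure_proj"
  shows "adj_on (range pure_proj) (restrict kernel (range pure_proj))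
    (tensor_id T (range P) (kernel h)) = V i h"
proof (rule adj_on_eqI)
  show "closed_csubspace (range pure_proj)"
    by (rule closed_csubspace_range_idempotent[OF bounded_pure_proj pure_proj_idem])
  show "V i h \<in> range pure_proj"
    using h by (simp add: pure_proj_range_iff pure_proj_V)
  fix z assume "z \<in> range pure_proj"
  then show "cinner (restrict kernel (range pure_proj) z) (tensor_id T (range P) (kernel h)) = cinner z (V i h)"
    unfolding tensor_id_eq_left_shift[OF c T closed_csubspace_range_P kernel_in_fock_tensor]
      kernel_V[OF c, symmetric]
    by (simp add: cinner_pure_proj[symmetric] pure_proj_range_iff[of z])
qed

section \<open>The decomposition and its uniqueness\<close>

lemma wold_decomposition: "wold_decomposition b V (range pure_proj) {x. pure_proj x = 0}"
proof -
  have "cinner x y = 0" if "x \<in> range pure_proj" "pure_proj y = 0" for x y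
    using that by (metis cinner.zero_right cinner_pure_proj_right pure_proj_range_iff)
  moreover have "\<exists>x\<in>range pure_proj. \<exists>y\<in>{x. pure_proj x = 0}. z = x + y" for z
    by (rule bexI[of _ "pure_proj z"], rule bexI[of _ "z - pure_proj z"])
      (simp_all add: pure_proj_linear pure_proj_idem)
  ultimately have "orthogonal_decomposition (range pure_proj) {x. pure_proj x = 0}"
    using closed_csubspace_reducing[OF reducing_pure] closed_csubspace_reducing[OF reducing_ker]
    by (simp add: orthogonal_decomposition_def)
  moreover have "P x = 0" if "pure_proj x = 0" for x
    using that kernel_eq_0_P kernel_eq_0_iff by blast
  ultimately show ?thesis
    by (simp add: wold_decomposition_def reducing_pure reducing_ker pure_tuple_iff[OF reducing_pure]
        cuntz_tuple_iff[OF reducing_ker] pure_proj_idem)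
qed

text \<open>On a pure reducing subspace \<open>pure_proj\<close> is the identity, on a Cuntz one it
  is 0. Since \<open>M\<close> and \<open>N\<close> together span the space, they must be the range
  and the kernel of \<open>pure_proj\<close>.\<close>

lemma wold_decomposition_unique:
  assumes "wold_decomposition b V M N"
  shows "M = range pure_proj" "N = {x. pure_proj x = 0}"
proof -
  have red: "\<And>i. reducing M (V i)" "\<And>i. reducing N (V i)"
    and od: "orthogonal_decomposition M N"
    and M: "\<And>x. x \<in> M \<Longrightarrow> pure_proj x = x" and N: "\<And>x. x \<in> N \<Longrightarrow> P x = 0"
    using assms pure_tuple_iff[of M] cuntz_tuple_iff[of N] by (auto simp: wold_decomposition_def)
  have N: "pure_proj x = 0" if "x \<in> N" for x
    by (rule pure_proj_eq_0_reducing[OF red(2) N that])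
  have split: "\<exists>x\<in>M. \<exists>y\<in>N. z = x + y" for z
    using od by (simp add: orthogonal_decomposition_def)
  show "M = range pure_proj"
  proof (intro set_eqI iffI)
    fix z assume "z \<in> range pure_proj"
    then have z: "pure_proj z = z" by (simp add: pure_proj_range_iff)
    obtain x y where xy: "x \<in> M" "y \<in> N" "z = x + y" using split by blast
    then have "pure_proj z = x"
      using M N by (simp add: pure_proj_linear)
    then show "z \<in> M" using z xy by simp
  qed (use M in \<open>simp add: pure_proj_range_iff\<close>)
  show "N = {x. pure_proj x = 0}"
  proof (intro set_eqI iffI)
    fix z assume z: "z \<in> {x. pure_proj x = 0}"
    obtain x y where xy: "x \<in> M" "y \<in> N" "z = x + y" using split by blast
    then have "pure_proj z = x"
      using M N by (simp add: pure_proj_linear)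
    then show "z \<in> N" using z xy by simp
  qed (use N in simp)
qed

section \<open>Geometric descriptions of the two summands\<close>

lemma word_image_eq: "op_word V \<alpha> ` range P = range (cell \<alpha>)"
proof (intro set_eqI iffI)
  fix x assume "x \<in> op_word V \<alpha> ` range P"
  then obtain z where z: "x = op_word V \<alpha> (P z)"
    by blast
  define d where "d = P z"
  have d: "P d = d" and x: "x = op_word V \<alpha> d"
    by (simp_all add: d_def P_idem z)
  have "cell \<alpha> x = x"
    using P_adj_word_append[of \<alpha> "[]" d] b_pos[of \<alpha>] d
    by (simp add: x cell_def b_Nil word_linear)
  then show "x \<in> range (cell \<alpha>)"
    by (metis rangeI)
next
  fix x assume "x \<in> range (cell \<alpha>)"
  then obtain y where "x = op_word V \<alpha> (P (b \<alpha> *\<^sub>R word_adj \<alpha> y))"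
    by (auto simp: cell_def word_linear P_linear)
  then show "x \<in> op_word V \<alpha> ` range P"
    by blast
qed

text \<open>Each V_\<alpha>(D) is the range of the bounded idempotent \<open>cell \<alpha>\<close>
  and thus already closed, so no closures are taken here. Orthogonality is \<open>cell_cell\<close>
  moved across the inner product.\<close>

lemma orthogonal_family_cells: "orthogonal_family UNIV (\<lambda>\<alpha>. op_word V \<alpha> ` range P)"
  unfolding orthogonal_family_def word_image_eq
  using closed_csubspace_range_idempotent[OF bounded_cell, of \<alpha> for \<alpha>]
  by (auto simp: cell_cell cinner_cell_right[of _ _ "_ :: 'k"] cinner.zero_left)

lemma pure_eq_hilbert_sum: "range pure_proj = hilbert_sum UNIV (\<lambda>\<alpha>. op_word V \<alpha> ` range P)"
  unfolding hilbert_sum_def word_image_eq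
proof
  show "range pure_proj \<subseteq> closure (cspan (\<Union>\<alpha>. range (cell \<alpha>)))"
  proof
    fix x assume "x \<in> range pure_proj"
    then have sum: "((\<lambda>\<alpha>. cell \<alpha> x) has_sum x) UNIV"
      using cell_has_sum[of x] by (simp add: pure_proj_range_iff)
    have "cell \<alpha> x \<in> closure (cspan (\<Union>\<alpha>. range (cell \<alpha>)))" for \<alpha>
      by (intro subsetD[OF closure_subset] complex_vector.span_base) blast
    then show "x \<in> closure (cspan (\<Union>\<alpha>. range (cell \<alpha>)))"
      by (rule closed_csubspace_has_sum[OF closed_csubspace_closure_cspan sum])
  qed
  have "pure_proj (cell \<alpha> x) = cell \<alpha> x" for \<alpha> x
    by (rule cinner_eqI) (simp add: cinner_pure_proj_right cinner_cell_right cell_pure_proj)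
  then show "closure (cspan (\<Union>\<alpha>. range (cell \<alpha>))) \<subseteq> range pure_proj"
    by (intro closure_cspan_least closed_csubspace_range_idempotent[OF bounded_pure_proj pure_proj_idem])
      (auto simp: pure_proj_range_iff)
qed

lemma cspan_range_word: "cspan (range (op_word V \<alpha>)) = range (op_word V \<alpha>)"
  by (simp add: csubspace_range[OF bounded_word])

lemma orthogonal_family_words: "orthogonal_family {\<alpha>. length \<alpha> = s} (\<lambda>\<alpha>. closure (range (op_word V \<alpha>)))"
  unfolding orthogonal_family_def
proof (intro conjI ballI impI)
  show "closed_csubspace (closure (range (op_word V \<alpha>)))" for \<alpha>
    by (rule closed_csubspace_closure[OF csubspace_range[OF bounded_word]])
  fix \<alpha> \<beta> :: "'n list" and x y
  assume "\<alpha> \<in> {\<alpha>. length \<alpha> = s}" "\<beta> \<in> {\<alpha>. length \<alpha> = s}" "\<alpha> \<noteq> \<beta>"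
    and xy: "x \<in> closure (range (op_word V \<alpha>))" "y \<in> closure (range (op_word V \<beta>))"
  then have "cinner (op_word V \<alpha> u) (op_word V \<beta> v) = 0" for u v
    by (simp add: cinner_word adj_word_word cinner.zero_right)
  then show "cinner x y = 0"
    using closure_cspan_orthogonal[of "range (op_word V \<alpha>)" "range (op_word V \<beta>)" x y] xy
    by (auto simp: cspan_range_word)
qed

lemma orthogonal_family_V: "orthogonal_family UNIV (\<lambda>i. closure (range (V i)))"
proof -
  have "closure (range (V i)) = closure (range (op_word V [i]))" for i
    by simp
  then show ?thesis
    using orthogonal_family_words[of 1] unfolding orthogonal_family_def
    by (metis (mono_tags, lifting) length_Cons list.size(3) mem_Collect_eq list.inject One_nat_def)
qed

text \<open>The empty word has coefficient 1 and contributes \<open>x\<close> itself, while all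
  other terms lie in the ranges of the V_i. The formulas for both \<open>range P\<close> and the
  Cuntz part start from this split.\<close>

lemma defect_partial_sum_eq_add:
  "defect_partial_sum b UNIV V k x =
    x + (\<Sum>p\<in>{1..k}. \<Sum>\<alpha> | length \<alpha> = p. nc_inverse b \<alpha> *\<^sub>R op_word V \<alpha> (word_adj \<alpha> x))"
proof -
  have "{..k} = insert 0 {1..k}" by auto
  then show ?thesis
    by (simp add: defect_partial_sum_def nc_inverse_Nil[of b] b_Nil)
qed

text \<open>One inclusion is P V_i = 0. Conversely a vector orthogonal to all ranges is annihilated
  by every V_i^*, so its defect series reduces to the constant term and P x = x.\<close>

lemma range_P_eq: "range P = orth_complement (hilbert_sum UNIV (\<lambda>i. closure (range (V i))))"
  unfolding hilbert_sum_def orth_complement_closure_cspan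
proof (intro set_eqI iffI)
  fix x assume "x \<in> range P"
  then have x: "P x = x" by (auto simp: P_idem)
  have "range (V i) \<subseteq> {y. cinner y x = 0}" for i
    using x by (auto, metis P_V cinner.zero_left cinner_P)
  then have "closure (range (V i)) \<subseteq> {y. cinner y x = 0}" for i
    using closed_csubspace_orthogonal[of x] by (intro closure_minimal) (auto simp: closed_csubspace_def)
  then show "x \<in> {x. \<forall>y\<in>\<Union>i. closure (range (V i)). cinner x y = 0}"
    by (auto simp: cinner_eq_0_commute[of x])
next
  fix x assume "x \<in> {x. \<forall>y\<in>\<Union>i. closure (range (V i)). cinner x y = 0}"
  then have x: "cinner x (V i y) = 0" for i y
    using closure_subset[of "range (V i)"] by blast
  have "adj_on UNIV (V i) x = 0" for i
    by (rule cinner_eqI)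
      (use x in \<open>simp add: cinner_adj[OF bounded_V, symmetric] cinner.zero_right cinner_eq_0_commute[of _ x]\<close>)
  then have "word_adj \<alpha> x = 0" if "\<alpha> \<noteq> []" for \<alpha>
    using that word_adj_Cons[of "hd \<alpha>" "tl \<alpha>" x] by (simp add: word_adj_linear)
  moreover have "\<alpha> \<noteq> []" if "length \<alpha> \<in> {1..k}" for \<alpha> :: "'n list" and k
    using that by auto
  ultimately have "(\<Sum>p\<in>{1..k}. \<Sum>\<alpha> | length \<alpha> = p. nc_inverse b \<alpha> *\<^sub>R op_word V \<alpha> (word_adj \<alpha> x)) = 0" for k
    by (intro sum.neutral ballI) (auto simp: word_linear)
  then have "(\<lambda>k. x) \<longlonglongrightarrow> P x"
    using defect_LIMSEQ[of x] by (simp add: defect_partial_sum_eq_add)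
  then have "P x = x"
    by (simp add: LIMSEQ_const_iff)
  then show "x \<in> range P"
    by (metis rangeI)
qed

text \<open>On \<open>\<K>\<^sup>(\<^sup>1\<^sup>)\<close> the defect series vanishes, so \<open>x\<close> equals minus the terms with \<open>|\<alpha>| \<ge> 1\<close>.\<close>

lemma cuntz_subset_step:
  assumes x: "pure_proj x = 0"
  shows "x \<in> closure (cspan (\<Union>i. V i ` {x. pure_proj x = 0}))" (is "_ \<in> ?C")
proof -
  note red = reducing_ker
  have cs: "closed ?C" "csubspace ?C"
    using closed_csubspace_closure_cspan by (auto simp: closed_csubspace_def)
  have "op_word V \<alpha> (word_adj \<alpha> x) \<in> ?C" if "\<alpha> \<noteq> []" for \<alpha>
  proof -
    \<comment> \<open>Only the first letter is split off: the rest of the word keeps the vector in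
      the Cuntz part, which is reducing. The step can therefore be iterated inside that
      part.\<close>
    have "op_word V (tl \<alpha>) (word_adj \<alpha> x) \<in> {x. pure_proj x = 0}"
      using x by (intro word_reducing[OF red] word_adj_reducing[OF red]) simp
    moreover have "op_word V \<alpha> (word_adj \<alpha> x) = V (hd \<alpha>) (op_word V (tl \<alpha>) (word_adj \<alpha> x))"
      using that by (cases \<alpha>) auto
    ultimately show ?thesis
      by (intro subsetD[OF closure_subset] complex_vector.span_base) blast
  qed
  moreover have "\<alpha> \<noteq> []" if "length \<alpha> \<in> {1..k}" for \<alpha> :: "'n list" and k
    using that by auto
  ultimately have "(\<Sum>p\<in>{1..k}. \<Sum>\<alpha> | length \<alpha> = p. nc_inverse b \<alpha> *\<^sub>R op_word V \<alpha> (word_adj \<alpha> x)) \<in> ?C" for k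
    by (intro complex_vector.subspace_sum[OF cs(2)] csubspace_scaleR[OF cs(2)]) auto
  then have "- (defect_partial_sum b UNIV V k x - x) \<in> ?C" for k
    by (simp add: defect_partial_sum_eq_add complex_vector.subspace_neg[OF cs(2)])
  moreover have "(\<lambda>k. - (defect_partial_sum b UNIV V k x - x)) \<longlonglongrightarrow> - (P x - x)"
    by (intro tendsto_intros defect_LIMSEQ)
  moreover have "P x = 0"
    using x kernel_eq_0_P kernel_eq_0_iff by blast
  ultimately show ?thesis
    using closed_sequentially[OF cs(1), of "\<lambda>k. - (defect_partial_sum b UNIV V k x - x)" x] by simp
qed

text \<open>The images are those of the Cuntz part rather than of the whole space, so that in the
  induction each generator V_\<alpha> y can be rewritten by applying the one-letter step to
  \<open>y\<close>.\<close>

lemma cuntz_subset_words: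
  "{x. pure_proj x = 0} \<subseteq> closure (cspan (\<Union>\<alpha>\<in>{\<alpha>. length \<alpha> = s}. op_word V \<alpha> ` {x. pure_proj x = 0}))"
    (is "?N \<subseteq> ?G s")
proof (induction s)
  case 0
  have "?N \<subseteq> (\<Union>\<alpha>\<in>{\<alpha>. length \<alpha> = 0}. op_word V \<alpha> ` ?N)" by simp
  also have "\<dots> \<subseteq> ?G 0"
    by (rule order_trans[OF complex_vector.span_superset closure_subset])
  finally show ?case .
next
  case (Suc s)
  have "?G s \<subseteq> ?G (Suc s)"
  proof (rule closure_cspan_least[OF _ closed_csubspace_closure_cspan], clarify)
    fix \<alpha> :: "'n list" and y assume s: "s = length \<alpha>" and y: "pure_proj y = 0"
    have "op_word V \<alpha> (V i z) \<in> ?G (Suc (length \<alpha>))" if "pure_proj z = 0" for i z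
    proof (intro subsetD[OF closure_subset] complex_vector.span_base UN_I)
      show "\<alpha> @ [i] \<in> {\<beta>. length \<beta> = Suc (length \<alpha>)}" by simp
      show "op_word V \<alpha> (V i z) \<in> op_word V (\<alpha> @ [i]) ` ?N"
        using that word_append[of \<alpha> "[i]" z] by (intro image_eqI[of _ _ z]) auto
    qed
    then have "(\<Union>i. V i ` ?N) \<subseteq> {z. op_word V \<alpha> z \<in> ?G (Suc (length \<alpha>))}"
      by auto
    then have "closure (cspan (\<Union>i. V i ` ?N)) \<subseteq> {z. op_word V \<alpha> z \<in> ?G (Suc (length \<alpha>))}"
      by (intro closure_cspan_least closed_csubspace_vimage bounded_word closed_csubspace_closure_cspan)
    then show "op_word V \<alpha> y \<in> ?G (Suc (length \<alpha>))"
      using cuntz_subset_step[OF y] by blast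
  qed
  with Suc show ?case by simp
qed

lemma cuntz_eq_Inter:
  "{x. pure_proj x = 0} = (\<Inter>s. hilbert_sum {\<alpha>. length \<alpha> = s} (\<lambda>\<alpha>. closure (range (op_word V \<alpha>))))"
proof
  have "op_word V \<alpha> ` {x. pure_proj x = 0} \<subseteq> closure (range (op_word V \<alpha>))" for \<alpha>
    using closure_subset[of "range (op_word V \<alpha>)"] by blast
  then have "closure (cspan (\<Union>\<alpha>\<in>{\<alpha>. length \<alpha> = s}. op_word V \<alpha> ` {x. pure_proj x = 0})) \<subseteq>
      hilbert_sum {\<alpha>. length \<alpha> = s} (\<lambda>\<alpha>. closure (range (op_word V \<alpha>)))" for s
    unfolding hilbert_sum_def by (intro closure_mono complex_vector.span_mono UN_mono) auto
  then show "{x. pure_proj x = 0} \<subseteq> (\<Inter>s. hilbert_sum {\<alpha>. length \<alpha> = s} (\<lambda>\<alpha>. closure (range (op_word V \<alpha>))))"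
    using cuntz_subset_words by blast
next
  \<comment> \<open>For fixed \<open>\<gamma>\<close> the level s = length \<gamma> + 1 suffices: a
    word longer than \<open>\<gamma>\<close> is not a prefix of it, so P V_\<gamma>^* kills every
    summand of that level.\<close>
  have "P (word_adj \<gamma> x) = 0"
    if x: "x \<in> hilbert_sum {\<alpha>. length \<alpha> = Suc (length \<gamma>)} (\<lambda>\<alpha>. closure (range (op_word V \<alpha>)))" for \<gamma> x
  proof -
    have cs: "closed_csubspace {z. P (word_adj \<gamma> z) \<in> {0}}"
      by (rule closed_csubspace_vimage[OF bounded_op_compose[OF bounded_P bounded_word_adj] closed_csubspace_zero])
    have "range (op_word V \<alpha>) \<subseteq> {z. P (word_adj \<gamma> z) \<in> {0}}" if "length \<alpha> = Suc (length \<gamma>)" for \<alpha>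
      using that by (auto intro!: P_adj_word_not_prefix)
    then have "closure (range (op_word V \<alpha>)) \<subseteq> {z. P (word_adj \<gamma> z) \<in> {0}}" if "length \<alpha> = Suc (length \<gamma>)" for \<alpha>
      using that cs by (intro closure_minimal) (auto simp: closed_csubspace_def)
    then have "hilbert_sum {\<alpha>. length \<alpha> = Suc (length \<gamma>)} (\<lambda>\<alpha>. closure (range (op_word V \<alpha>)))
        \<subseteq> {z. P (word_adj \<gamma> z) \<in> {0}}"
      unfolding hilbert_sum_def by (intro closure_cspan_least cs) blast
    with x show ?thesis by blast
  qed
  then show "(\<Inter>s. hilbert_sum {\<alpha>. length \<alpha> = s} (\<lambda>\<alpha>. closure (range (op_word V \<alpha>)))) \<subseteq> {x. pure_proj x = 0}"
    unfolding kernel_eq_0_iff[symmetric] kernel_eq_0_iff_cells by blast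
qed

end

theorem theorem5p7:
  fixes b :: "'n::finite list \<Rightarrow> real"
    and \<pi> :: "('n fock \<Rightarrow>\<^sub>L 'n fock) \<Rightarrow> ('k::chilbert_space \<Rightarrow>\<^sub>L 'k)"
    and V :: "'n \<Rightarrow> 'k \<Rightarrow> 'k"
    and \<Delta> :: "'k \<Rightarrow> 'k"
    and K :: "'k \<Rightarrow> ('n list, 'k) ell2"
    and \<D> K0 K1 :: "'k set"
  assumes "admissible b"
    and "summable (creation_defect_term b)"
    and "separable_space (euclidean :: 'k topology)"
    and "unital_star_representation (cstar_generated (range (weighted_creation b))) \<pi>"
    and "V = (\<lambda>i. blinfun_apply (\<pi> (weighted_creation b i)))"
    and "\<Delta> = defect b UNIV V"
    and "\<D> = range \<Delta>"
    and "K = berezin_kernel b UNIV V"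
    and "K0 = adj_on UNIV K ` fock_tensor (closure (range \<Delta>))"
    and "K1 = {h. K h = 0}"
  shows "V \<in> nc_domain b UNIV \<and>
    partial_isometry UNIV (fock_tensor (closure (range \<Delta>))) K \<and>
    wold_decomposition b V K0 K1 \<and>
    orthogonal_projection \<Delta> \<and>
    unitary_op K0 (fock_tensor \<D>) (restrict K K0) \<and>
    (\<forall>i. \<forall>h\<in>K0. restrict (V i) K0 h =
      adj_on K0 (restrict K K0) (tensor_id (weighted_creation b i) \<D> (restrict K K0 h))) \<and>
    (\<forall>M N. wold_decomposition b V M N \<longrightarrow> M = K0 \<and> N = K1) \<and>
    orthogonal_family UNIV (\<lambda>\<alpha>. op_word V \<alpha> ` \<D>) \<and>
    K0 = hilbert_sum UNIV (\<lambda>\<alpha>. op_word V \<alpha> ` \<D>) \<and>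
    orthogonal_family UNIV (\<lambda>i. closure (range (V i))) \<and>
    \<D> = orth_complement (hilbert_sum UNIV (\<lambda>i. closure (range (V i)))) \<and>
    (\<forall>s. orthogonal_family {\<alpha>. length \<alpha> = s} (\<lambda>\<alpha>. closure (range (op_word V \<alpha>)))) \<and>
    K1 = (\<Inter>s. hilbert_sum {\<alpha>. length \<alpha> = s} (\<lambda>\<alpha>. closure (range (op_word V \<alpha>))))"
proof -
  define P where "P = blinfun_apply (\<pi> (\<Sum>p. creation_defect_term b p))"
  interpret wold_model b V P
    unfolding P_def \<open>V = _\<close> by (rule wold_model_representation[OF assms(1,2,4)])
  have \<Delta>: "\<Delta> = P"
    using \<open>\<Delta> = _\<close> by (simp add: defect_eq)
  have K: "K = kernel"
    using \<open>K = _\<close> by (simp add: berezin_kernel_eq)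
  have \<D>: "\<D> = range P"
    using \<open>\<D> = _\<close> by (simp add: \<Delta>)
  have K0: "K0 = range pure_proj"
    \<comment> \<open>The defect space is the range of a projection, hence closed, and the closure
      in the target of the kernel disappears.\<close>
    using \<open>K0 = _\<close> by (simp add: K \<Delta> closure_range_P adj_kernel_image)
  have K1: "K1 = {x. pure_proj x = 0}"
    using \<open>K1 = _\<close> by (simp add: K kernel_eq_0_iff)
  have intertwine: "restrict (V i) K0 h =
      adj_on K0 (restrict K K0) (tensor_id (weighted_creation b i) \<D> (restrict K K0 h))" if "h \<in> K0" for i h
  proof -
    obtain B where "\<And>\<beta>. \<bar>sqrt (b \<beta> / b (i # \<beta>))\<bar> \<le> B"
      using creation_weight_bounded[OF assms(1)] by blast
    from intertwining[OF this weighted_creation_eq[OF assms(1)]] that show ?thesis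
      by (simp add: K0 K \<D>)
  qed
  show ?thesis
    unfolding K0 K1 K \<Delta> \<D> closure_range_P
    by (intro conjI allI ballI impI nc_domain_V partial_isometry_kernel wold_decomposition
        orthogonal_projection_P unitary_kernel intertwine[unfolded K0 K \<D>]
        wold_decomposition_unique orthogonal_family_cells pure_eq_hilbert_sum
        orthogonal_family_V range_P_eq orthogonal_family_words cuntz_eq_Inter)
qed

end
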